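(* Let $g,\varphi$ be entire functions on $\mathbb{C}$ such that $V_{(g,\varphi)}\in\mathcal{T}$. If $V_{(g,\varphi)}$ is not compact, then it is a Fredholm operator with $\operatorname{ind}V_{(g,\varphi)}=-2$.
   Context: $\mu$ is the Gaussian measure $d\mu(z)=\frac1\pi e^{-|z|^2}dz$ on $\mathbb{C}$, and $F^2=L^2(\mathbb{C},\mu)\cap\operatorname{Hol}(\mathbb{C})$ is the Fock space. Let $P$ be the orthogonal projection of $L^2(\mathbb{C},\mu)$ onto $F^2$; for $f\in L^\infty(\mathbb{C})$ the Toeplitz operator is $T_f g=P(fg)$, $g\in F^2$. The Toeplitz algebra $\mathcal{T}\subset\mathcal{L}(F^2)$ is the $C^*$-algebra generated by all $T_f$, $f\in L^\infty(\mathbb{C})$. For entire $g,\varphi$ the generalized Volterra-type operator is $V_{(g,\varphi)}f(z)=\int_0^z f(\varphi(w))\,g'(w)\,dw$; $V_{(g,\varphi)}\in\mathcal{T}$ means that it acts as a bounded operator on $F^2$ which lies in $\mathcal{T}$. The Fredholm index is $\operatorname{ind}A=\dim\ker A-\dim\ker A^*$. *)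

theory Defs
  imports "HOL-Complex_Analysis.Complex_Analysis"
begin

section \<open>The Fock space\<close>

definition gauss :: "complex measure" where
  "gauss = density lborel (\<lambda>z. ennreal (exp (- (cmod z)\<^sup>2) / pi))"

lemma sets_gauss [simp, measurable_cong]: "sets gauss = sets borel"
  by (simp add: gauss_def)

lemma space_gauss [simp]: "space gauss = UNIV"
  by (simp add: gauss_def)

lemma AE_gauss_iff: "(AE z in gauss. P z) \<longleftrightarrow> (AE z in lborel. P z)"
proof -
  have "0 < exp (- (cmod z)\<^sup>2) / pi" for z :: complex
    by simp
  then show ?thesis
    unfolding gauss_def by (subst AE_density) auto
qed

definition fock_space :: "(complex \<Rightarrow> complex) set" where
  "fock_space = {f. f holomorphic_on UNIV \<and> integrable gauss (\<lambda>z. (cmod (f z))\<^sup>2)}"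

lemma holomorphic_imp_borel:
  "f holomorphic_on UNIV \<Longrightarrow> f \<in> borel_measurable gauss"
  by (subst measurable_cong_sets[OF sets_gauss refl])
     (intro borel_measurable_continuous_onI holomorphic_on_imp_continuous_on)

lemma fock_space_borel: "f \<in> fock_space \<Longrightarrow> f \<in> borel_measurable gauss"
  by (simp add: fock_space_def holomorphic_imp_borel)

lemma fock_space_mult_integrable:
  assumes f: "f \<in> fock_space" and g: "g \<in> fock_space"
  shows "integrable gauss (\<lambda>z. f z * cnj (g z))"
proof (rule Bochner_Integration.integrable_bound)
  show "integrable gauss (\<lambda>z. (cmod (f z))\<^sup>2 + (cmod (g z))\<^sup>2)"
    using f g by (simp add: fock_space_def)
  have [measurable]: "f \<in> borel_measurable gauss" "g \<in> borel_measurable gauss"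
    using f g by (auto intro: fock_space_borel)
  have [measurable]: "cnj \<in> borel_measurable borel"
    by (intro borel_measurable_continuous_onI continuous_intros)
  show "(\<lambda>z. f z * cnj (g z)) \<in> borel_measurable gauss"
    by measurable
  have "a * b \<le> a\<^sup>2 + b\<^sup>2" if "a \<ge> 0" "b \<ge> 0" for a b :: real
    using sum_squares_bound[of a b] mult_nonneg_nonneg[OF that] by linarith
  then show "AE z in gauss. norm (f z * cnj (g z)) \<le> norm ((cmod (f z))\<^sup>2 + (cmod (g z))\<^sup>2)"
    by (simp add: norm_mult)
qed

lemma fock_space_zero: "(\<lambda>_. 0) \<in> fock_space"
  by (simp add: fock_space_def)

lemma fock_space_scale: "f \<in> fock_space \<Longrightarrow> (\<lambda>z. c * f z) \<in> fock_space"
  by (auto simp: fock_space_def norm_mult power_mult_distrib intro!: holomorphic_intros)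

lemma fock_space_add:
  assumes f: "f \<in> fock_space" and g: "g \<in> fock_space"
  shows "(\<lambda>z. f z + g z) \<in> fock_space"
proof -
  have "integrable gauss (\<lambda>z. (cmod (f z + g z))\<^sup>2)"
  proof (rule Bochner_Integration.integrable_bound)
    show "integrable gauss (\<lambda>z. 2 * (cmod (f z))\<^sup>2 + 2 * (cmod (g z))\<^sup>2)"
      using f g by (simp add: fock_space_def)
    have [measurable]: "f \<in> borel_measurable gauss" "g \<in> borel_measurable gauss"
      using f g by (auto intro: fock_space_borel)
    show "(\<lambda>z. (cmod (f z + g z))\<^sup>2) \<in> borel_measurable gauss"
      by measurable
    have "(cmod (a + b))\<^sup>2 \<le> 2 * (cmod a)\<^sup>2 + 2 * (cmod b)\<^sup>2" for a b :: complex
    proof -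
      have "(cmod (a + b))\<^sup>2 \<le> (cmod a + cmod b)\<^sup>2"
        by (intro power_mono norm_triangle_ineq) auto
      also have "\<dots> \<le> 2 * (cmod a)\<^sup>2 + 2 * (cmod b)\<^sup>2"
        using sum_squares_bound[of "cmod a" "cmod b"] by (simp add: power2_sum)
      finally show ?thesis .
    qed
    then show "AE z in gauss. norm ((cmod (f z + g z))\<^sup>2)
                 \<le> norm (2 * (cmod (f z))\<^sup>2 + 2 * (cmod (g z))\<^sup>2)"
      by simp
  qed
  then show ?thesis
    using f g by (auto simp: fock_space_def intro!: holomorphic_intros)
qed

lemma fock_space_eq_zero:
  assumes f: "f \<in> fock_space" and 0: "(\<integral>z. (cmod (f z))\<^sup>2 \<partial>gauss) = 0"
  shows "f z = 0"
proof -
  have "AE z in gauss. (cmod (f z))\<^sup>2 = 0"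
    using f 0 by (subst integral_nonneg_eq_0_iff_AE[symmetric]) (auto simp: fock_space_def)
  then have ae: "AE z in lborel. f z = 0"
    by (simp add: AE_gauss_iff)
  have "continuous_on UNIV f"
    using f by (simp add: fock_space_def holomorphic_on_imp_continuous_on)
  then have op: "open {z. f z \<noteq> 0}"
    by (intro open_Collect_neq) auto
  have "emeasure lborel {z. f z \<noteq> 0} = 0"
    using ae op by (subst AE_iff_measurable[symmetric, where P = "\<lambda>z. f z = 0"]) auto
  then have "negligible {z. f z \<noteq> 0}"
    using op by (simp add: negligible_iff_null_sets null_sets_def)
  then have "{z. f z \<noteq> 0} = {}"
    using op open_not_negligible by blast
  then show ?thesis
    by auto
qed

typedef fock = fock_space
  morphisms fock_fun Fock
  using fock_space_zero by blast

setup_lifting type_definition_fock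

instantiation fock :: ab_group_add
begin

lift_definition zero_fock :: fock is "\<lambda>_. 0"
  by (rule fock_space_zero)

lift_definition plus_fock :: "fock \<Rightarrow> fock \<Rightarrow> fock" is "\<lambda>f g z. f z + g z"
  by (rule fock_space_add)

lift_definition uminus_fock :: "fock \<Rightarrow> fock" is "\<lambda>f z. - f z"
  using fock_space_scale[where c = "-1"] by simp

definition minus_fock :: "fock \<Rightarrow> fock \<Rightarrow> fock" where
  "f - g = f + - g" for f g :: fock

instance
  by standard (unfold minus_fock_def, (transfer, auto)+)

end

lift_definition scaleC :: "complex \<Rightarrow> fock \<Rightarrow> fock"  (infixr \<open>*\<^sub>C\<close> 75) is "\<lambda>c f z. c * f z"
  by (rule fock_space_scale)

text \<open>Dimensions of subspaces of the Fock space are complex dimensions.\<close>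

interpretation fock: vector_space scaleC
  by standard (transfer, auto simp: algebra_simps)+

lift_definition fock_inner :: "fock \<Rightarrow> fock \<Rightarrow> complex" is
  "\<lambda>f g. \<integral>z. f z * cnj (g z) \<partial>gauss" .

lemma fock_inner_add: "fock_inner (f + g) h = fock_inner f h + fock_inner g h"
  by transfer (simp add: distrib_right fock_space_mult_integrable)

lemma fock_inner_scaleC: "fock_inner (c *\<^sub>C f) g = c * fock_inner f g"
  by transfer (simp add: mult.assoc)

lemma fock_inner_commute: "fock_inner f g = cnj (fock_inner g f)"
  by transfer (simp add: mult.commute flip: Bochner_Integration.integral_cnj)

lemma fock_inner_self:
  "fock_inner f f = of_real (\<integral>z. (cmod (fock_fun f z))\<^sup>2 \<partial>gauss)"
  by transfer (simp flip: complex_norm_square integral_complex_of_real)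

instantiation fock :: real_vector
begin

definition scaleR_fock :: "real \<Rightarrow> fock \<Rightarrow> fock" where
  "r *\<^sub>R f = of_real r *\<^sub>C f" for f :: fock

instance
  by standard (simp_all add: scaleR_fock_def fock.scale_right_distrib fock.scale_left_distrib)

end

text \<open>The real inner product underlying the Hermitian one induces the same norm.\<close>

instantiation fock :: real_inner
begin

definition inner_fock :: "fock \<Rightarrow> fock \<Rightarrow> real" where
  "inner f g = Re (fock_inner f g)" for f g :: fock

definition norm_fock :: "fock \<Rightarrow> real" where
  "norm f = sqrt (inner f f)" for f :: fock

definition sgn_fock :: "fock \<Rightarrow> fock" where
  "sgn f = f /\<^sub>R norm f" for f :: fock

definition dist_fock :: "fock \<Rightarrow> fock \<Rightarrow> real" where
  "dist f g = norm (f - g)" for f g :: fock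

definition uniformity_fock :: "(fock \<times> fock) filter" where
  "uniformity = (INF e\<in>{0<..}. principal {(f :: fock, g). dist f g < e})"

definition open_fock :: "fock set \<Rightarrow> bool" where
  "open U \<longleftrightarrow> (\<forall>f\<in>U. eventually (\<lambda>(f', g). f' = f \<longrightarrow> g \<in> U) uniformity)" for U :: "fock set"

instance
proof
  fix f g h :: fock and a :: real and U :: "fock set"
  show "dist f g = norm (f - g)" "sgn f = f /\<^sub>R norm f" "norm f = sqrt (inner f f)"
    "uniformity = (INF e\<in>{0<..}. principal {(f :: fock, g). dist f g < e})"
    "open U \<longleftrightarrow> (\<forall>f\<in>U. eventually (\<lambda>(f', g). f' = f \<longrightarrow> g \<in> U) uniformity)"
    by (simp_all add: dist_fock_def sgn_fock_def norm_fock_def uniformity_fock_def open_fock_def)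
  show "inner f g = inner g f"
    unfolding inner_fock_def by (subst fock_inner_commute) simp
  show "inner (f + g) h = inner f h + inner g h" "inner (a *\<^sub>R f) g = a * inner f g"
    by (simp_all add: inner_fock_def scaleR_fock_def fock_inner_add fock_inner_scaleC)
  show "0 \<le> inner f f"
    by (simp add: inner_fock_def fock_inner_self)
  have "f = 0" if "(\<integral>z. (cmod (fock_fun f z))\<^sup>2 \<partial>gauss) = 0"
    using that by transfer (auto dest: fock_space_eq_zero)
  moreover have "(\<integral>z. (cmod (fock_fun 0 z))\<^sup>2 \<partial>gauss) = 0"
    by transfer simp
  ultimately show "inner f f = 0 \<longleftrightarrow> f = 0"
    by (auto simp: inner_fock_def fock_inner_self)
qed

end

lemma norm_scaleC: "norm (c *\<^sub>C f) = cmod c * norm f"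
proof -
  have "inner (c *\<^sub>C f) (c *\<^sub>C f) = (cmod c)\<^sup>2 * inner f f"
    unfolding inner_fock_def fock_inner_self
    by transfer (simp add: norm_mult power_mult_distrib)
  then show ?thesis
    by (simp add: norm_eq_sqrt_inner real_sqrt_mult)
qed

section \<open>Operators on the Fock space\<close>

text \<open>
  The type \<open>fock \<Rightarrow>\<^sub>L fock\<close> consists of the bounded real-linear operators;
  \<open>fock_operators\<close> is the set of bounded complex-linear ones.
\<close>

definition fock_operators :: "(fock \<Rightarrow>\<^sub>L fock) set" where
  "fock_operators = {A. \<forall>c f. blinfun_apply A (c *\<^sub>C f) = c *\<^sub>C blinfun_apply A f}"

definition op_scaleC :: "complex \<Rightarrow> (fock \<Rightarrow>\<^sub>L fock) \<Rightarrow> (fock \<Rightarrow>\<^sub>L fock)" where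
  "op_scaleC c A = Blinfun (\<lambda>f. c *\<^sub>C blinfun_apply A f)"

lemma op_scaleC_apply: "blinfun_apply (op_scaleC c A) f = c *\<^sub>C blinfun_apply A f"
proof -
  have "bounded_linear (scaleC c)"
    by (rule bounded_linear_intro[where K = "cmod c"])
       (simp_all add: fock.scale_right_distrib scaleR_fock_def norm_scaleC mult.commute)
  then have "bounded_linear (\<lambda>f. c *\<^sub>C blinfun_apply A f)"
    by (rule bounded_linear_compose[OF _ blinfun.bounded_linear_right])
  then show ?thesis
    by (simp add: op_scaleC_def bounded_linear_Blinfun_apply)
qed

definition op_adjoint :: "(fock \<Rightarrow>\<^sub>L fock) \<Rightarrow> (fock \<Rightarrow>\<^sub>L fock)" where
  "op_adjoint A = (THE B. \<forall>f g. fock_inner (blinfun_apply A f) g = fock_inner f (blinfun_apply B g))"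

definition compact_operator :: "(fock \<Rightarrow>\<^sub>L fock) \<Rightarrow> bool" where
  "compact_operator A \<longleftrightarrow> compact (closure (blinfun_apply A ` cball 0 1))"

definition op_kernel :: "(fock \<Rightarrow>\<^sub>L fock) \<Rightarrow> fock set" where
  "op_kernel A = {f. blinfun_apply A f = 0}"

definition fin_dim :: "fock set \<Rightarrow> bool" where
  "fin_dim U \<longleftrightarrow> (\<exists>B. finite B \<and> U \<subseteq> fock.span B)"

definition fredholm :: "(fock \<Rightarrow>\<^sub>L fock) \<Rightarrow> bool" where
  "fredholm A \<longleftrightarrow> A \<in> fock_operators \<and> closed (range (blinfun_apply A)) \<and>
     fin_dim (op_kernel A) \<and> fin_dim (op_kernel (op_adjoint A))"

definition fredholm_index :: "(fock \<Rightarrow>\<^sub>L fock) \<Rightarrow> int" where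
  "fredholm_index A = int (fock.dim (op_kernel A)) - int (fock.dim (op_kernel (op_adjoint A)))"

section \<open>Toeplitz operators and the Toeplitz algebra\<close>

text \<open>Only meaningful for \<open>h\<close> square-integrable with respect to \<^const>\<open>gauss\<close>.\<close>

definition fock_proj :: "(complex \<Rightarrow> complex) \<Rightarrow> fock" where
  "fock_proj h = (THE p. \<forall>k. (\<integral>z. (h z - fock_fun p z) * cnj (fock_fun k z) \<partial>gauss) = 0)"

definition L_infinity :: "(complex \<Rightarrow> complex) set" where
  "L_infinity = {f \<in> borel_measurable borel. \<exists>C. AE z in lborel. cmod (f z) \<le> C}"

definition toeplitz :: "(complex \<Rightarrow> complex) \<Rightarrow> (fock \<Rightarrow>\<^sub>L fock)" where
  "toeplitz f = Blinfun (\<lambda>g. fock_proj (\<lambda>z. f z * fock_fun g z))"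

definition cstar_subalgebra :: "(fock \<Rightarrow>\<^sub>L fock) set \<Rightarrow> bool" where
  "cstar_subalgebra S \<longleftrightarrow> S \<subseteq> fock_operators \<and> closed S \<and> 0 \<in> S \<and>
     (\<forall>A\<in>S. \<forall>B\<in>S. A + B \<in> S \<and> A o\<^sub>L B \<in> S) \<and>
     (\<forall>A\<in>S. op_adjoint A \<in> S \<and> (\<forall>c. op_scaleC c A \<in> S))"

definition toeplitz_algebra :: "(fock \<Rightarrow>\<^sub>L fock) set" where
  "toeplitz_algebra = cstar_subalgebra hull (toeplitz ` L_infinity)"

section \<open>Generalized Volterra-type operators\<close>

definition volterra ::
  "(complex \<Rightarrow> complex) \<Rightarrow> (complex \<Rightarrow> complex) \<Rightarrow> (complex \<Rightarrow> complex) \<Rightarrow> complex \<Rightarrow> complex" where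
  "volterra g \<phi> f z = contour_integral (linepath 0 z) (\<lambda>w. f (\<phi> w) * deriv g w)"

end

(*
  V f' = f(phi) g', so testing V on the reproducing kernel at phi(z) bounds
  m(z) = |g'(z)| exp((|phi(z)|^2 - |z|^2)/2) / (1 + |z|), and this forces phi(z) = a z + b.
  Conjugating an operator A of the Toeplitz algebra by the Weyl unitaries W_z gives, for each f, a
  precompact orbit {W_{-z} A W_z f}: this property is stable under the C*-operations and holds for
  Toeplitz operators. It makes m(z) small wherever phi(z) is far from z, and m -> 0 at infinity
  makes V compact by a Littlewood-Paley estimate. Hence a = 1, and Liouville's theorem gives
  g'(z) = exp(-conj(b) z) (alpha z + beta) with alpha nonzero. Then V is injective and its range is
  {F. F(0) = 0, F'(-beta/alpha) = 0}, which has codimension two.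
*)
theory Submission
  imports Defs "HOL-Probability.Distributions"
begin

subsection \<open>Gaussian moments and Parseval's identity\<close>

text \<open>Why Toeplitz orbits are precompact: a conjugate of T_F by a Weyl unitary is bounded by
  |<u, g>| <= C int |f||g| dmu for its value u at f, with C and f independent of the translation.
  The vectors u dominated in this way form a compact set, because on it locally uniform convergence,
  supplied by Montel, forces norm convergence. Why m becomes small: \<open>weyl w fock_one\<close>
  is the normalized reproducing kernel at w. Each member of a finite net of the orbit is
  o(exp(|z|^2/2)), so the decay away from w is uniform in w. The factor 1 + |z| in m is the price of
  differentiation: Cauchy's estimate is made on a circle of radius 1/(1 + |z|), where the Gaussian
  weight changes only by a bounded factor. The analytic estimates come from power series. Parseval
  for rotation-invariant weights gives the pointwise bounds and two comparisons of F with F': one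
  bounds V f through its derivative, the other shows that F' divided by a linear factor stays in the
  space, which identifies the range.\<close>

lemma nn_integral_lborel_translate:
  fixes f :: "'a::euclidean_space \<Rightarrow> ennreal"
  assumes [measurable]: "f \<in> borel_measurable borel"
  shows "(\<integral>\<^sup>+x. f (x + c) \<partial>lborel) = (\<integral>\<^sup>+x. f x \<partial>lborel)"
proof -
  have "(\<integral>\<^sup>+x. f x \<partial>lborel) = (\<integral>\<^sup>+x. f x \<partial>distr lborel borel ((+) c))"
    by (simp only: lborel_distr_plus)
  also have "\<dots> = (\<integral>\<^sup>+x. f (c + x) \<partial>lborel)"
    by (rule nn_integral_distr) auto
  finally show ?thesis
    by (simp add: add.commute)
qed

text \<open>Fubini against the unit disc takes the place of a change of variables: for fixed y the
  condition |y - c x| < 1 describes a disc of radius 1/|c| in x, and the ratio of the two areas is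
  the Jacobian of multiplication by c.\<close>

lemma nn_integral_lborel_cmult:
  fixes f :: "complex \<Rightarrow> ennreal"
  assumes [measurable]: "f \<in> borel_measurable borel" and c: "c \<noteq> 0"
  shows "(\<integral>\<^sup>+x. f (c * x) \<partial>lborel) = ennreal (1 / (cmod c)\<^sup>2) * (\<integral>\<^sup>+x. f x \<partial>lborel)"
proof -
  let ?B = "\<lambda>y. indicator (ball 0 1) (y::complex) :: ennreal"
  have meas: "(\<lambda>p. k (h p)) \<in> borel_measurable (lborel \<Otimes>\<^sub>M lborel)"
    if "continuous_on UNIV h" "k \<in> borel_measurable borel"
    for h :: "complex \<times> complex \<Rightarrow> complex" and k :: "complex \<Rightarrow> ennreal"
    using measurable_compose[OF borel_measurable_continuous_onI[OF that(1)] that(2)]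
    by (simp add: lborel_prod)
  have [measurable]: "?B \<in> borel_measurable borel"
    by (rule borel_measurable_indicator) simp
  have m1: "(\<lambda>p. ?B (snd p) * f (c * fst p + snd p)) \<in> borel_measurable (lborel \<Otimes>\<^sub>M lborel)"
    by (intro borel_measurable_times_ennreal meas[of snd ?B] meas[of "\<lambda>p. c * fst p + snd p" f] continuous_intros)
       measurable
  have m2: "(\<lambda>p. ?B (fst p - c * snd p) * f (fst p)) \<in> borel_measurable (lborel \<Otimes>\<^sub>M lborel)"
    by (intro borel_measurable_times_ennreal meas[of "\<lambda>p. fst p - c * snd p" ?B] meas[of fst f] continuous_intros)
       measurable
  have vol: "emeasure lborel (ball z r) = ennreal pi * ennreal (r\<^sup>2)" if "0 \<le> r" for z :: complex and r
    using that by (simp add: emeasure_ball unit_ball_vol_2 flip: ennreal_mult)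
  have "ennreal pi * (\<integral>\<^sup>+x. f (c * x) \<partial>lborel) = (\<integral>\<^sup>+y. ?B y * (\<integral>\<^sup>+x. f (c * x) \<partial>lborel) \<partial>lborel)"
    using vol[of 1 0] by (subst nn_integral_multc) (auto intro!: borel_measurable_indicator)
  \<comment> \<open>The shift by y / c leaves the inner integral unchanged and brings y into the
    argument of f as c x + y.\<close>
  also have "\<dots> = (\<integral>\<^sup>+y. ?B y * (\<integral>\<^sup>+x. f (c * (x + y / c)) \<partial>lborel) \<partial>lborel)"
    by (subst nn_integral_lborel_translate[where f = "\<lambda>x. f (c * x)"]) auto
  also have "\<dots> = (\<integral>\<^sup>+y. (\<integral>\<^sup>+x. ?B y * f (c * x + y) \<partial>lborel) \<partial>lborel)"
    using c by (simp add: nn_integral_cmult distrib_left)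
  also have "\<dots> = (\<integral>\<^sup>+x. (\<integral>\<^sup>+y. ?B y * f (c * x + y) \<partial>lborel) \<partial>lborel)"
    by (rule lborel_pair.Fubini'[where f = "\<lambda>x y. ?B y * f (c * x + y)"])
       (use m1 in \<open>simp add: split_beta'\<close>)
  also have "\<dots> = (\<integral>\<^sup>+x. (\<integral>\<^sup>+y. ?B (y - c * x) * f y \<partial>lborel) \<partial>lborel)"
  proof -
    have "(\<integral>\<^sup>+y. ?B y * f (c * x + y) \<partial>lborel) = (\<integral>\<^sup>+y. ?B (y - c * x) * f y \<partial>lborel)" for x
      using nn_integral_lborel_translate[of "\<lambda>y. ?B (y - c * x) * f y" "c * x"]
      by (simp add: add.commute)
    then show ?thesis by simp
  qed
  also have "\<dots> = (\<integral>\<^sup>+y. (\<integral>\<^sup>+x. ?B (y - c * x) * f y \<partial>lborel) \<partial>lborel)"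
    by (rule lborel_pair.Fubini'[where f = "\<lambda>y x. ?B (y - c * x) * f y"])
       (use m2 in \<open>simp add: split_beta'\<close>)
  also have "\<dots> = (\<integral>\<^sup>+y. emeasure lborel (ball (y / c) (1 / cmod c)) * f y \<partial>lborel)"
  proof -
    have "?B (y - c * x) = indicator (ball (y / c) (1 / cmod c)) x" for x y
    proof -
      have "y - c * x = c * (y / c - x)"
        using c by (simp add: right_diff_distrib)
      then have "cmod (y - c * x) = cmod c * cmod (y / c - x)"
        by (metis norm_mult)
      then have "cmod (y - c * x) < 1 \<longleftrightarrow> cmod (y / c - x) < 1 / cmod c"
        using c by (simp only: pos_less_divide_eq zero_less_norm_iff not_False_eq_True mult.commute)
      then show ?thesis
        by (simp add: indicator_def dist_norm norm_minus_commute)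
    qed
    moreover have "(\<integral>\<^sup>+x. indicator (ball a r) x * k \<partial>lborel) = emeasure lborel (ball a r) * k"
      for a :: complex and r k
      by (subst nn_integral_multc) (auto intro!: borel_measurable_indicator)
    ultimately show ?thesis
      by simp
  qed
  also have "\<dots> = ennreal pi * (ennreal (1 / (cmod c)\<^sup>2) * (\<integral>\<^sup>+y. f y \<partial>lborel))"
    by (simp add: vol nn_integral_cmult power_divide mult.assoc)
  finally show ?thesis
    by (simp add: ennreal_mult_cancel_left)
qed

lemma nn_integral_gauss:
  assumes [measurable]: "f \<in> borel_measurable borel"
  shows "(\<integral>\<^sup>+z. f z \<partial>gauss) = (\<integral>\<^sup>+z. ennreal (exp (- (cmod z)\<^sup>2) / pi) * f z \<partial>lborel)"
  unfolding gauss_def by (subst nn_integral_density) auto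

lemma emeasure_gauss_UNIV: "emeasure gauss UNIV = 1"
proof -
  \<comment> \<open>Standard deviation 1 / sqrt 2 gives exp(-x^2) / sqrt pi, the factor of the
    Gaussian density belonging to one real coordinate.\<close>
  let ?n = "\<lambda>x. ennreal (normal_density 0 (1 / sqrt 2) x)"
  have "emeasure gauss UNIV = (\<integral>\<^sup>+z. ennreal (exp (- (cmod z)\<^sup>2) / pi) \<partial>lborel)"
    unfolding gauss_def by (subst emeasure_density) auto
  also have "\<dots> = (\<integral>\<^sup>+z. (\<Prod>b\<in>(Basis::complex set). ?n (z \<bullet> b)) \<partial>lborel)"
  proof (rule nn_integral_cong)
    fix z :: complex
    have "exp (- (cmod z)\<^sup>2) / pi = (exp (- (Re z)\<^sup>2) / sqrt pi) * (exp (- (Im z)\<^sup>2) / sqrt pi)"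
      by (simp add: cmod_power2 flip: exp_add)
    then show "ennreal (exp (- (cmod z)\<^sup>2) / pi) = (\<Prod>b\<in>Basis. ?n (z \<bullet> b))"
      by (simp add: Basis_complex_def normal_density_def power_divide inner_complex_def flip: ennreal_mult)
  qed
  also have "\<dots> = (\<Prod>b\<in>(Basis::complex set). (\<integral>\<^sup>+x. ?n x \<partial>lborel))"
    by (rule nn_integral_lborel_prod) auto
  also have "(\<integral>\<^sup>+x. ?n x \<partial>lborel) = 1"
    using prob_space.emeasure_space_1[OF prob_space_normal_density[of "1 / sqrt 2" 0]]
    by (simp add: emeasure_density)
  finally show ?thesis by simp
qed

lemma prob_space_gauss: "prob_space gauss"
  by standard (simp add: emeasure_gauss_UNIV)

interpretation gauss: prob_space gauss
  by (rule prob_space_gauss)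


lemma nn_integral_gauss_dilate:
  assumes s: "s > 0"
  shows "(\<integral>\<^sup>+z. ennreal (((cmod z)\<^sup>2) ^ n * exp (- s * (cmod z)\<^sup>2) / pi) \<partial>lborel)
    = ennreal (1 / s ^ Suc n) * (\<integral>\<^sup>+z. ennreal (((cmod z)\<^sup>2) ^ n * exp (- (cmod z)\<^sup>2) / pi) \<partial>lborel)"
proof -
  let ?F = "\<lambda>z. ennreal (((cmod z)\<^sup>2) ^ n * exp (- (cmod z)\<^sup>2) / pi)"
  have "(\<integral>\<^sup>+z. ennreal (((cmod z)\<^sup>2) ^ n * exp (- s * (cmod z)\<^sup>2) / pi) \<partial>lborel)
      = (\<integral>\<^sup>+z. ennreal (1 / s ^ n) * ?F (of_real (sqrt s) * z) \<partial>lborel)"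
    using s by (intro nn_integral_cong)
      (simp add: norm_mult power_mult_distrib abs_mult field_simps flip: ennreal_mult)
  also have "\<dots> = ennreal (1 / s ^ n) * (ennreal (1 / s) * (\<integral>\<^sup>+z. ?F z \<partial>lborel))"
    using s by (simp add: nn_integral_cmult nn_integral_lborel_cmult[where f = ?F])
  also have "\<dots> = ennreal (1 / s ^ Suc n) * (\<integral>\<^sup>+z. ?F z \<partial>lborel)"
    using s by (simp add: mult.commute flip: mult.assoc ennreal_mult)
  finally show ?thesis .
qed

text \<open>Differentiating the dilation identity in s at s = 1 would give M(n+1) = (n+1) M(n). The
  derivative is replaced by two inequalities for the dilation s = 1/t with t < 1, which close up as
  t tends to 1.\<close>

lemma gauss_moment: "(\<integral>\<^sup>+z. ennreal ((cmod z) ^ (2 * n)) \<partial>gauss) = ennreal (fact n)"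
proof -
  let ?E = "\<lambda>s n z. ennreal (((cmod z)\<^sup>2) ^ n * exp (- s * (cmod z)\<^sup>2) / pi)"
  let ?E1 = "\<lambda>n z. ennreal (((cmod z)\<^sup>2) ^ n * exp (- (cmod z)\<^sup>2) / pi)"
  define M where "M n = (\<integral>\<^sup>+z. ?E1 n z \<partial>lborel)" for n
  have M: "(\<integral>\<^sup>+z. ennreal ((cmod z) ^ (2 * n)) \<partial>gauss) = M n" for n
    unfolding M_def
    by (subst nn_integral_gauss, measurable)
       (auto intro!: nn_integral_cong simp: power_mult[of _ 2 n] simp flip: ennreal_mult)
  have "M n = ennreal (fact n)"
  proof (induction n)
    case 0
    show ?case
      using emeasure_gauss_UNIV M[of 0] by simp
  next
    case (Suc n)
    have bnd: "ennreal ((1 - t) * t ^ Suc n) * M (Suc n) + ennreal (t ^ Suc n) * M n \<le> M n"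
              "M n \<le> ennreal (t ^ Suc n) * M n + ennreal ((1 - t) / t) * M (Suc n)"
      if t: "0 < t" "t < 1" for t
    proof -
      \<comment> \<open>Both are 1 + y <= exp y, for y = (1/t - 1) x and for its negative: convexity
        bounds the difference quotient from the two sides.\<close>
      have e1: "(1/t - 1) * x * exp (-(1/t) * x) + exp (- (1/t) * x) \<le> exp (- x)"
       and e2: "exp (- x) \<le> exp (- (1/t) * x) + (1/t - 1) * x * exp (- x)" if "x \<ge> 0" for x :: real
      proof -
        let ?y = "(1/t - 1) * x"
        have eq: "exp (- x) = exp (- (1/t) * x) * exp ?y"
          by (simp add: algebra_simps flip: exp_add)
        have "(1 + ?y) \<le> exp ?y"
          by (rule exp_ge_add_one_self)
        then have "exp (- (1/t) * x) * (1 + ?y) \<le> exp (- (1/t) * x) * exp ?y"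
          by (intro mult_left_mono) auto
        then show "(1/t - 1) * x * exp (-(1/t) * x) + exp (- (1/t) * x) \<le> exp (- x)"
          unfolding eq by (simp add: algebra_simps)
        have eq2: "exp (- (1/t) * x) = exp (- x) * exp (-?y)"
          by (simp add: algebra_simps flip: exp_add)
        have "(1 + (-?y)) \<le> exp (-?y)"
          by (rule exp_ge_add_one_self)
        then have "exp (- x) * (1 - ?y) \<le> exp (- x) * exp (-?y)"
          by (intro mult_left_mono) auto
        then show "exp (- x) \<le> exp (- (1/t) * x) + (1/t - 1) * x * exp (- x)"
          unfolding eq2 by (simp add: algebra_simps)
      qed
      have D: "(\<integral>\<^sup>+z. ?E (1/t) n z \<partial>lborel) = ennreal (t ^ Suc n) * M n" for n
        unfolding M_def using t by (subst nn_integral_gauss_dilate) (auto simp: power_one_over)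
      have D': "(\<integral>\<^sup>+z. ennreal (((cmod z)\<^sup>2) ^ n * exp (- ((cmod z)\<^sup>2 / t)) / pi) \<partial>lborel) = ennreal (t ^ Suc n) * M n" for n
        using D[of n] by simp
      have alg: "P / pi * (k * x * E + E) = k * (x * P * E / pi) + P * E / pi"
                "P / pi * (E + k * x * E') = P * E / pi + k * (x * P * E' / pi)" for P k x E E' :: real
        by (simp_all add: algebra_simps add_divide_distrib)
      have enn: "k * A + B \<le> C \<Longrightarrow> ennreal k * ennreal A + ennreal B \<le> ennreal C"
                "C \<le> A + k * B \<Longrightarrow> ennreal C \<le> ennreal A + ennreal k * ennreal B"
        if "0 \<le> k" "0 \<le> A" "0 \<le> B" for k A B C
        using that by (simp_all only: ennreal_mult[symmetric] ennreal_plus[symmetric] mult_nonneg_nonneg ennreal_leI)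
      have t1: "1/t - 1 \<ge> 0" "(1/t - 1) * t = 1 - t" using t by (auto simp: field_simps)
      have eq: "ennreal ((1 - t) * t ^ Suc n) * M (Suc n) = ennreal (1/t - 1) * (ennreal (t ^ Suc (Suc n)) * M (Suc n))"
      proof -
        have "(1 - t) * t ^ Suc n = (1/t - 1) * t ^ Suc (Suc n)"
          using t by (simp add: field_simps)
        then show ?thesis
          using t t1 by (simp only: ennreal_mult mult.assoc zero_le_power less_imp_le)
      qed
      have "ennreal ((1 - t) * t ^ Suc n) * M (Suc n) + ennreal (t ^ Suc n) * M n
         = (\<integral>\<^sup>+z. ennreal (1/t - 1) * ?E (1/t) (Suc n) z
              + ?E (1/t) n z \<partial>lborel)"
        unfolding eq by (subst nn_integral_add) (auto simp: nn_integral_cmult D' simp del: power_Suc)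
      also have "\<dots> \<le> M n"
        unfolding M_def
      proof (rule nn_integral_mono)
        fix z :: complex
        have "((cmod z)\<^sup>2) ^ n / pi * ((1/t - 1) * (cmod z)\<^sup>2 * exp (-(1/t) * (cmod z)\<^sup>2) + exp (- (1/t) * (cmod z)\<^sup>2))
           \<le> ((cmod z)\<^sup>2) ^ n / pi * exp (- (cmod z)\<^sup>2)"
          by (intro mult_left_mono e1) auto
        then have "(1/t - 1) * (((cmod z)\<^sup>2) ^ Suc n * exp (- (1/t) * (cmod z)\<^sup>2) / pi) + ((cmod z)\<^sup>2) ^ n * exp (- (1/t) * (cmod z)\<^sup>2) / pi
            \<le> ((cmod z)\<^sup>2) ^ n * exp (- (cmod z)\<^sup>2) / pi"
          by (simp only: alg power_Suc) simp
        then show "ennreal (1/t - 1) * ?E (1/t) (Suc n) z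
              + ?E (1/t) n z \<le> ?E1 n z"
          by (rule enn(1)[OF t1(1), rotated 2]) simp_all
      qed
      finally show "ennreal ((1 - t) * t ^ Suc n) * M (Suc n) + ennreal (t ^ Suc n) * M n \<le> M n" .
      have "M n \<le> (\<integral>\<^sup>+z. ?E (1/t) n z
          + ennreal (1/t - 1) * ?E1 (Suc n) z \<partial>lborel)"
        unfolding M_def
      proof (rule nn_integral_mono)
        fix z :: complex
        have "((cmod z)\<^sup>2) ^ n / pi * exp (- (cmod z)\<^sup>2)
          \<le> ((cmod z)\<^sup>2) ^ n / pi * (exp (- (1/t) * (cmod z)\<^sup>2) + (1/t - 1) * (cmod z)\<^sup>2 * exp (- (cmod z)\<^sup>2))"
          by (intro mult_left_mono e2) auto
        then have "((cmod z)\<^sup>2) ^ n * exp (- (cmod z)\<^sup>2) / pi \<le> ((cmod z)\<^sup>2) ^ n * exp (- (1/t) * (cmod z)\<^sup>2) / pi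
          + (1/t - 1) * (((cmod z)\<^sup>2) ^ Suc n * exp (- (cmod z)\<^sup>2) / pi)"
          by (simp only: alg power_Suc) simp
        then show "?E1 n z \<le> ?E (1/t) n z
          + ennreal (1/t - 1) * ?E1 (Suc n) z"
          by (rule enn(2)[OF t1(1), rotated 2]) simp_all
      qed
      also have "\<dots> = ennreal (t ^ Suc n) * M n + ennreal (1/t - 1) * M (Suc n)"
        by (subst nn_integral_add) (auto simp: nn_integral_cmult D' M_def simp del: power_Suc)
      also have "1/t - 1 = (1 - t) / t"
        using t by (simp add: field_simps)
      finally show "M n \<le> ennreal (t ^ Suc n) * M n + ennreal ((1 - t) / t) * M (Suc n)" .
    qed
    \<comment> \<open>Finiteness has to precede any subtraction in \<open>ennreal\<close>; the first
      inequality at t = 1/2 already bounds a positive multiple of M(n+1) by M(n).\<close>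
    have "M (Suc n) \<noteq> \<infinity>"
    proof
      assume inf: "M (Suc n) = \<infinity>"
      have "ennreal ((1 - 1/2) * (1/2) ^ Suc n) * M (Suc n) = \<infinity>"
        unfolding inf by (simp add: ennreal_mult_eq_top_iff)
      then show False
        using bnd(1)[of "1/2"] Suc.IH by (simp add: top_unique)
    qed
    then obtain r where r: "M (Suc n) = ennreal r" "r \<ge> 0"
      by (cases "M (Suc n)") auto
    \<comment> \<open>The geometric sum exposes the factor 1 - t, which cancels; what remains is
      continuous at t = 1, where the sum has the value n + 1.\<close>
    have gp: "1 - t ^ Suc n = (1 - t) * (\<Sum>k\<le>n. t ^ k)" for t :: real
      using sum_gp0[of t n] by (cases "t = 1") auto
    have up: "t ^ Suc n * r \<le> fact n * (\<Sum>k\<le>n. t ^ k)" and lo: "fact n * (\<Sum>k\<le>n. t ^ k) \<le> r / t"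
      if t: "0 < t" "t < 1" for t :: real
    proof -
      have "ennreal ((1 - t) * t ^ Suc n * r + t ^ Suc n * fact n) \<le> ennreal (fact n)"
        using bnd(1)[OF t] t r by (simp add: Suc.IH ennreal_mult del: power_Suc)
      then have "(1 - t) * t ^ Suc n * r + t ^ Suc n * fact n \<le> fact n"
        by (subst (asm) ennreal_le_iff) auto
      moreover have "(1 - t) * (t ^ Suc n * r) = (1 - t) * t ^ Suc n * r"
        by (simp only: mult.assoc)
      moreover have "fact n * (1 - t ^ Suc n) = fact n - t ^ Suc n * fact n"
        by (simp only: right_diff_distrib mult_1_right mult.commute)
      ultimately have "(1 - t) * (t ^ Suc n * r) \<le> fact n * (1 - t ^ Suc n)"
        by linarith
      then have "(1 - t) * (t ^ Suc n * r) \<le> (1 - t) * (fact n * (\<Sum>k\<le>n. t ^ k))"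
        unfolding gp by (simp only: mult.left_commute)
      then show "t ^ Suc n * r \<le> fact n * (\<Sum>k\<le>n. t ^ k)"
        using t by simp
      have "ennreal (fact n) \<le> ennreal (t ^ Suc n * fact n + (1 - t) / t * r)"
      proof -
        have "0 \<le> (1 - t) / t" "0 \<le> t ^ Suc n"
          using t by auto
        then have "ennreal (t ^ Suc n * fact n + (1 - t) / t * r)
            = ennreal (t ^ Suc n) * ennreal (fact n) + ennreal ((1 - t) / t) * ennreal r"
          by (simp only: ennreal_mult ennreal_plus mult_nonneg_nonneg r fact_ge_zero)
        then show ?thesis
          using bnd(2)[OF t] by (simp only: Suc.IH r)
      qed
      then have "fact n \<le> t ^ Suc n * fact n + (1 - t) / t * r"
        by (subst (asm) ennreal_le_iff) (use t r in auto)
      then have "fact n * (1 - t ^ Suc n) \<le> (1 - t) * (r / t)"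
        by (simp add: algebra_simps del: power_Suc)
      then have "(1 - t) * (fact n * (\<Sum>k\<le>n. t ^ k)) \<le> (1 - t) * (r / t)"
        unfolding gp by (simp add: mult.left_commute)
      then show "fact n * (\<Sum>k\<le>n. t ^ k) \<le> r / t"
        using t by (simp only: mult_le_cancel_left_pos diff_gt_0_iff_gt)
    qed
    have ev: "eventually (\<lambda>t. 0 < t \<and> t < 1) (at_left (1::real))"
      using eventually_at_left_real[of 0 1] by (auto elim: eventually_mono)
    have L1: "((\<lambda>t. fact n * (\<Sum>k\<le>n. t ^ k)) \<longlongrightarrow> fact n * (\<Sum>k\<le>n. 1 ^ k)) (at_left (1::real))"
      by (intro tendsto_intros)
    have L2: "((\<lambda>t. t ^ Suc n * r) \<longlongrightarrow> 1 ^ Suc n * r) (at_left 1)"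
      by (intro tendsto_intros)
    have L3: "((\<lambda>t. r / t) \<longlongrightarrow> r / 1) (at_left 1)"
      by (intro tendsto_intros) auto
    have "1 ^ Suc n * r \<le> fact n * (\<Sum>k\<le>n. 1 ^ k)"
      by (rule tendsto_le[OF _ L1 L2]) (auto intro!: eventually_mono[OF ev] up simp del: power_Suc)
    moreover have "fact n * (\<Sum>k\<le>n. 1 ^ k) \<le> r / 1"
      by (rule tendsto_le[OF _ L3 L1]) (auto intro!: eventually_mono[OF ev] lo)
    ultimately have "r = fact (Suc n)"
      by (simp add: algebra_simps)
    then show ?case
      using r by simp
  qed
  then show ?thesis
    by (simp add: M)
qed


section \<open>Power series and orthogonality of monomials\<close>

definition taylor_coeff :: "(complex \<Rightarrow> complex) \<Rightarrow> nat \<Rightarrow> complex" where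
  "taylor_coeff f n = (deriv ^^ n) f 0 / fact n"

lemma entire_sums:
  assumes "f holomorphic_on UNIV"
  shows "(\<lambda>n. taylor_coeff f n * z ^ n) sums f z"
proof -
  have "z \<in> ball 0 (cmod z + 1)" by simp
  then have "((\<lambda>n. (deriv ^^ n) f 0 / fact n * (z - 0) ^ n) sums f z)"
    using assms by (intro holomorphic_power_series[where r = "cmod z + 1"]) (auto intro: holomorphic_on_subset)
  then show ?thesis
    by (simp add: taylor_coeff_def)
qed

lemma entire_summable_norm:
  assumes "f holomorphic_on UNIV"
  shows "summable (\<lambda>n. cmod (taylor_coeff f n) * R ^ n)"
proof -
  have "summable (\<lambda>n. taylor_coeff f n * (of_real (\<bar>R\<bar> + 1)) ^ n)"
    using entire_sums[OF assms] sums_summable by blast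
  then have "summable (\<lambda>n. norm (taylor_coeff f n * (of_real R) ^ n))"
    by (rule powser_insidea) simp
  then have "summable (\<lambda>n. norm (cmod (taylor_coeff f n) * R ^ n))"
    by (simp add: norm_mult norm_power abs_mult power_abs)
  then show ?thesis
    by (rule summable_norm_cancel)
qed

text \<open>A rotation makes distinct monomials orthogonal on each disc, and there the power series
  is dominated by a constant, so partial sums may be integrated. The discs are essential at first:
  \<nu> is only finite, so powers of |z| need not be integrable. Monotone convergence over integer
  radii then gives the identity in \<open>ennreal\<close>, where both sides may be infinite.\<close>

theorem parseval_rotation_invariant:
  fixes \<nu> :: "complex measure"
  assumes sets[measurable_cong]: "sets \<nu> = sets borel" and fin: "finite_measure \<nu>"
    and rot: "\<And>c. cmod c = 1 \<Longrightarrow> distr \<nu> borel ((*) c) = \<nu>"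
    and f: "f holomorphic_on UNIV"
  shows "(\<integral>\<^sup>+z. ennreal ((cmod (f z))\<^sup>2) \<partial>\<nu>)
    = (\<Sum>n. ennreal ((cmod (taylor_coeff f n))\<^sup>2) * (\<integral>\<^sup>+z. ennreal ((cmod z) ^ (2 * n)) \<partial>\<nu>))"
proof -
  let ?i = "\<lambda>R z. indicat_real (cball 0 R) z" and ?j = "\<lambda>R z. indicator (cball 0 R) z :: ennreal"
  interpret \<nu>: finite_measure \<nu> by fact
  define a where "a = taylor_coeff f"
  have cont: "continuous_on UNIV f"
    using f by (rule holomorphic_on_imp_continuous_on)
  have [measurable]: "f \<in> borel_measurable borel"
    using cont by (rule borel_measurable_continuous_onI)
  have [measurable]: "cnj \<in> borel_measurable borel"
    by (intro borel_measurable_continuous_onI continuous_intros)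
  have int: "integrable \<nu> (\<lambda>z. ?i R z *\<^sub>R h z)"
    if h: "continuous_on UNIV h" for R and h :: "complex \<Rightarrow> 'b::{banach, second_countable_topology}"
  proof -
    have [measurable]: "h \<in> borel_measurable borel"
      using h by (rule borel_measurable_continuous_onI)
    have "bounded (h ` cball 0 R)"
      by (intro compact_imp_bounded compact_continuous_image continuous_on_subset[OF h]) auto
    then obtain K where K: "\<And>z. z \<in> cball 0 R \<Longrightarrow> norm (h z) \<le> K"
      unfolding bounded_iff by blast
    show ?thesis
      by (rule \<nu>.integrable_const_bound[where B = "max K 0"])
         (auto simp: indicator_def le_max_iff_disj intro!: AE_I2 K)
  qed
  have orth: "(\<integral>z. ?i R z *\<^sub>R (z ^ n * cnj z ^ m) \<partial>\<nu>) = 0" if "n \<noteq> m" for n m R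
  proof -
    \<comment> \<open>Rotating by \<theta> multiplies the integrand by exp(i (n - m) \<theta>); this
      angle makes the factor -1, so the integral equals its own negative.\<close>
    define c where "c = cis (pi / (real n - real m))"
    let ?I = "\<integral>z. ?i R z *\<^sub>R (z ^ n * cnj z ^ m) \<partial>\<nu>"
    have c: "cmod c = 1" by (simp add: c_def)
    have [measurable]: "(\<lambda>z. ?i R z *\<^sub>R (z ^ n * cnj z ^ m)) \<in> borel_measurable borel"
      by (intro borel_measurable_scaleR borel_measurable_indicator borel_measurable_continuous_onI continuous_intros) auto
    have "c ^ n * cnj c ^ m = cis (pi / (real n - real m) * real n - pi / (real n - real m) * real m)"
      by (simp add: c_def Complex.DeMoivre cis_cnj cis_mult mult.commute)
    also have "pi / (real n - real m) * real n - pi / (real n - real m) * real m = pi / (real n - real m) * (real n - real m)"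
      by (simp only: right_diff_distrib)
    also have "\<dots> = pi"
      using that by simp
    finally have c2: "c ^ n * cnj c ^ m = -1" by simp
    have "?I = (\<integral>z. ?i R z *\<^sub>R (z ^ n * cnj z ^ m) \<partial>distr \<nu> borel ((*) c))"
      by (simp add: rot[OF c])
    also have "\<dots> = (\<integral>z. ?i R (c * z) *\<^sub>R ((c * z) ^ n * cnj (c * z) ^ m) \<partial>\<nu>)"
      by (subst integral_distr) auto
    also have "\<dots> = (\<integral>z. (c ^ n * cnj c ^ m) * (?i R z *\<^sub>R (z ^ n * cnj z ^ m)) \<partial>\<nu>)"
      by (intro Bochner_Integration.integral_cong refl)
         (auto simp: indicator_def norm_mult c power_mult_distrib)
    also have "\<dots> = - ?I"
      by (subst integral_mult_right_zero) (simp add: c2)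
    finally show ?thesis by simp
  qed
  define S where "S N z = (\<Sum>n<N. a n * z ^ n)" for N z
  have partial: "(\<integral>z. ?i R z *\<^sub>R (cmod (S N z))\<^sup>2 \<partial>\<nu>)
      = (\<Sum>n<N. (cmod (a n))\<^sup>2 * (\<integral>z. ?i R z *\<^sub>R (cmod z) ^ (2 * n) \<partial>\<nu>))" for N R
  proof -
    have "complex_of_real (\<integral>z. ?i R z *\<^sub>R (cmod (S N z))\<^sup>2 \<partial>\<nu>)
        = (\<integral>z. (\<Sum>n<N. \<Sum>m<N. (a n * cnj (a m)) * (?i R z *\<^sub>R (z ^ n * cnj z ^ m))) \<partial>\<nu>)"
      unfolding integral_complex_of_real[symmetric]
    proof (intro Bochner_Integration.integral_cong refl)
      fix z
      have "complex_of_real ((cmod (S N z))\<^sup>2) = S N z * cnj (S N z)"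
        by (rule complex_norm_square)
      also have "\<dots> = (\<Sum>n<N. \<Sum>m<N. (a n * cnj (a m)) * (z ^ n * cnj z ^ m))"
        by (simp add: S_def sum_product algebra_simps)
      finally show "complex_of_real (?i R z *\<^sub>R (cmod (S N z))\<^sup>2) =
          (\<Sum>n<N. \<Sum>m<N. (a n * cnj (a m)) * (?i R z *\<^sub>R (z ^ n * cnj z ^ m)))"
        by (auto simp: indicator_def)
    qed
    also have "\<dots> = (\<Sum>n<N. \<Sum>m<N. (a n * cnj (a m)) * (\<integral>z. ?i R z *\<^sub>R (z ^ n * cnj z ^ m) \<partial>\<nu>))"
      by (subst Bochner_Integration.integral_sum, intro Bochner_Integration.integrable_sum integrable_mult_right int continuous_intros,
          intro sum.cong refl, subst Bochner_Integration.integral_sum, intro integrable_mult_right int continuous_intros,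
          simp only: integral_mult_right_zero)
    also have "\<dots> = (\<Sum>n<N. \<Sum>m<N. if m = n then (a n * cnj (a n)) * (\<integral>z. ?i R z *\<^sub>R (z ^ n * cnj z ^ n) \<partial>\<nu>) else 0)"
      by (intro sum.cong refl) (auto simp: orth)
    also have "\<dots> = (\<Sum>n<N. (a n * cnj (a n)) * (\<integral>z. ?i R z *\<^sub>R (z ^ n * cnj z ^ n) \<partial>\<nu>))"
      by simp
    also have "\<dots> = complex_of_real (\<Sum>n<N. (cmod (a n))\<^sup>2 * (\<integral>z. ?i R z *\<^sub>R (cmod z) ^ (2 * n) \<partial>\<nu>))"
    proof -
      have "complex_of_real ((cmod z) ^ (2 * n)) = (complex_of_real ((cmod z)\<^sup>2)) ^ n" for z n
        by (simp add: power_mult)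
      then have pw: "z ^ n * cnj z ^ n = complex_of_real ((cmod z) ^ (2 * n))" for z n
        by (simp only: complex_norm_square power_mult_distrib)
      have "(\<integral>z. ?i R z *\<^sub>R (z ^ n * cnj z ^ n) \<partial>\<nu>)
          = complex_of_real (\<integral>z. ?i R z *\<^sub>R (cmod z) ^ (2 * n) \<partial>\<nu>)" for n
        unfolding integral_complex_of_real[symmetric]
        by (intro Bochner_Integration.integral_cong refl)
           (simp add: pw scaleR_conv_of_real)
      then show ?thesis
        by (simp only: complex_norm_square[symmetric] of_real_sum of_real_mult)
    qed
    finally show ?thesis
      by (simp only: of_real_eq_iff)
  qed
  have ball: "(\<lambda>n. (cmod (a n))\<^sup>2 * (\<integral>z. ?i R z *\<^sub>R (cmod z) ^ (2 * n) \<partial>\<nu>)) sums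
      (\<integral>z. ?i R z *\<^sub>R (cmod (f z))\<^sup>2 \<partial>\<nu>)" for R
  proof -
    define K where "K = (\<Sum>n. cmod (a n) * \<bar>R\<bar> ^ n)"
    have S_le: "cmod (S N z) \<le> K" if "z \<in> cball 0 R" for N z
    proof -
      have "cmod (S N z) \<le> (\<Sum>n<N. cmod (a n * z ^ n))"
        unfolding S_def by (rule norm_sum)
      also have "\<dots> \<le> (\<Sum>n<N. cmod (a n) * \<bar>R\<bar> ^ n)"
        using that by (intro sum_mono) (auto simp: norm_mult norm_power intro!: mult_left_mono power_mono)
      also have "\<dots> \<le> K"
        unfolding K_def a_def by (intro sum_le_suminf entire_summable_norm f) auto
      finally show ?thesis .
    qed
    have "(\<lambda>N. \<integral>z. ?i R z *\<^sub>R (cmod (S N z))\<^sup>2 \<partial>\<nu>)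
      \<longlonglongrightarrow> (\<integral>z. ?i R z *\<^sub>R (cmod (f z))\<^sup>2 \<partial>\<nu>)"
    proof (rule integral_dominated_convergence[where w = "\<lambda>_. K\<^sup>2"])
      show "(\<lambda>z. ?i R z *\<^sub>R (cmod (f z))\<^sup>2) \<in> borel_measurable \<nu>"
        by (intro borel_measurable_integrable int continuous_intros cont)
      show "(\<lambda>z. ?i R z *\<^sub>R (cmod (S N z))\<^sup>2) \<in> borel_measurable \<nu>" for N
        unfolding S_def by (intro borel_measurable_integrable int continuous_intros)
      have "(\<lambda>N. S N z) \<longlonglongrightarrow> f z" for z
        using entire_sums[OF f, of z] by (simp add: S_def sums_def a_def)
      then show "AE z in \<nu>. (\<lambda>N. ?i R z *\<^sub>R (cmod (S N z))\<^sup>2) \<longlonglongrightarrow> ?i R z *\<^sub>R (cmod (f z))\<^sup>2"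
        by (intro AE_I2 tendsto_intros)
      show "AE z in \<nu>. norm (?i R z *\<^sub>R (cmod (S N z))\<^sup>2) \<le> K\<^sup>2" for N
        using S_le by (intro AE_I2) (auto simp: indicator_def intro!: power_mono)
    qed simp
    then show ?thesis
      unfolding partial sums_def .
  qed
  have ballnn: "(\<integral>\<^sup>+z. ?j R z * ennreal ((cmod (f z))\<^sup>2) \<partial>\<nu>)
      = (\<Sum>n. ennreal ((cmod (a n))\<^sup>2) * (\<integral>\<^sup>+z. ?j R z * ennreal ((cmod z) ^ (2 * n)) \<partial>\<nu>))" for R
  proof -
    have conv: "(\<integral>\<^sup>+z. ?j R z * ennreal (h z) \<partial>\<nu>) = ennreal (\<integral>z. ?i R z *\<^sub>R h z \<partial>\<nu>)"
      if "continuous_on UNIV h" "\<And>z. h z \<ge> 0" for h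
    proof -
      have "(\<integral>\<^sup>+z. ?j R z * ennreal (h z) \<partial>\<nu>) = (\<integral>\<^sup>+z. ennreal (?i R z *\<^sub>R h z) \<partial>\<nu>)"
        by (intro nn_integral_cong) (auto simp: indicator_def)
      also have "\<dots> = ennreal (\<integral>z. ?i R z *\<^sub>R h z \<partial>\<nu>)"
        using that by (intro nn_integral_eq_integral int) auto
      finally show ?thesis .
    qed
    have pos: "0 \<le> (\<integral>z. ?i R z *\<^sub>R (cmod z) ^ (2 * n) \<partial>\<nu>)" for n
      by (intro integral_nonneg_AE) auto
    have "(\<integral>\<^sup>+z. ?j R z * ennreal ((cmod (f z))\<^sup>2) \<partial>\<nu>)
      = ennreal (\<Sum>n. (cmod (a n))\<^sup>2 * (\<integral>z. ?i R z *\<^sub>R (cmod z) ^ (2 * n) \<partial>\<nu>))"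
      unfolding sums_unique[OF ball, symmetric]
      by (rule conv) (auto intro!: continuous_intros cont)
    also have "\<dots> = (\<Sum>n. ennreal ((cmod (a n))\<^sup>2 * (\<integral>z. ?i R z *\<^sub>R (cmod z) ^ (2 * n) \<partial>\<nu>)))"
      using pos by (intro suminf_ennreal2[symmetric] sums_summable[OF ball]) auto
    also have "\<dots> = (\<Sum>n. ennreal ((cmod (a n))\<^sup>2) * (\<integral>\<^sup>+z. ?j R z * ennreal ((cmod z) ^ (2 * n)) \<partial>\<nu>))"
      using pos by (subst conv) (auto simp: ennreal_mult intro!: continuous_intros)
    finally show ?thesis .
  qed
  have sup: "(\<integral>\<^sup>+z. h z \<partial>\<nu>) = (SUP R. \<integral>\<^sup>+z. ?j (real R) z * h z \<partial>\<nu>)"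
    and incs: "incseq (\<lambda>R. \<integral>\<^sup>+z. ?j (real R) z * h z \<partial>\<nu>)"
    if [measurable]: "h \<in> borel_measurable borel" for h
  proof -
    have inc: "incseq (\<lambda>R z. ?j (real R) z * h z)"
      by (auto simp: incseq_def le_fun_def indicator_def)
    have "(SUP R. ?j (real R) z * h z) = h z" for z
    proof (rule antisym)
      show "(SUP R. ?j (real R) z * h z) \<le> h z"
        by (intro SUP_least) (auto simp: indicator_def)
      obtain R where "cmod z \<le> real R" using real_arch_simple by blast
      then show "h z \<le> (SUP R. ?j (real R) z * h z)"
        by (intro SUP_upper2[of R]) auto
    qed
    then have "(\<integral>\<^sup>+z. h z \<partial>\<nu>) = (\<integral>\<^sup>+z. (SUP R. ?j (real R) z * h z) \<partial>\<nu>)"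
      by simp
    also have "\<dots> = (SUP R. \<integral>\<^sup>+z. ?j (real R) z * h z \<partial>\<nu>)"
    proof (intro nn_integral_monotone_convergence_SUP inc)
      have "h \<in> borel_measurable \<nu>"
        by measurable
      then show "(\<lambda>z. ?j (real R) z * h z) \<in> borel_measurable \<nu>" for R
        by (intro borel_measurable_times_ennreal borel_measurable_indicator) (auto simp: sets)
    qed
    finally show "(\<integral>\<^sup>+z. h z \<partial>\<nu>) = (SUP R. \<integral>\<^sup>+z. ?j (real R) z * h z \<partial>\<nu>)" .
    show "incseq (\<lambda>R. \<integral>\<^sup>+z. ?j (real R) z * h z \<partial>\<nu>)"
      using inc by (auto simp: incseq_def le_fun_def intro!: nn_integral_mono)
  qed
  have "(\<integral>\<^sup>+z. ennreal ((cmod (f z))\<^sup>2) \<partial>\<nu>)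
      = (SUP R. \<Sum>n. ennreal ((cmod (a n))\<^sup>2) * (\<integral>\<^sup>+z. ?j (real R) z * ennreal ((cmod z) ^ (2 * n)) \<partial>\<nu>))"
    by (subst sup) (auto simp: ballnn)
  also have "\<dots> = (\<Sum>n. SUP R. ennreal ((cmod (a n))\<^sup>2) * (\<integral>\<^sup>+z. ?j (real R) z * ennreal ((cmod z) ^ (2 * n)) \<partial>\<nu>))"
    using incs by (intro ennreal_suminf_SUP_eq[symmetric]) (auto simp: incseq_def intro!: mult_left_mono)
  also have "\<dots> = (\<Sum>n. ennreal ((cmod (a n))\<^sup>2) * (\<integral>\<^sup>+z. ennreal ((cmod z) ^ (2 * n)) \<partial>\<nu>))"
    by (simp add: sup SUP_mult_left_ennreal[symmetric])
  finally show ?thesis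
    by (simp add: a_def)
qed

lemma distr_gauss_rotate:
  assumes c: "cmod c = 1"
  shows "distr gauss borel ((*) c) = gauss"
proof (rule measure_eqI)
  show "sets (distr gauss borel ((*) c)) = sets gauss" by simp
  fix A assume "A \<in> sets (distr gauss borel ((*) c))"
  then have [measurable]: "A \<in> sets borel" by simp
  have c0: "c \<noteq> 0" using c by auto
  have "emeasure (distr gauss borel ((*) c)) A = (\<integral>\<^sup>+z. indicator A (c * z) \<partial>gauss)"
  proof -
    have "(*) c -` A \<in> sets gauss"
      using measurable_sets[of "(*) c" gauss borel A] by simp
    then show ?thesis
      by (subst emeasure_distr) (simp_all add: indicator_vimage flip: nn_integral_indicator)
  qed
  also have "\<dots> = (\<integral>\<^sup>+z. ennreal (exp (- (cmod (c * z))\<^sup>2) / pi) * indicator A (c * z) \<partial>lborel)"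
    by (simp add: nn_integral_gauss norm_mult c)
  also have "\<dots> = (\<integral>\<^sup>+z. ennreal (exp (- (cmod z)\<^sup>2) / pi) * indicator A z \<partial>lborel)"
    using nn_integral_lborel_cmult[of "\<lambda>z. ennreal (exp (- (cmod z)\<^sup>2) / pi) * indicator A z", OF _ c0] c by simp
  also have "\<dots> = emeasure gauss A"
    by (simp flip: nn_integral_gauss)
  finally show "emeasure (distr gauss borel ((*) c)) A = emeasure gauss A" .
qed

lemma distr_gauss_density_rotate:
  assumes [measurable]: "w \<in> borel_measurable borel" and w: "\<And>c z. cmod c = 1 \<Longrightarrow> w (c * z) = w z"
    and c: "cmod c = 1"
  shows "distr (density gauss w) borel ((*) c) = density gauss w"
proof -
  have "density gauss w = density (distr gauss borel ((*) c)) w"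
    by (simp add: distr_gauss_rotate c)
  also have "\<dots> = distr (density gauss (\<lambda>z. w (c * z))) borel ((*) c)"
    by (rule density_distr) auto
  also have "\<dots> = distr (density gauss w) borel ((*) c)"
    by (simp add: w c)
  finally show ?thesis by simp
qed

text \<open>Three weights are used: the constant 1 for norms, the indicator of the unit disc for
  local mass, and 1/(1 + |z|^2) for the Littlewood-Paley estimate. The bound by 1 keeps the weighted
  measure finite.\<close>

lemma parseval_gauss_density:
  assumes [measurable]: "w \<in> borel_measurable borel" and w: "\<And>c z. cmod c = 1 \<Longrightarrow> w (c * z) = w z"
    and w1: "\<And>z. w z \<le> 1" and f: "f holomorphic_on UNIV"
  shows "(\<integral>\<^sup>+z. w z * ennreal ((cmod (f z))\<^sup>2) \<partial>gauss)
    = (\<Sum>n. ennreal ((cmod (taylor_coeff f n))\<^sup>2) * (\<integral>\<^sup>+z. w z * ennreal ((cmod z) ^ (2 * n)) \<partial>gauss))"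
proof -
  have "finite_measure (density gauss w)"
  proof
    have "emeasure (density gauss w) UNIV = (\<integral>\<^sup>+z. w z \<partial>gauss)"
      by (subst emeasure_density) auto
    also have "\<dots> \<le> (\<integral>\<^sup>+z. 1 \<partial>gauss)"
      by (intro nn_integral_mono w1)
    finally show "emeasure (density gauss w) (space (density gauss w)) \<noteq> \<infinity>"
      by (auto simp: emeasure_gauss_UNIV top_unique)
  qed
  then have "(\<integral>\<^sup>+z. ennreal ((cmod (f z))\<^sup>2) \<partial>density gauss w)
    = (\<Sum>n. ennreal ((cmod (taylor_coeff f n))\<^sup>2) * (\<integral>\<^sup>+z. ennreal ((cmod z) ^ (2 * n)) \<partial>density gauss w))"
    by (intro parseval_rotation_invariant f distr_gauss_density_rotate w) auto
  moreover have [measurable]: "f \<in> borel_measurable gauss"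
    using f by (rule holomorphic_imp_borel)
  ultimately show ?thesis
    by (simp add: nn_integral_density)
qed

lemma parseval_gauss:
  assumes f: "f holomorphic_on UNIV"
  shows "(\<integral>\<^sup>+z. ennreal ((cmod (f z))\<^sup>2) \<partial>gauss)
    = (\<Sum>n. ennreal ((cmod (taylor_coeff f n))\<^sup>2) * ennreal (fact n))"
  using parseval_gauss_density[of "\<lambda>_. 1" f] f by (simp add: gauss_moment)

subsection \<open>Weyl operators and normal families in the Fock space\<close>

lemma fock_fun_mem: "fock_fun f \<in> fock_space"
  by (rule fock_fun)

lemma holomorphic_fock_fun: "fock_fun f holomorphic_on UNIV"
  using fock_fun[of f] by (simp add: fock_space_def)

lemma continuous_fock_fun: "continuous_on S (fock_fun f)"
  using holomorphic_fock_fun[of f] holomorphic_on_imp_continuous_on continuous_on_subset by blast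

lemma measurable_fock_fun [measurable]: "fock_fun f \<in> borel_measurable borel"
  by (intro borel_measurable_continuous_onI continuous_fock_fun)

lemma integrable_fock_fun_square: "integrable gauss (\<lambda>z. (cmod (fock_fun f z))\<^sup>2)"
  using fock_fun[of f] by (simp add: fock_space_def)

lemma fock_fun_0 [simp]: "fock_fun 0 z = 0"
  and fock_fun_add [simp]: "fock_fun (f + g) z = fock_fun f z + fock_fun g z"
  and fock_fun_uminus [simp]: "fock_fun (- f) z = - fock_fun f z"
  and fock_fun_scaleC [simp]: "fock_fun (c *\<^sub>C f) z = c * fock_fun f z"
  by (simp_all add: zero_fock.rep_eq plus_fock.rep_eq uminus_fock.rep_eq scaleC.rep_eq)

lemma fock_fun_diff [simp]: "fock_fun (f - g) z = fock_fun f z - fock_fun g z"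
  using fock_fun_add[of f "- g" z] by simp

lemma fock_eqI: "(\<And>z. fock_fun f z = fock_fun g z) \<Longrightarrow> f = g"
  by (metis fock_fun_inject ext)

lemma norm_fock_square: "(norm f)\<^sup>2 = (\<integral>z. (cmod (fock_fun f z))\<^sup>2 \<partial>gauss)"
  unfolding power2_norm_eq_inner inner_fock_def fock_inner_self by simp

lemma ennreal_norm_fock_square: "ennreal ((norm f)\<^sup>2) = (\<integral>\<^sup>+z. ennreal ((cmod (fock_fun f z))\<^sup>2) \<partial>gauss)"
  unfolding norm_fock_square
  by (rule nn_integral_eq_integral[symmetric, OF integrable_fock_fun_square]) auto

lemma fock_spaceI:
  assumes "f holomorphic_on UNIV" "(\<integral>\<^sup>+z. ennreal ((cmod (f z))\<^sup>2) \<partial>gauss) < \<infinity>"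
  shows "f \<in> fock_space"
  using assms holomorphic_imp_borel[OF assms(1)]
  by (auto simp: fock_space_def intro!: integrableI_bounded)

lemma fock_of_entire:
  assumes "f holomorphic_on UNIV" "(\<integral>\<^sup>+z. ennreal ((cmod (f z))\<^sup>2) \<partial>gauss) \<le> ennreal (B\<^sup>2)" "B \<ge> 0"
  obtains F where "fock_fun F = f" "norm F \<le> B"
proof -
  have "f \<in> fock_space"
    using assms by (intro fock_spaceI) (auto intro: le_less_trans)
  then have F: "fock_fun (Fock f) = f"
    by (rule Fock_inverse)
  have "ennreal ((norm (Fock f))\<^sup>2) \<le> ennreal (B\<^sup>2)"
    using assms(2) by (simp add: ennreal_norm_fock_square F)
  then have "norm (Fock f) \<le> B"
    using assms(3) by (simp add: power2_le_iff_abs_le)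
  then show ?thesis using F that by blast
qed

text \<open>The reproducing kernel exp(cnj w z) at w divided by its norm exp(|w|^2/2).\<close>

abbreviation weyl_factor :: "complex \<Rightarrow> complex \<Rightarrow> complex" where
  "weyl_factor w z \<equiv> exp (cnj w * z - (of_real (cmod w))\<^sup>2 / 2)"

text \<open>Completing the square: 2 Re(cnj w z) - |w|^2 = |z|^2 - |z - w|^2, so the squared factor
  turns the Gaussian density at z into the one at z - w.\<close>

lemma gauss_nn_integral_translate:
  assumes [measurable]: "h \<in> borel_measurable borel"
  shows "(\<integral>\<^sup>+z. ennreal ((cmod (weyl_factor w z))\<^sup>2) * h (z - w) \<partial>gauss) = (\<integral>\<^sup>+z. h z \<partial>gauss)"
proof -
  have eq: "exp (- (cmod z)\<^sup>2) / pi * (cmod (weyl_factor w z))\<^sup>2 = exp (- (cmod (z - w))\<^sup>2) / pi" for z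
  proof -
    have "(cmod (weyl_factor w z))\<^sup>2 = exp (2 * Re (cnj w * z - (of_real (cmod w))\<^sup>2 / 2))"
      by (simp add: norm_exp_eq_Re flip: exp_double)
    also have "2 * Re (cnj w * z - (of_real (cmod w))\<^sup>2 / 2) = (cmod z)\<^sup>2 - (cmod (z - w))\<^sup>2"
      by (simp add: cmod_power2 power2_diff algebra_simps)
    finally show ?thesis
      by (simp flip: exp_add)
  qed
  let ?k = "\<lambda>z. (cmod (weyl_factor w z))\<^sup>2"
  have "(\<integral>\<^sup>+z. ennreal (?k z) * h (z - w) \<partial>gauss)
      = (\<integral>\<^sup>+z. ennreal (exp (- (cmod z)\<^sup>2) / pi) * (ennreal (?k z) * h (z - w)) \<partial>lborel)"
    by (rule nn_integral_gauss) measurable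
  also have "\<dots> = (\<integral>\<^sup>+z. ennreal (exp (- (cmod (z - w))\<^sup>2) / pi) * h (z - w) \<partial>lborel)"
  proof (rule nn_integral_cong)
    fix z
    have "0 \<le> exp (- (cmod z)\<^sup>2) / pi" by simp
    then show "ennreal (exp (- (cmod z)\<^sup>2) / pi) * (ennreal (?k z) * h (z - w)) = ennreal (exp (- (cmod (z - w))\<^sup>2) / pi) * h (z - w)"
      by (simp only: mult.assoc[symmetric] ennreal_mult[symmetric] zero_le_power2 eq)
  qed
  also have "\<dots> = (\<integral>\<^sup>+z. ennreal (exp (- (cmod z)\<^sup>2) / pi) * h z \<partial>lborel)"
    using nn_integral_lborel_translate[of "\<lambda>z. ennreal (exp (- (cmod z)\<^sup>2) / pi) * h z" "- w"] by simp
  also have "\<dots> = (\<integral>\<^sup>+z. h z \<partial>gauss)"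
    by (simp add: nn_integral_gauss)
  finally show ?thesis .
qed

lift_definition weyl :: "complex \<Rightarrow> fock \<Rightarrow> fock" is
  "\<lambda>w f z. weyl_factor w z * f (z - w)"
proof -
  fix w f assume f: "f \<in> fock_space"
  have "(\<lambda>z. f (z - w)) = f \<circ> (\<lambda>z. z - w)" by auto
  moreover have "f \<circ> (\<lambda>z. z - w) holomorphic_on UNIV"
    by (rule holomorphic_on_compose_gen[where t = UNIV]) (use f in \<open>auto simp: fock_space_def intro!: holomorphic_intros\<close>)
  ultimately have hol: "(\<lambda>z. f (z - w)) holomorphic_on UNIV" by simp
  have [measurable]: "f \<in> borel_measurable borel"
    using fock_space_borel[OF f] by simp
  have "(\<integral>\<^sup>+z. ennreal ((cmod (weyl_factor w z * f (z - w)))\<^sup>2) \<partial>gauss)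
      = (\<integral>\<^sup>+z. ennreal ((cmod (f z))\<^sup>2) \<partial>gauss)"
    using gauss_nn_integral_translate[of "\<lambda>z. ennreal ((cmod (f z))\<^sup>2)" w]
    by (simp add: norm_mult power_mult_distrib ennreal_mult)
  also have "\<dots> < \<infinity>"
    using f by (auto simp: fock_space_def nn_integral_eq_integral)
  finally show "(\<lambda>z. weyl_factor w z * f (z - w)) \<in> fock_space"
    by (intro fock_spaceI holomorphic_intros hol) auto
qed

lemma fock_fun_weyl: "fock_fun (weyl w f) z = weyl_factor w z * fock_fun f (z - w)"
  by transfer simp

lemma cmod_fock_fun_weyl:
  "cmod (fock_fun (weyl w f) z) = exp (Re (cnj w * z) - (cmod w)\<^sup>2 / 2) * cmod (fock_fun f (z - w))"
proof -
  have "(complex_of_real (cmod w))\<^sup>2 / 2 = complex_of_real ((cmod w)\<^sup>2 / 2)"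
    by simp
  then show ?thesis
    by (simp only: fock_fun_weyl norm_mult norm_exp_eq_Re minus_complex.simps Re_complex_of_real)
qed

text \<open>With k = 1 this gives unitarity and the invariance of \<open>abs_inner\<close>; with k
  the indicator of the unit disc it moves the mass near w to the origin.\<close>

lemma weyl_nn_integral:
  "(\<integral>\<^sup>+z. k (z - w) * ennreal (cmod (fock_fun (weyl w f) z) * cmod (fock_fun (weyl w g) z)) \<partial>gauss)
    = (\<integral>\<^sup>+z. k z * ennreal (cmod (fock_fun f z) * cmod (fock_fun g z)) \<partial>gauss)"
  if [measurable]: "k \<in> borel_measurable borel"
proof -
  have "k (z - w) * ennreal (cmod (fock_fun (weyl w f) z) * cmod (fock_fun (weyl w g) z))
     = ennreal ((cmod (weyl_factor w z))\<^sup>2) *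
       (k (z - w) * ennreal (cmod (fock_fun f (z - w)) * cmod (fock_fun g (z - w))))" for z
  proof -
    have "cmod (fock_fun (weyl w f) z) * cmod (fock_fun (weyl w g) z)
       = (cmod (weyl_factor w z))\<^sup>2 * (cmod (fock_fun f (z - w)) * cmod (fock_fun g (z - w)))"
      by (simp add: fock_fun_weyl norm_mult power2_eq_square algebra_simps)
    then show ?thesis
      by (simp add: ennreal_mult mult.left_commute)
  qed
  then show ?thesis
    using gauss_nn_integral_translate[of "\<lambda>z. k z * ennreal (cmod (fock_fun f z) * cmod (fock_fun g z))" w]
    by simp
qed

lemma norm_weyl [simp]: "norm (weyl w f) = norm f"
proof -
  have "ennreal ((norm (weyl w f))\<^sup>2) = ennreal ((norm f)\<^sup>2)"
    unfolding ennreal_norm_fock_square using weyl_nn_integral[of "\<lambda>_. 1" w f f]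
    by (simp add: power2_eq_square)
  then show ?thesis by simp
qed

lemma weyl_add: "weyl w (f + g) = weyl w f + weyl w g"
  and weyl_diff: "weyl w (f - g) = weyl w f - weyl w g"
  and weyl_scaleC: "weyl w (c *\<^sub>C f) = c *\<^sub>C weyl w f"
  by (auto intro!: fock_eqI simp: fock_fun_weyl algebra_simps)

lemma weyl_inverse: "weyl (- w) (weyl w f) = f" "weyl w (weyl (- w) f) = f"
proof -
  have "weyl (- w) (weyl w f) = f" for w
  proof (rule fock_eqI)
    fix z
    have "exp (cnj (- w) * z - (of_real (cmod (- w)))\<^sup>2 / 2) * exp (cnj w * (z + w) - (of_real (cmod w))\<^sup>2 / 2)
      = exp (- (of_real (cmod w))\<^sup>2 + w * cnj w)"
      by (simp flip: exp_add add: algebra_simps)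
    also have "\<dots> = 1"
      using complex_norm_square[of w] by simp
    finally show "fock_fun (weyl (- w) (weyl w f)) z = fock_fun f z"
      by (simp add: fock_fun_weyl flip: mult.assoc)
  qed
  from this[of w] this[of "-w"] show "weyl (- w) (weyl w f) = f" "weyl w (weyl (- w) f) = f" by auto
qed

text \<open>Keeping only the term n = 0 of the Parseval series gives a sub-mean value property for
  every radial weight.\<close>

lemma cmod_at_0_le:
  assumes f: "f holomorphic_on UNIV" and [measurable]: "w \<in> borel_measurable borel"
    and w: "\<And>c z. cmod c = 1 \<Longrightarrow> w (c * z) = w z" and w1: "\<And>z. w z \<le> 1"
  shows "ennreal ((cmod (f 0))\<^sup>2) * (\<integral>\<^sup>+z. w z \<partial>gauss) \<le> (\<integral>\<^sup>+z. w z * ennreal ((cmod (f z))\<^sup>2) \<partial>gauss)"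
proof -
  let ?t = "\<lambda>n. ennreal ((cmod (taylor_coeff f n))\<^sup>2) * (\<integral>\<^sup>+z. w z * ennreal ((cmod z) ^ (2 * n)) \<partial>gauss)"
  have "sum ?t {0} \<le> suminf ?t"
    by (intro sum_le_suminf) auto
  then show ?thesis
    by (simp add: parseval_gauss_density[OF assms(2) w w1 f] taylor_coeff_def)
qed

text \<open>A Weyl operator moves w to the origin, where the sub-mean value property with weight 1
  applies; the exponential is the factor picked up on the way.\<close>

lemma norm_fock_fun_le: "cmod (fock_fun f w) \<le> norm f * exp ((cmod w)\<^sup>2 / 2)"
proof -
  have "ennreal ((cmod (fock_fun (weyl (- w) f) 0))\<^sup>2) \<le> ennreal ((norm f)\<^sup>2)"
    using cmod_at_0_le[OF holomorphic_fock_fun, of "\<lambda>_. 1" "weyl (- w) f"]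
    by (simp add: emeasure_gauss_UNIV[unfolded] flip: ennreal_norm_fock_square)
  then have "cmod (fock_fun (weyl (- w) f) 0) \<le> norm f"
    by (simp add: power2_le_iff_abs_le)
  then show ?thesis
    by (simp add: cmod_fock_fun_weyl exp_minus field_simps)
qed

lift_definition fock_one :: fock is "\<lambda>_. 1"
  by (intro fock_spaceI) (auto simp: emeasure_gauss_UNIV)

lemma fock_fun_one [simp]: "fock_fun fock_one z = 1"
  by transfer simp

lemma norm_fock_one [simp]: "norm fock_one = 1"
proof -
  have "ennreal ((norm fock_one)\<^sup>2) = ennreal 1"
    unfolding ennreal_norm_fock_square by (simp add: emeasure_gauss_UNIV)
  then have "(norm fock_one)\<^sup>2 = 1"
    by (subst (asm) ennreal_inj) auto
  then show ?thesis
    using power2_eq_1_iff[of "norm fock_one"] norm_ge_zero[of fock_one] by auto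
qed

lemma fock_tail:
  assumes "e > 0"
  obtains R where "R > 0" "(\<integral>z. indicator (- ball 0 R) z *\<^sub>R (cmod (fock_fun f z))\<^sup>2 \<partial>gauss) < e"
proof -
  let ?t = "\<lambda>R z. indicat_real (- ball 0 R) z *\<^sub>R (cmod (fock_fun f z))\<^sup>2"
  have meas: "(\<lambda>z. ?t R z) \<in> borel_measurable gauss" for R
    by (intro borel_measurable_scaleR borel_measurable_indicator) (auto simp: sets_gauss)
  have "(\<lambda>n. \<integral>z. ?t (real n) z \<partial>gauss) \<longlonglongrightarrow> (\<integral>z. 0 \<partial>gauss)"
  proof (rule integral_dominated_convergence[where w = "\<lambda>z. (cmod (fock_fun f z))\<^sup>2"])
    show "AE z in gauss. (\<lambda>n. ?t (real n) z) \<longlonglongrightarrow> 0"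
    proof (rule AE_I2, rule tendsto_eventually)
      fix z :: complex
      show "\<forall>\<^sub>F n in sequentially. ?t (real n) z = 0"
        using eventually_gt_at_top[of "nat \<lceil>cmod z\<rceil>"]
        by eventually_elim (simp add: indicator_def, linarith)
    qed
    show "AE z in gauss. norm (?t (real n) z) \<le> (cmod (fock_fun f z))\<^sup>2" for n
      by (rule AE_I2) (auto simp: indicator_def)
  qed (auto intro: meas integrable_fock_fun_square)
  then have "\<forall>\<^sub>F n in sequentially. (\<integral>z. ?t (real n) z \<partial>gauss) < e"
    using assms by (auto dest: order_tendstoD(2))
  then have "\<forall>\<^sub>F n in sequentially. (\<integral>z. ?t (real n) z \<partial>gauss) < e \<and> n > 0"
    using eventually_gt_at_top[of 0] by (rule eventually_conj)
  then obtain n where "(\<integral>z. ?t (real n) z \<partial>gauss) < e" "n > 0"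
    using eventually_happens'[OF sequentially_bot] by blast
  then show ?thesis
    using that[of "real n"] by auto
qed

text \<open>After translating w to 0, the sub-mean value property on the unit disc bounds |f(w)|^2
  exp(-|w|^2) by a multiple of the mass of f within distance 1 of w, and for large |w| that mass
  lies in a tail of a convergent integral.\<close>

lemma fock_decay:
  assumes "e > 0"
  obtains R where "R > 0" "\<And>w. R \<le> cmod w \<Longrightarrow> cmod (fock_fun f w) \<le> e * exp ((cmod w)\<^sup>2 / 2)"
proof -
  let ?t = "\<lambda>R z. indicat_real (- ball 0 R) z *\<^sub>R (cmod (fock_fun f z))\<^sup>2"
  let ?i = "\<lambda>z. indicator (cball 0 1) (z::complex) :: ennreal"
  have mi [measurable]: "indicator (cball a r) \<in> borel_measurable borel" for a :: complex and r
    by (rule borel_measurable_indicator) simp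
  define c where "c = measure gauss (cball 0 1)"
  have c: "emeasure gauss (cball 0 1) = ennreal c"
    unfolding c_def by (rule gauss.emeasure_eq_measure)
  have "c > 0"
  proof (rule ccontr)
    assume "\<not> c > 0"
    then have "emeasure gauss (cball 0 1) = 0"
      using measure_nonneg[of gauss "cball 0 1"] by (simp add: c c_def)
    then have "AE z in gauss. z \<notin> cball 0 1"
      by (subst AE_iff_measurable[where N = "cball 0 1"]) auto
    then have "AE z in lborel. z \<notin> cball (0::complex) 1"
      by (simp add: AE_gauss_iff)
    then have "emeasure lborel (cball (0::complex) 1) = 0"
      by (subst (asm) AE_iff_measurable[where N = "cball 0 1"]) auto
    then show False
      using emeasure_cball[of 1 "0::complex"] by (simp add: unit_ball_vol_2)
  qed
  \<comment> \<open>The factor c is the Gaussian mass of the unit disc; it cancels against the same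
    mass on the left of the sub-mean value inequality.\<close>
  obtain R where R: "R > 0" "(\<integral>z. ?t R z \<partial>gauss) < c * e\<^sup>2"
    using fock_tail[of "c * e\<^sup>2"] \<open>c > 0\<close> assms by auto
  have "cmod (fock_fun f w) \<le> e * exp ((cmod w)\<^sup>2 / 2)" if w: "R + 1 \<le> cmod w" for w
  proof -
    let ?g = "weyl (- w) f"
    have "(\<integral>\<^sup>+z. ?i z \<partial>gauss) = ennreal c"
      by (subst nn_integral_indicator) (auto simp: c)
    moreover have "ennreal ((cmod (fock_fun ?g 0))\<^sup>2) * (\<integral>\<^sup>+z. ?i z \<partial>gauss)
        \<le> (\<integral>\<^sup>+z. ?i z * ennreal ((cmod (fock_fun ?g z))\<^sup>2) \<partial>gauss)"
      by (rule cmod_at_0_le[OF holomorphic_fock_fun mi]) (auto simp: indicator_def norm_mult)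
    ultimately have "ennreal ((cmod (fock_fun ?g 0))\<^sup>2) * ennreal c
        \<le> (\<integral>\<^sup>+z. ?i z * ennreal ((cmod (fock_fun ?g z))\<^sup>2) \<partial>gauss)"
      by simp
    also have "\<dots> = (\<integral>\<^sup>+z. ?i (z - w) * ennreal ((cmod (fock_fun f z))\<^sup>2) \<partial>gauss)"
      using weyl_nn_integral[of ?i w ?g ?g] by (simp add: weyl_inverse power2_eq_square)
    also have "\<dots> \<le> (\<integral>\<^sup>+z. ennreal (?t R z) \<partial>gauss)"
    proof (rule nn_integral_mono)
      fix z
      have "R \<le> cmod z" if "cmod (z - w) \<le> 1"
        using norm_triangle_ineq2[of w z] that w by (simp add: norm_minus_commute)
      then show "?i (z - w) * ennreal ((cmod (fock_fun f z))\<^sup>2) \<le> ennreal (?t R z)"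
        by (auto simp: indicator_def)
    qed
    also have "\<dots> = ennreal (\<integral>z. ?t R z \<partial>gauss)"
    proof (rule nn_integral_eq_integral)
      show "integrable gauss (\<lambda>z. ?t R z)"
        by (rule integrable_mult_indicator) (auto intro: integrable_fock_fun_square)
    qed auto
    also have "\<dots> \<le> ennreal (e\<^sup>2 * c)"
      using R by (intro ennreal_leI) (simp add: mult.commute)
    finally have "ennreal ((cmod (fock_fun ?g 0))\<^sup>2 * c) \<le> ennreal (e\<^sup>2 * c)"
      using \<open>c > 0\<close> by (simp add: ennreal_mult)
    then have "(cmod (fock_fun ?g 0))\<^sup>2 \<le> e\<^sup>2"
      using \<open>c > 0\<close> by (subst (asm) ennreal_le_iff) auto
    then have "cmod (fock_fun ?g 0) \<le> e"
      using assms by (simp add: power2_le_iff_abs_le)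
    then show ?thesis
      by (simp add: cmod_fock_fun_weyl exp_minus field_simps)
  qed
  then show ?thesis
    using that[of "R + 1"] R(1) by auto
qed

lemma fock_fatou:
  assumes B: "\<And>n. norm (X n) \<le> B" and f: "f holomorphic_on UNIV"
    and lim: "\<And>z. (\<lambda>n. fock_fun (X n) z) \<longlonglongrightarrow> f z"
  obtains F where "fock_fun F = f" "norm F \<le> B"
proof -
  have B0: "B \<ge> 0" using B[of 0] norm_ge_zero[of "X 0"] by linarith
  have "(\<integral>\<^sup>+z. ennreal ((cmod (f z))\<^sup>2) \<partial>gauss) = (\<integral>\<^sup>+z. liminf (\<lambda>n. ennreal ((cmod (fock_fun (X n) z))\<^sup>2)) \<partial>gauss)"
  proof (rule nn_integral_cong)
    fix z
    have "(\<lambda>n. ennreal ((cmod (fock_fun (X n) z))\<^sup>2)) \<longlonglongrightarrow> ennreal ((cmod (f z))\<^sup>2)"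
      by (intro tendsto_intros lim tendsto_ennrealI)
    then show "ennreal ((cmod (f z))\<^sup>2) = liminf (\<lambda>n. ennreal ((cmod (fock_fun (X n) z))\<^sup>2))"
      by (intro lim_imp_Liminf[symmetric]) auto
  qed
  also have "\<dots> \<le> liminf (\<lambda>n. \<integral>\<^sup>+z. ennreal ((cmod (fock_fun (X n) z))\<^sup>2) \<partial>gauss)"
    by (rule nn_integral_liminf) measurable
  also have "\<dots> = liminf (\<lambda>n. ennreal ((norm (X n))\<^sup>2))"
    by (simp add: ennreal_norm_fock_square)
  also have "\<dots> \<le> liminf (\<lambda>n::nat. ennreal (B\<^sup>2))"
    by (intro Liminf_mono always_eventually allI ennreal_leI power_mono B) auto
  also have "\<dots> = ennreal (B\<^sup>2)"
    by (simp add: Liminf_const)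
  finally show ?thesis
    using fock_of_entire[OF f _ B0] that by blast
qed

text \<open>Takes the part of weak compactness of balls. The pointwise bound
  \<open>norm_fock_fun_le\<close> makes a bounded sequence locally bounded, and Fatou keeps the
  limit in the ball of the same radius.\<close>

lemma fock_montel:
  assumes B: "\<And>n. norm (X n) \<le> B"
  obtains F r where "strict_mono (r :: nat \<Rightarrow> nat)" "norm F \<le> B"
    "\<And>K. compact K \<Longrightarrow> uniform_limit K (\<lambda>n. fock_fun (X (r n))) (fock_fun F) sequentially"
proof -
  have "\<exists>C. \<forall>h\<in>range (\<lambda>n. fock_fun (X n)). \<forall>z\<in>K. cmod (h z) \<le> C" if "compact K" for K
  proof -
    from compact_imp_bounded[OF that] obtain R where R: "\<And>z. z \<in> K \<Longrightarrow> cmod z \<le> R"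
      by (auto simp: bounded_iff)
    have "cmod (fock_fun (X n) z) \<le> B * exp (R\<^sup>2 / 2)" if "z \<in> K" for n z
    proof -
      have "cmod (fock_fun (X n) z) \<le> norm (X n) * exp ((cmod z)\<^sup>2 / 2)"
        by (rule norm_fock_fun_le)
      also have "\<dots> \<le> B * exp (R\<^sup>2 / 2)"
        using R[OF that] B[of n] order_trans[OF norm_ge_zero B[of n]]
        by (intro mult_mono) (auto intro!: power_mono)
      finally show ?thesis .
    qed
    then show ?thesis by blast
  qed
  note bdd = this
  have "\<exists>f r. f holomorphic_on UNIV \<and> strict_mono (r :: nat \<Rightarrow> nat) \<and>
      (\<forall>x. (\<lambda>n. fock_fun (X (r n)) x) \<longlonglongrightarrow> f x) \<and>
      (\<forall>K. compact K \<longrightarrow> uniform_limit K ((\<lambda>n. fock_fun (X n)) \<circ> r) f sequentially)"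
  proof (rule Montel[of UNIV "range (\<lambda>n. fock_fun (X n))" "\<lambda>n. fock_fun (X n)"])
    show "h holomorphic_on UNIV" if "h \<in> range (\<lambda>n. fock_fun (X n))" for h
      using that holomorphic_fock_fun by auto
    show "\<exists>C. \<forall>h\<in>range (\<lambda>n. fock_fun (X n)). \<forall>z\<in>K. cmod (h z) \<le> C" if "compact K" for K
      using bdd that by simp
  qed (simp_all, blast)
  then obtain f r where f: "f holomorphic_on UNIV" "strict_mono (r :: nat \<Rightarrow> nat)"
      "\<And>x. (\<lambda>n. fock_fun (X (r n)) x) \<longlonglongrightarrow> f x"
      "\<And>K. compact K \<Longrightarrow> uniform_limit K ((\<lambda>n. fock_fun (X n)) \<circ> r) f sequentially"
    by blast
  obtain F where F: "fock_fun F = f" "norm F \<le> B"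
    using fock_fatou[of "\<lambda>n. X (r n)" B f] B f by blast
  show ?thesis
    using that[of r F] f F by (simp add: o_def)
qed

lemma uniform_limit_fock_diff:
  assumes "uniform_limit K (\<lambda>n. fock_fun (X n)) (fock_fun u) sequentially"
  shows "uniform_limit K (\<lambda>n. fock_fun (X n - u)) (\<lambda>_. 0) sequentially"
proof -
  have "uniform_limit K (\<lambda>n z. fock_fun (X n) z - fock_fun u z) (\<lambda>z. fock_fun u z - fock_fun u z) sequentially"
    by (intro uniform_limit_intros assms)
  moreover have "fock_fun (X n - u) = (\<lambda>z. fock_fun (X n) z - fock_fun u z)" for n
    by auto
  ultimately show ?thesis by simp
qed

lemma fock_uniform_imp_pointwise:
  assumes "\<And>K. compact K \<Longrightarrow> uniform_limit K (\<lambda>n. h n) (l :: complex \<Rightarrow> complex) sequentially"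
  shows "(\<lambda>n. h n z) \<longlonglongrightarrow> l z"
  using tendsto_uniform_limitI[OF assms[of "{z}"]] by simp

text \<open>The candidate limit is the locally uniform limit of a subsequence. The Cauchy estimate
  for differences passes to it by \<open>fock_fatou\<close>, which turns pointwise convergence into
  a norm bound.\<close>

instance fock :: complete_space
proof
  fix X :: "nat \<Rightarrow> fock"
  assume X: "Cauchy X"
  from cauchy_imp_bounded[OF X] obtain B where B: "\<And>n. norm (X n) \<le> B"
    by (auto simp: bounded_iff)
  obtain F r where r: "strict_mono (r :: nat \<Rightarrow> nat)" and
    lim: "\<And>K. compact K \<Longrightarrow> uniform_limit K (\<lambda>n. fock_fun (X (r n))) (fock_fun F) sequentially"
    using fock_montel[of X B] B by metis
  have "X \<longlonglongrightarrow> F"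
  proof (rule LIMSEQ_I)
    fix e :: real assume "0 < e"
    then have "0 < e / 2" by simp
    then obtain N where N: "\<And>m n. m \<ge> N \<Longrightarrow> n \<ge> N \<Longrightarrow> norm (X m - X n) < e / 2"
      using X unfolding Cauchy_iff by meson
    have "norm (X n - F) < e" if n: "n \<ge> N" for n
    proof -
      have "(\<lambda>m. fock_fun (X n - X (r (m + N))) z) \<longlonglongrightarrow> fock_fun (X n - F) z" for z
      proof -
        have "(\<lambda>m. fock_fun (X (r m)) z) \<longlonglongrightarrow> fock_fun F z"
          by (rule fock_uniform_imp_pointwise[OF lim])
        then have "(\<lambda>m. fock_fun (X (r (m + N))) z) \<longlonglongrightarrow> fock_fun F z"
          by (rule LIMSEQ_ignore_initial_segment)
        then show ?thesis
          by (auto intro!: tendsto_intros)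
      qed
      moreover have "norm (X n - X (r (m + N))) \<le> e / 2" for m
        using N[OF n, of "r (m + N)"] seq_suble[OF r, of "m + N"] by (simp add: less_imp_le)
      ultimately obtain G where "fock_fun G = fock_fun (X n - F)" "norm G \<le> e / 2"
        using fock_fatou[of "\<lambda>m. X n - X (r (m + N))" "e / 2" "fock_fun (X n - F)"] holomorphic_fock_fun by blast
      then have "norm (X n - F) \<le> e / 2"
        by (simp add: fock_fun_inject)
      then show ?thesis using \<open>0 < e\<close> by simp
    qed
    then show "\<exists>no. \<forall>n\<ge>no. norm (X n - F) < e" by blast
  qed
  then show "convergent X"
    by (rule convergentI)
qed

section \<open>Weak convergence under absolute values\<close>

abbreviation abs_inner :: "fock \<Rightarrow> fock \<Rightarrow> real" where
  "abs_inner f g \<equiv> \<integral>z. cmod (fock_fun f z) * cmod (fock_fun g z) \<partial>gauss"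

lemma integrable_norm_fock_mult: "integrable gauss (\<lambda>z. cmod (fock_fun f z) * cmod (fock_fun g z))"
  using integrable_norm[OF fock_space_mult_integrable[OF fock_fun_mem fock_fun_mem, of f g]]
  by (simp add: norm_mult)

text \<open>Absolute values inside the integral are harmless since convergence is uniform on a large
  disc, while outside it f has little mass and v n stays bounded. This stronger form is what
  domination by \<open>abs_inner\<close> requires.\<close>

lemma fock_weak_null:
  assumes B: "\<And>n. norm (v n) \<le> B"
    and lim: "\<And>K. compact K \<Longrightarrow> uniform_limit K (\<lambda>n. fock_fun (v n)) (\<lambda>_. 0) sequentially"
  shows "(\<lambda>n. abs_inner f (v n)) \<longlonglongrightarrow> 0"
proof (rule LIMSEQ_I)
  fix e :: real assume e: "0 < e"
  \<comment> \<open>The parameter of x y <= x^2 / t + t y^2 outside the disc: t B^2 <= e/4 settles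
    the second term, and the tail of f is then taken below t e/4. The summand 1 covers B =
    0.\<close>
  define t where "t = e / (4 * (B\<^sup>2 + 1))"
  have t: "t > 0" "t * B\<^sup>2 \<le> e / 4"
  proof -
    have "0 < B\<^sup>2 + 1" by (simp add: add_nonneg_pos)
    then show "t > 0" using e by (simp add: t_def)
    have "t * B\<^sup>2 = e / 4 * (B\<^sup>2 / (B\<^sup>2 + 1))" by (simp add: t_def)
    also have "\<dots> \<le> e / 4 * 1"
      using e \<open>0 < B\<^sup>2 + 1\<close> by (intro mult_left_mono) auto
    finally show "t * B\<^sup>2 \<le> e / 4" by simp
  qed
  obtain R where R: "R > 0" "(\<integral>z. indicator (- ball 0 R) z *\<^sub>R (cmod (fock_fun f z))\<^sup>2 \<partial>gauss) < t * (e / 4)"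
    using fock_tail[of "t * (e / 4)"] t e by auto
  define C where "C = 1 + (\<integral>z. cmod (fock_fun f z) \<partial>gauss)"
  have intf: "integrable gauss (\<lambda>z. cmod (fock_fun f z))"
    using integrable_norm_fock_mult[of f fock_one] by simp
  have C: "C > 0"
    unfolding C_def by (intro add_pos_nonneg integral_nonneg_AE) auto
  have "\<forall>\<^sub>F n in sequentially. \<forall>z\<in>cball 0 R. cmod (fock_fun (v n) z) < e / (4 * C)"
    using uniform_limitD[OF lim[OF compact_cball], of "e / (4 * C)" 0 R] e C by (simp add: dist_norm)
  then obtain N where N: "\<And>n z. n \<ge> N \<Longrightarrow> z \<in> cball 0 R \<Longrightarrow> cmod (fock_fun (v n) z) < e / (4 * C)"
    unfolding eventually_sequentially by blast
  have "norm (abs_inner f (v n) - 0) < e" if n: "n \<ge> N" for n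
  proof -
    \<comment> \<open>The first summand majorizes the product on the disc, the other two outside
      it.\<close>
    let ?h = "\<lambda>z. e / (4 * C) * cmod (fock_fun f z) + (1 / t) * (indicator (- ball 0 R) z *\<^sub>R (cmod (fock_fun f z))\<^sup>2)
       + t * (cmod (fock_fun (v n) z))\<^sup>2"
    have ind: "integrable gauss (\<lambda>z. indicator (- ball 0 R) z *\<^sub>R (cmod (fock_fun f z))\<^sup>2)"
      by (rule integrable_mult_indicator) (auto intro: integrable_fock_fun_square)
    have "abs_inner f (v n) \<le> (\<integral>z. ?h z \<partial>gauss)"
    proof (rule integral_mono)
      show "integrable gauss ?h"
        by (intro Bochner_Integration.integrable_add integrable_mult_right ind intf integrable_fock_fun_square)
      fix z
      show "cmod (fock_fun f z) * cmod (fock_fun (v n) z) \<le> ?h z"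
      proof (cases "z \<in> ball 0 R")
        case True
        then have "cmod (fock_fun f z) * cmod (fock_fun (v n) z) \<le> cmod (fock_fun f z) * (e / (4 * C))"
          using N[OF n, of z] by (intro mult_left_mono) auto
        then show ?thesis
          using t True by (simp add: mult.commute add_increasing2)
      next
        case False
        let ?a = "cmod (fock_fun f z)" and ?b = "cmod (fock_fun (v n) z)"
        have "0 \<le> (?a - t * ?b)\<^sup>2 / t"
          using t by simp
        also have "\<dots> = ?a\<^sup>2 / t + t * ?b\<^sup>2 - 2 * (?a * ?b)"
          using t by (simp add: power2_diff power2_eq_square field_simps)
        finally have "?a * ?b \<le> ?a\<^sup>2 / t + t * ?b\<^sup>2"
          using mult_nonneg_nonneg[of ?a ?b, OF norm_ge_zero norm_ge_zero] by linarith
        moreover have "0 \<le> e / (4 * C) * ?a"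
          using e C by simp
        ultimately show ?thesis
          using False by simp
      qed
    qed (rule integrable_norm_fock_mult)
    also have "\<dots> = e / (4 * C) * (\<integral>z. cmod (fock_fun f z) \<partial>gauss)
        + (1 / t) * (\<integral>z. indicator (- ball 0 R) z *\<^sub>R (cmod (fock_fun f z))\<^sup>2 \<partial>gauss) + t * (norm (v n))\<^sup>2"
      unfolding norm_fock_square
      by (simp only: Bochner_Integration.integral_add Bochner_Integration.integrable_add integrable_mult_right ind intf
          integrable_fock_fun_square integral_mult_right_zero)
    also have "\<dots> < e / 4 + e / 4 + e / 4"
    proof -
      have "e / (4 * C) * (\<integral>z. cmod (fock_fun f z) \<partial>gauss) \<le> e / (4 * C) * C"
        using e C by (intro mult_left_mono) (auto simp: C_def)
      moreover have "e / (4 * C) * C = e / 4" using C by simp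
      moreover have "(1 / t) * (\<integral>z. indicator (- ball 0 R) z *\<^sub>R (cmod (fock_fun f z))\<^sup>2 \<partial>gauss) < e / 4"
        using R(2) t by (simp add: field_simps)
      moreover have "t * (norm (v n))\<^sup>2 \<le> t * B\<^sup>2"
        using t B[of n] by (intro mult_left_mono power_mono) auto
      ultimately show ?thesis using t(2) by linarith
    qed
    also have "\<dots> < e" using e by simp
    finally have "abs_inner f (v n) < e" .
    moreover have "0 \<le> abs_inner f (v n)"
      by (intro integral_nonneg_AE) auto
    ultimately show ?thesis by simp
  qed
  then show "\<exists>no. \<forall>n\<ge>no. norm (abs_inner f (v n) - 0) < e"
    by blast
qed

subsection \<open>Adjoints and Toeplitz operators\<close>

text \<open>The representing vector minimizes |x|^2/2 - L x. The parallelogram law makes a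
  minimizing sequence Cauchy, and the first variation at the minimum is the required
  identity.\<close>

lemma riesz_representation_real:
  fixes L :: "'a::{real_inner, complete_space} \<Rightarrow> real"
  assumes L: "bounded_linear L"
  obtains p where "\<And>x. L x = inner x p"
proof -
  interpret L: bounded_linear L by fact
  obtain K where K: "\<And>x. norm (L x) \<le> norm x * K" "K > 0"
    using L.pos_bounded by auto
  define J where "J x = inner x x / 2 - L x" for x
  have J_ge: "J x \<ge> - K\<^sup>2 / 2" for x
  proof -
    have "0 \<le> (norm x - K)\<^sup>2" by simp
    moreover have "L x \<le> norm x * K" using K(1)[of x] by simp
    moreover have "inner x x = (norm x)\<^sup>2" by (rule power2_norm_eq_inner[symmetric])
    ultimately show ?thesis by (simp add: J_def power2_diff)
  qed
  define m where "m = (INF x. J x)"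
  have bdd: "bdd_below (range J)" by (rule bdd_belowI2[of UNIV "- K\<^sup>2 / 2" J]) (rule J_ge)
  have m_le: "m \<le> J x" for x unfolding m_def by (rule cINF_lower[OF bdd]) simp
  have "\<exists>x. J x < m + 1 / real (Suc n)" for n
  proof -
    have "Inf (range J) < m + 1 / real (Suc n)" by (simp add: m_def)
    then show ?thesis using cInf_lessD[of "range J"] by blast
  qed
  then obtain X where X: "\<And>n. J (X n) < m + 1 / real (Suc n)" by metis
  have para: "(norm (x - y))\<^sup>2 / 4 \<le> J x + J y - 2 * m" for x y
  proof -
    have "(norm (x - y))\<^sup>2 / 4 = J x + J y - 2 * J ((1/2) *\<^sub>R (x + y))"
      by (simp add: J_def L.add L.scaleR power2_norm_eq_inner inner_add inner_diff inner_commute field_simps)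
    also have "\<dots> \<le> J x + J y - 2 * m"
      using m_le[of "(1/2) *\<^sub>R (x + y)"] by simp
    finally show ?thesis .
  qed
  have "Cauchy X"
    unfolding Cauchy_iff
  proof (intro allI impI)
    fix e :: real assume e: "0 < e"
    obtain N where N: "1 / real (Suc N) < e\<^sup>2 / 8"
      using reals_Archimedean[of "e\<^sup>2 / 8"] e by (auto simp: inverse_eq_divide)
    have "norm (X i - X j) < e" if "i \<ge> N" "j \<ge> N" for i j
    proof -
      have le: "1 / real (Suc i) \<le> 1 / real (Suc N)" "1 / real (Suc j) \<le> 1 / real (Suc N)"
        using that by (auto intro!: divide_left_mono)
      have "(norm (X i - X j))\<^sup>2 / 4 < e\<^sup>2 / 4"
        using para[of "X i" "X j"] X[of i] X[of j] le N by linarith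
      then have "(norm (X i - X j))\<^sup>2 < e\<^sup>2" by simp
      then show ?thesis
        using e by (simp add: power2_less_imp_less)
    qed
    then show "\<exists>M. \<forall>m\<ge>M. \<forall>n\<ge>M. norm (X m - X n) < e" by blast
  qed
  then obtain p where p: "X \<longlonglongrightarrow> p"
    using Cauchy_convergent convergent_def by blast
  have "(\<lambda>n. J (X n)) \<longlonglongrightarrow> J p"
    unfolding J_def by (intro tendsto_intros p L.tendsto) auto
  moreover have "(\<lambda>n. m + 1 / real (Suc n)) \<longlonglongrightarrow> m + 0"
    by (intro tendsto_intros LIMSEQ_Suc[OF lim_1_over_n])
  ultimately have "J p \<le> m + 0"
    using X by (intro LIMSEQ_le[of "\<lambda>n. J (X n)"]) (auto intro: less_imp_le)
  then have Jp: "J p \<le> J x" for x using m_le[of x] by simp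
  have "L x = inner x p" for x
  proof -
    define D where "D = inner x p - L x"
    \<comment> \<open>A strict upper bound of |x|^2, positive also for x = 0, so that t = - D / N
      can serve as the trial value in the quadratic inequality.\<close>
    define N where "N = inner x x + 1"
    have N: "N > 0" "inner x x < N" by (auto simp: N_def add_nonneg_pos)
    have q: "0 \<le> t * D + t\<^sup>2 * inner x x / 2" for t
    proof -
      have "J (p + t *\<^sub>R x) - J p = t * D + t\<^sup>2 * inner x x / 2"
        by (simp add: J_def D_def L.add L.scaleR inner_add inner_commute algebra_simps power2_eq_square)
      then show ?thesis using Jp[of "p + t *\<^sub>R x"] by simp
    qed
    have "0 \<le> (- D / N) * D + (- D / N)\<^sup>2 * N / 2"
      using q[of "- D / N"] N mult_left_mono[of "inner x x" N "(- D / N)\<^sup>2"] by simp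
    also have "\<dots> = - (D\<^sup>2 / N) / 2"
      using N by (simp add: power2_eq_square field_simps)
    finally have "D\<^sup>2 / N \<le> 0" by simp
    then have "D\<^sup>2 \<le> 0" using N by (simp add: divide_le_0_iff)
    then show ?thesis by (simp add: D_def)
  qed
  then show ?thesis using that by blast
qed

lemma integral_cauchy_schwarz:
  fixes u v :: "'a \<Rightarrow> real"
  assumes [measurable]: "u \<in> borel_measurable M" "v \<in> borel_measurable M"
    and u: "integrable M (\<lambda>x. (u x)\<^sup>2)" and v: "integrable M (\<lambda>x. (v x)\<^sup>2)"
  shows "integrable M (\<lambda>x. u x * v x)"
    and "(\<integral>x. u x * v x \<partial>M) \<le> sqrt (\<integral>x. (u x)\<^sup>2 \<partial>M) * sqrt (\<integral>x. (v x)\<^sup>2 \<partial>M)"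
proof -
  have ab: "\<bar>a * b\<bar> \<le> a\<^sup>2 + b\<^sup>2" for a b :: real
    using sum_squares_bound[of "\<bar>a\<bar>" "\<bar>b\<bar>"] mult_nonneg_nonneg[of "\<bar>a\<bar>" "\<bar>b\<bar>"]
    unfolding abs_mult power2_abs by linarith
  show int: "integrable M (\<lambda>x. u x * v x)"
    by (rule Bochner_Integration.integrable_bound[OF Bochner_Integration.integrable_add[OF u v]])
       (auto intro!: AE_I2 ab[THEN order_trans])
  define A where "A = (\<integral>x. (u x)\<^sup>2 \<partial>M)"
  define B where "B = (\<integral>x. (v x)\<^sup>2 \<partial>M)"
  define I where "I = (\<integral>x. u x * v x \<partial>M)"
  have pos: "A \<ge> 0" "B \<ge> 0" by (auto simp: A_def B_def)
  have le: "2 * t * I \<le> A + t\<^sup>2 * B" for t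
  proof -
    have "(\<integral>x. 2 * t * (u x * v x) \<partial>M) \<le> (\<integral>x. (u x)\<^sup>2 + t\<^sup>2 * (v x)\<^sup>2 \<partial>M)"
    proof (rule integral_mono)
      fix x
      have "0 \<le> (u x - t * v x)\<^sup>2" by simp
      then show "2 * t * (u x * v x) \<le> (u x)\<^sup>2 + t\<^sup>2 * (v x)\<^sup>2"
        by (simp add: power2_diff power_mult_distrib algebra_simps)
    qed (auto intro!: u v int integrable_mult_right)
    also have "\<dots> = A + t\<^sup>2 * B"
      unfolding A_def B_def by (subst Bochner_Integration.integral_add) (auto intro!: u v integrable_mult_right)
    finally show ?thesis by (simp add: I_def)
  qed
  have "I\<^sup>2 \<le> A * B"
  proof (cases "B = 0")
    case True
    have "I = 0"
    proof (rule ccontr)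
      assume "I \<noteq> 0"
      \<comment> \<open>This t makes the left side 2 t I equal to A + 1 while the right side is
        A.\<close>
      then show False using le[of "(A + 1) / (2 * I)"] True pos by simp
    qed
    then show ?thesis using pos by simp
  next
    case False
    then have "B > 0" using pos by simp
    have "2 * (I / B) * I \<le> A + (I / B)\<^sup>2 * B" by (rule le)
    then have "I\<^sup>2 / B \<le> A" using \<open>B > 0\<close> by (simp add: power2_eq_square field_simps)
    then show ?thesis using \<open>B > 0\<close> by (simp add: field_simps)
  qed
  then have "\<bar>I\<bar> \<le> sqrt (A * B)"
    by (simp add: real_le_rsqrt)
  then show "(\<integral>x. u x * v x \<partial>M) \<le> sqrt (\<integral>x. (u x)\<^sup>2 \<partial>M) * sqrt (\<integral>x. (v x)\<^sup>2 \<partial>M)"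
    unfolding I_def[symmetric] A_def[symmetric] B_def[symmetric] by (simp add: real_sqrt_mult)
qed

lemma fock_inner_scaleC_right: "fock_inner f (c *\<^sub>C g) = cnj c * fock_inner f g"
  by (subst (1 2) fock_inner_commute) (simp add: fock_inner_scaleC)

lemma fock_inner_add_right: "fock_inner f (g + h) = fock_inner f g + fock_inner f h"
  by (subst (1 2 3) fock_inner_commute) (simp add: fock_inner_add)

lemma fock_inner_diff: "fock_inner (f - g) h = fock_inner f h - fock_inner g h"
  using fock_inner_add[of "f - g" g h] by simp

lemma fock_inner_diff_right: "fock_inner f (g - h) = fock_inner f g - fock_inner f h"
  using fock_inner_add_right[of f "g - h" h] by simp

lemma Re_fock_inner: "Re (fock_inner f g) = inner f g"
  and Im_fock_inner: "Im (fock_inner f g) = inner f (\<i> *\<^sub>C g)"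
  by (simp_all add: inner_fock_def fock_inner_scaleC_right)

lemma fock_inner_eqI: "(\<And>f. fock_inner f p = fock_inner f q) \<Longrightarrow> p = q"
proof -
  assume "\<And>f. fock_inner f p = fock_inner f q"
  then have "fock_inner (p - q) (p - q) = 0"
    by (simp add: fock_inner_diff_right)
  then have "inner (p - q) (p - q) = 0"
    by (simp add: inner_fock_def)
  then show ?thesis by simp
qed

lemma fock_inner_eqI2: "(\<And>f. fock_inner p f = fock_inner q f) \<Longrightarrow> p = q"
  by (rule fock_inner_eqI) (metis fock_inner_commute)

lemma fock_inner_bound: "cmod (fock_inner f g) \<le> norm f * norm g"
proof (cases "fock_inner f g = 0")
  case False
  define c where "c = cnj (fock_inner f g) / cmod (fock_inner f g)"
  have "cmod c = 1" using False by (simp add: c_def norm_divide)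
  have "c * fock_inner f g = complex_of_real (cmod (fock_inner f g)) * complex_of_real (cmod (fock_inner f g)) / cmod (fock_inner f g)"
    using complex_norm_square[of "fock_inner f g"]
    by (simp add: c_def power2_eq_square mult.commute)
  also have "\<dots> = cmod (fock_inner f g)"
    using False by simp
  finally have "c * fock_inner f g = cmod (fock_inner f g)" .
  then have "cmod (fock_inner f g) = inner (c *\<^sub>C f) g"
    by (simp add: inner_fock_def fock_inner_scaleC)
  also have "\<dots> \<le> norm (c *\<^sub>C f) * norm g" by (rule norm_cauchy_schwarz)
  finally show ?thesis using \<open>cmod c = 1\<close> by (simp add: norm_scaleC)
qed simp

text \<open>A complex-linear functional is determined by its real part, since Re L(i f) = - Im L(f);
  so the real representation theorem for the underlying real inner product suffices.\<close>

lemma fock_riesz: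
  fixes L :: "fock \<Rightarrow> complex"
  assumes add: "\<And>f g. L (f + g) = L f + L g" and scale: "\<And>c f. L (c *\<^sub>C f) = c * L f"
    and bound: "\<And>f. cmod (L f) \<le> K * norm f"
  obtains p where "\<And>f. L f = fock_inner f p"
proof -
  have "bounded_linear (\<lambda>f. Re (L f))"
  proof (rule bounded_linear_intro[where K = K])
    show "norm (Re (L f)) \<le> norm f * K" for f
      using bound[of f] abs_Re_le_cmod[of "L f"] by (simp add: mult.commute)
  qed (simp_all add: add scaleR_fock_def scale)
  then obtain p where p: "\<And>f. Re (L f) = inner f p"
    using riesz_representation_real by blast
  have "L f = fock_inner f p" for f
  proof (rule complex_eqI)
    show "Re (L f) = Re (fock_inner f p)"
      by (simp add: p inner_fock_def)
    have "Re (L (\<i> *\<^sub>C f)) = Re (fock_inner (\<i> *\<^sub>C f) p)"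
      by (simp add: p inner_fock_def)
    then show "Im (L f) = Im (fock_inner f p)"
      by (simp add: scale fock_inner_scaleC)
  qed
  then show ?thesis using that by blast
qed

section \<open>Complex-linear operators and their adjoints\<close>

lemma fock_operatorsD: "A \<in> fock_operators \<Longrightarrow> blinfun_apply A (c *\<^sub>C f) = c *\<^sub>C blinfun_apply A f"
  by (simp add: fock_operators_def)

lemma op_adjoint_eqI:
  assumes "\<And>f g. fock_inner (blinfun_apply A f) g = fock_inner f (blinfun_apply B g)"
  shows "op_adjoint A = B"
  unfolding op_adjoint_def
proof (rule the_equality)
  fix B' assume "\<forall>f g. fock_inner (blinfun_apply A f) g = fock_inner f (blinfun_apply B' g)"
  then have "fock_inner f (blinfun_apply B' g) = fock_inner f (blinfun_apply B g)" for f g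
    by (simp flip: assms)
  then show "B' = B"
    by (intro blinfun_eqI fock_inner_eqI)
qed (simp add: assms)

text \<open>Riesz supplies the existence behind the definite description in
  \<open>op_adjoint\<close>. The norm bound makes the passage to adjoints continuous, which later
  yields closedness of the set that contains the Toeplitz algebra.\<close>

lemma
  assumes A: "A \<in> fock_operators"
  shows op_adjoint: "fock_inner (blinfun_apply A f) g = fock_inner f (blinfun_apply (op_adjoint A) g)"
    and op_adjoint_mem: "op_adjoint A \<in> fock_operators"
    and norm_op_adjoint_le: "norm (op_adjoint A) \<le> norm A"
proof -
  have "\<exists>p. \<forall>f. fock_inner (blinfun_apply A f) g = fock_inner f p" for g
  proof -
    obtain p where "\<And>f. fock_inner (blinfun_apply A f) g = fock_inner f p"
    proof (rule fock_riesz[of "\<lambda>f. fock_inner (blinfun_apply A f) g" "norm A * norm g"])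
      fix f
      have "cmod (fock_inner (blinfun_apply A f) g) \<le> norm (blinfun_apply A f) * norm g"
        by (rule fock_inner_bound)
      also have "\<dots> \<le> (norm A * norm f) * norm g"
        by (intro mult_right_mono norm_blinfun) auto
      finally show "cmod (fock_inner (blinfun_apply A f) g) \<le> norm A * norm g * norm f"
        by (simp add: algebra_simps)
    qed (auto simp: blinfun.add_right fock_inner_add fock_operatorsD[OF A] fock_inner_scaleC)
    then show ?thesis by blast
  qed
  then obtain P where P: "\<And>f g. fock_inner (blinfun_apply A f) g = fock_inner f (P g)"
    by metis
  have P_add: "P (g + h) = P g + P h" for g h
    by (rule fock_inner_eqI) (simp add: fock_inner_add_right flip: P)
  have P_scale: "P (c *\<^sub>C g) = c *\<^sub>C P g" for c g
    by (rule fock_inner_eqI) (simp add: fock_inner_scaleC_right flip: P)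
  have P_bound: "norm (P g) \<le> norm g * norm A" for g
  proof -
    have "(norm (P g))\<^sup>2 = Re (fock_inner (P g) (P g))"
      by (simp add: power2_norm_eq_inner inner_fock_def)
    also have "\<dots> = Re (fock_inner (blinfun_apply A (P g)) g)"
      by (simp add: P)
    also have "\<dots> \<le> norm (blinfun_apply A (P g)) * norm g"
      using complex_Re_le_cmod fock_inner_bound order_trans by blast
    also have "\<dots> \<le> (norm A * norm (P g)) * norm g"
      by (intro mult_right_mono norm_blinfun) auto
    finally have "norm (P g) * norm (P g) \<le> norm (P g) * (norm g * norm A)"
      by (simp add: power2_eq_square algebra_simps)
    then show ?thesis
      by (cases "norm (P g) = 0") auto
  qed
  have bl: "bounded_linear P"
    by (rule bounded_linear_intro[where K = "norm A"]) (auto simp: P_add scaleR_fock_def P_scale P_bound)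
  have eq: "op_adjoint A = Blinfun P"
    by (rule op_adjoint_eqI) (simp add: bounded_linear_Blinfun_apply[OF bl] P)
  show "fock_inner (blinfun_apply A f) g = fock_inner f (blinfun_apply (op_adjoint A) g)"
    by (simp add: eq bounded_linear_Blinfun_apply[OF bl] P)
  show "op_adjoint A \<in> fock_operators"
    by (simp add: fock_operators_def eq bounded_linear_Blinfun_apply[OF bl] P_scale)
  show "norm (op_adjoint A) \<le> norm A"
    by (rule norm_blinfun_bound) (simp_all add: eq bounded_linear_Blinfun_apply[OF bl] P_bound mult.commute)
qed

lemma op_adjoint_right: "A \<in> fock_operators \<Longrightarrow>
    fock_inner (blinfun_apply (op_adjoint A) f) g = fock_inner f (blinfun_apply A g)"
  by (metis fock_inner_commute op_adjoint)

lemma op_adjoint_op_adjoint: "A \<in> fock_operators \<Longrightarrow> op_adjoint (op_adjoint A) = A"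
  by (rule op_adjoint_eqI) (rule op_adjoint_right)

lemma fock_operators_zero: "0 \<in> fock_operators"
  and fock_operators_add: "A \<in> fock_operators \<Longrightarrow> B \<in> fock_operators \<Longrightarrow> A + B \<in> fock_operators"
  and fock_operators_diff: "A \<in> fock_operators \<Longrightarrow> B \<in> fock_operators \<Longrightarrow> A - B \<in> fock_operators"
  and fock_operators_comp: "A \<in> fock_operators \<Longrightarrow> B \<in> fock_operators \<Longrightarrow> A o\<^sub>L B \<in> fock_operators"
  and fock_operators_scaleC: "A \<in> fock_operators \<Longrightarrow> op_scaleC c A \<in> fock_operators"
  by (simp_all add: fock_operators_def blinfun.add_left blinfun.diff_left op_scaleC_apply
      fock.scale_right_distrib fock.scale_right_diff_distrib mult.commute)

lemma op_adjoint_zero: "op_adjoint 0 = 0"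
  by (rule op_adjoint_eqI) (use fock_inner_scaleC[of 0] fock_inner_scaleC_right[of _ 0] in simp)

lemma op_adjoint_add: "A \<in> fock_operators \<Longrightarrow> B \<in> fock_operators \<Longrightarrow> op_adjoint (A + B) = op_adjoint A + op_adjoint B"
  and op_adjoint_diff: "A \<in> fock_operators \<Longrightarrow> B \<in> fock_operators \<Longrightarrow> op_adjoint (A - B) = op_adjoint A - op_adjoint B"
  and op_adjoint_comp: "A \<in> fock_operators \<Longrightarrow> B \<in> fock_operators \<Longrightarrow> op_adjoint (A o\<^sub>L B) = op_adjoint B o\<^sub>L op_adjoint A"
  and op_adjoint_scaleC: "A \<in> fock_operators \<Longrightarrow> op_adjoint (op_scaleC c A) = op_scaleC (cnj c) (op_adjoint A)"
  by (rule op_adjoint_eqI, simp add: blinfun.add_left blinfun.diff_left op_scaleC_apply fock_inner_add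
      fock_inner_add_right fock_inner_diff fock_inner_diff_right fock_inner_scaleC fock_inner_scaleC_right op_adjoint)+

lemma closed_fock_operators: "closed fock_operators"
  unfolding closed_sequential_limits
proof (intro allI impI, elim conjE)
  fix X A assume X: "\<forall>n. X n \<in> fock_operators" and lim: "X \<longlonglongrightarrow> A"
  have "bounded_linear (scaleC c)" for c
    by (rule bounded_linear_intro[where K = "cmod c"])
       (simp_all add: fock.scale_right_distrib scaleR_fock_def norm_scaleC mult.commute)
  then have lim1: "(\<lambda>n. c *\<^sub>C blinfun_apply (X n) f) \<longlonglongrightarrow> c *\<^sub>C blinfun_apply A f" for c f
    by (rule bounded_linear.tendsto) (intro tendsto_intros lim)
  have "blinfun_apply A (c *\<^sub>C f) = c *\<^sub>C blinfun_apply A f" for c f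
  proof (rule LIMSEQ_unique[OF _ lim1])
    have "(\<lambda>n. blinfun_apply (X n) (c *\<^sub>C f)) \<longlonglongrightarrow> blinfun_apply A (c *\<^sub>C f)"
      by (intro tendsto_intros lim)
    then show "(\<lambda>n. c *\<^sub>C blinfun_apply (X n) f) \<longlonglongrightarrow> blinfun_apply A (c *\<^sub>C f)"
      using X by (simp add: fock_operatorsD)
  qed
  then show "A \<in> fock_operators"
    by (simp add: fock_operators_def)
qed

section \<open>The projection and Toeplitz operators\<close>

lemma fock_inner_integral: "fock_inner f g = (\<integral>z. fock_fun f z * cnj (fock_fun g z) \<partial>gauss)"
  by transfer simp

lemma fock_cauchy_schwarz: "abs_inner f g \<le> norm f * norm g"
  using integral_cauchy_schwarz(2)[of "\<lambda>z. cmod (fock_fun f z)" gauss "\<lambda>z. cmod (fock_fun g z)"]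
  by (simp add: integrable_fock_fun_square flip: norm_fock_square)

lemma cnj_measurable [measurable]: "cnj \<in> borel_measurable borel"
  by (intro borel_measurable_continuous_onI continuous_intros)

text \<open>The projection is found as a Riesz vector: pairing with h is a bounded functional on the
  Fock space, and its representing vector satisfies the orthogonality that defines
  \<open>fock_proj\<close>.\<close>

lemma fock_proj_inner:
  assumes [measurable]: "h \<in> borel_measurable borel" and h: "integrable gauss (\<lambda>z. (cmod (h z))\<^sup>2)"
  shows "fock_inner (fock_proj h) k = (\<integral>z. h z * cnj (fock_fun k z) \<partial>gauss)"
proof -
  have int1: "integrable gauss (\<lambda>z. cmod (h z) * cmod (fock_fun k z))" for k
    by (rule integral_cauchy_schwarz(1)) (auto intro: h integrable_fock_fun_square)
  have int: "integrable gauss (\<lambda>z. h z * cnj (fock_fun k z))" for k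
    by (rule Bochner_Integration.integrable_bound[OF int1[of k]]) (auto simp: norm_mult)
  have intk: "integrable gauss (\<lambda>z. fock_fun p z * cnj (fock_fun k z))" for p k
    by (rule fock_space_mult_integrable[OF fock_fun_mem fock_fun_mem])
  \<comment> \<open>The outer conjugate makes L linear in k.\<close>
  define L where "L k = cnj (\<integral>z. h z * cnj (fock_fun k z) \<partial>gauss)" for k
  obtain p where p: "\<And>k. L k = fock_inner k p"
  proof (rule fock_riesz[of L "sqrt (\<integral>z. (cmod (h z))\<^sup>2 \<partial>gauss)"])
    show "L (f + g) = L f + L g" for f g
      by (simp add: L_def distrib_left int)
    show "L (c *\<^sub>C f) = c * L f" for c f
    proof -
      have "(\<integral>z. h z * cnj (fock_fun (c *\<^sub>C f) z) \<partial>gauss) = (\<integral>z. cnj c * (h z * cnj (fock_fun f z)) \<partial>gauss)"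
        by (intro Bochner_Integration.integral_cong refl) (simp add: algebra_simps)
      then show ?thesis by (simp add: L_def)
    qed
    show "cmod (L k) \<le> sqrt (\<integral>z. (cmod (h z))\<^sup>2 \<partial>gauss) * norm k" for k
    proof -
      have "cmod (L k) \<le> (\<integral>z. cmod (h z) * cmod (fock_fun k z) \<partial>gauss)"
        unfolding L_def complex_mod_cnj
        using integral_norm_bound[of gauss "\<lambda>z. h z * cnj (fock_fun k z)"] by (simp add: norm_mult)
      also have "\<dots> \<le> sqrt (\<integral>z. (cmod (h z))\<^sup>2 \<partial>gauss) * norm k"
        using integral_cauchy_schwarz(2)[of "\<lambda>z. cmod (h z)" gauss "\<lambda>z. cmod (fock_fun k z)"] h
        by (simp add: integrable_fock_fun_square flip: norm_fock_square)
      finally show ?thesis .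
    qed
  qed blast
  have iff: "(\<forall>k. (\<integral>z. (h z - fock_fun q z) * cnj (fock_fun k z) \<partial>gauss) = 0) \<longleftrightarrow>
      (\<forall>k. fock_inner q k = (\<integral>z. h z * cnj (fock_fun k z) \<partial>gauss))" for q
    by (auto simp: left_diff_distrib int intk fock_inner_integral)
  have pk: "fock_inner p k = (\<integral>z. h z * cnj (fock_fun k z) \<partial>gauss)" for k
    using p[of k] by (subst fock_inner_commute) (simp add: L_def flip: p)
  have "fock_proj h = p"
    unfolding fock_proj_def iff
  proof (rule the_equality)
    fix q assume "\<forall>k. fock_inner q k = (\<integral>z. h z * cnj (fock_fun k z) \<partial>gauss)"
    then show "q = p" by (intro fock_inner_eqI2) (simp add: pk)
  qed (simp add: pk)
  then show ?thesis by (simp add: pk)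
qed

lemma L_infinityE:
  assumes "F \<in> L_infinity"
  obtains C where "C \<ge> 0" "AE z in gauss. cmod (F z) \<le> C" "F \<in> borel_measurable borel"
proof -
  obtain C where C: "AE z in lborel. cmod (F z) \<le> C" and F: "F \<in> borel_measurable borel"
    using assms by (auto simp: L_infinity_def)
  then have "AE z in gauss. cmod (F z) \<le> max C 0"
    by (auto simp: AE_gauss_iff elim!: AE_mp)
  then show ?thesis using that[of "max C 0"] F by auto
qed

text \<open>The bound by \<open>abs_inner\<close> is finer than the operator norm bound: it keeps
  the pointwise sizes of f and g inside the integral, and this is the source of compactness
  later.\<close>

lemma
  assumes F: "F \<in> borel_measurable borel" and C: "C \<ge> 0" "AE z in gauss. cmod (F z) \<le> C"
  shows toeplitz_inner: "fock_inner (blinfun_apply (toeplitz F) f) g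
      = (\<integral>z. F z * fock_fun f z * cnj (fock_fun g z) \<partial>gauss)"
    and toeplitz_inner_le: "cmod (fock_inner (blinfun_apply (toeplitz F) f) g)
      \<le> C * abs_inner f g"
    and toeplitz_mem: "toeplitz F \<in> fock_operators"
proof -
  note [measurable] = F
  let ?P = "\<lambda>f. fock_proj (\<lambda>z. F z * fock_fun f z)"
  have sq: "integrable gauss (\<lambda>z. (cmod (F z * fock_fun f z))\<^sup>2)" for f
  proof (rule Bochner_Integration.integrable_bound[of _ "\<lambda>z. C\<^sup>2 * (cmod (fock_fun f z))\<^sup>2"])
    show "AE z in gauss. norm ((cmod (F z * fock_fun f z))\<^sup>2) \<le> norm (C\<^sup>2 * (cmod (fock_fun f z))\<^sup>2)"
      using C(2) by eventually_elim (auto simp: norm_mult power_mult_distrib intro!: mult_right_mono power_mono)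
  qed (auto intro: integrable_fock_fun_square)
  have P: "fock_inner (?P f) g = (\<integral>z. F z * fock_fun f z * cnj (fock_fun g z) \<partial>gauss)" for f g
    by (rule fock_proj_inner) (auto intro: sq)
  have le: "cmod (fock_inner (?P f) g) \<le> C * abs_inner f g" for f g
  proof -
    have "cmod (fock_inner (?P f) g) \<le> (\<integral>z. cmod (F z * fock_fun f z * cnj (fock_fun g z)) \<partial>gauss)"
      unfolding P by (rule integral_norm_bound)
    also have "\<dots> \<le> (\<integral>z. C * (cmod (fock_fun f z) * cmod (fock_fun g z)) \<partial>gauss)"
    proof (rule integral_mono_AE')
      show "AE z in gauss. cmod (F z * fock_fun f z * cnj (fock_fun g z)) \<le> C * (cmod (fock_fun f z) * cmod (fock_fun g z))"
        using C(2) by eventually_elim (auto simp: norm_mult mult.assoc intro!: mult_right_mono)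
      show "AE z in gauss. 0 \<le> C * (cmod (fock_fun f z) * cmod (fock_fun g z))"
        using C by simp
    qed (auto intro!: integrable_norm_fock_mult)
    finally show ?thesis by simp
  qed
  have int: "integrable gauss (\<lambda>z. F z * fock_fun f z * cnj (fock_fun g z))" for f g
  proof (rule Bochner_Integration.integrable_bound[of _ "\<lambda>z. C * (cmod (fock_fun f z) * cmod (fock_fun g z))"])
    show "AE z in gauss. norm (F z * fock_fun f z * cnj (fock_fun g z)) \<le> norm (C * (cmod (fock_fun f z) * cmod (fock_fun g z)))"
      using C(2) by eventually_elim (use C(1) in \<open>auto simp: norm_mult abs_mult mult.assoc intro!: mult_right_mono\<close>)
  qed (auto intro!: integrable_norm_fock_mult)
  have add: "?P (f + g) = ?P f + ?P g" for f g
    by (rule fock_inner_eqI2, simp only: P fock_inner_add) (simp add: distrib_left distrib_right int)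
  have scale: "?P (c *\<^sub>C f) = c *\<^sub>C ?P f" for c f
  proof (rule fock_inner_eqI2)
    fix g
    have "(\<integral>z. F z * fock_fun (c *\<^sub>C f) z * cnj (fock_fun g z) \<partial>gauss) = (\<integral>z. c * (F z * fock_fun f z * cnj (fock_fun g z)) \<partial>gauss)"
      by (intro Bochner_Integration.integral_cong refl) (simp add: algebra_simps)
    then show "fock_inner (?P (c *\<^sub>C f)) g = fock_inner (c *\<^sub>C ?P f) g"
      by (simp only: P fock_inner_scaleC) simp
  qed
  have bound: "norm (?P f) \<le> norm f * C" for f
  proof -
    have "(norm (?P f))\<^sup>2 = Re (fock_inner (?P f) (?P f))"
      by (simp add: power2_norm_eq_inner inner_fock_def)
    also have "\<dots> \<le> C * abs_inner f (?P f)"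
      using complex_Re_le_cmod le order_trans by blast
    also have "\<dots> \<le> C * (norm f * norm (?P f))"
      by (intro mult_left_mono fock_cauchy_schwarz C)
    finally have "norm (?P f) * norm (?P f) \<le> norm (?P f) * (norm f * C)"
      by (simp add: power2_eq_square algebra_simps)
    then show ?thesis
      using C by (cases "norm (?P f) = 0") auto
  qed
  have "bounded_linear ?P"
    by (rule bounded_linear_intro[where K = C], rule add, unfold scaleR_fock_def, rule scale, rule bound)
  then have T: "blinfun_apply (toeplitz F) = ?P"
    by (simp add: toeplitz_def bounded_linear_Blinfun_apply)
  show "fock_inner (blinfun_apply (toeplitz F) f) g = (\<integral>z. F z * fock_fun f z * cnj (fock_fun g z) \<partial>gauss)"
    by (simp add: T P)
  show "cmod (fock_inner (blinfun_apply (toeplitz F) f) g) \<le> C * abs_inner f g"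
    by (simp add: T le)
  show "toeplitz F \<in> fock_operators"
    by (simp add: fock_operators_def T scale del: fock_fun_scaleC)
qed

lemma op_adjoint_toeplitz:
  assumes "F \<in> L_infinity"
  shows "op_adjoint (toeplitz F) = toeplitz (\<lambda>z. cnj (F z))" "(\<lambda>z. cnj (F z)) \<in> L_infinity"
proof -
  obtain C where C: "C \<ge> 0" "AE z in gauss. cmod (F z) \<le> C" and [measurable]: "F \<in> borel_measurable borel"
    using L_infinityE[OF assms] .
  show "op_adjoint (toeplitz F) = toeplitz (\<lambda>z. cnj (F z))"
  proof (rule op_adjoint_eqI)
    fix f g
    have "fock_inner f (blinfun_apply (toeplitz (\<lambda>z. cnj (F z))) g)
      = cnj (\<integral>z. cnj (F z) * fock_fun g z * cnj (fock_fun f z) \<partial>gauss)"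
      by (subst fock_inner_commute, subst toeplitz_inner[where C = C]) (use C in auto)
    also have "\<dots> = (\<integral>z. cnj (cnj (F z) * fock_fun g z * cnj (fock_fun f z)) \<partial>gauss)"
      by (rule Bochner_Integration.integral_cnj[symmetric])
    also have "\<dots> = (\<integral>z. F z * fock_fun f z * cnj (fock_fun g z) \<partial>gauss)"
      by (simp add: algebra_simps)
    also have "\<dots> = fock_inner (blinfun_apply (toeplitz F) f) g"
      by (subst toeplitz_inner[where C = C]) (use C in auto)
    finally show "fock_inner (blinfun_apply (toeplitz F) f) g = fock_inner f (blinfun_apply (toeplitz (\<lambda>z. cnj (F z))) g)" ..
  qed
  show "(\<lambda>z. cnj (F z)) \<in> L_infinity"
    using assms by (auto simp: L_infinity_def)
qed

subsection \<open>Precompact Weyl orbits\<close>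

abbreviation weyl_conj :: "(fock \<Rightarrow>\<^sub>L fock) \<Rightarrow> complex \<Rightarrow> fock \<Rightarrow> fock" where
  "weyl_conj A z f \<equiv> weyl (- z) (blinfun_apply A (weyl z f))"

text \<open>Total boundedness in terms of finite nets, because nets can be added, composed and
  perturbed directly.\<close>

definition precompact_weyl_orbits :: "(fock \<Rightarrow>\<^sub>L fock) \<Rightarrow> bool" where
  "precompact_weyl_orbits A \<longleftrightarrow> (\<forall>f e. e > 0 \<longrightarrow>
     (\<exists>T. finite T \<and> (\<forall>z. \<exists>t\<in>T. norm (weyl_conj A z f - t) < e)))"

text \<open>Montel gives a subsequence with a locally uniform limit u. The difference v satisfies
  |v|^2 <= C int |f||v| + int |u||v|, and both integrals vanish in the limit by
  \<open>fock_weak_null\<close>, so the convergence is in norm.\<close>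

lemma seq_compact_dominated:
  assumes C: "C \<ge> 0"
  shows "seq_compact {u. \<forall>g. cmod (fock_inner u g) \<le> C * abs_inner f g}" (is "seq_compact ?S")
proof (rule seq_compactI)
  fix X assume "\<forall>n::nat. X n \<in> ?S"
  then have X: "cmod (fock_inner (X n) g) \<le> C * abs_inner f g" for n g
    by blast
  have B: "norm (X n) \<le> C * norm f" for n
  proof -
    have "norm (X n) * norm (X n) = Re (fock_inner (X n) (X n))"
      using power2_norm_eq_inner[of "X n"] by (simp add: inner_fock_def power2_eq_square)
    also have "\<dots> \<le> C * abs_inner f (X n)"
      using complex_Re_le_cmod X order_trans by blast
    also have "\<dots> \<le> C * (norm f * norm (X n))"
      by (intro mult_left_mono fock_cauchy_schwarz C)
    finally have "norm (X n) * norm (X n) \<le> norm (X n) * (C * norm f)"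
      by (simp add: algebra_simps)
    then show ?thesis
      using C by (cases "norm (X n) = 0") auto
  qed
  obtain u r where r: "strict_mono (r :: nat \<Rightarrow> nat)" "norm u \<le> C * norm f" and
    lim: "\<And>K. compact K \<Longrightarrow> uniform_limit K (\<lambda>n. fock_fun (X (r n))) (fock_fun u) sequentially"
    using fock_montel[of X "C * norm f"] B by metis
  let ?v = "\<lambda>n. X (r n) - u"
  note v_lim = uniform_limit_fock_diff[OF lim]
  have v_B: "norm (?v n) \<le> C * norm f + C * norm f" for n
    using norm_triangle_ineq4[of "X (r n)" u] B[of "r n"] r(2) by linarith
  have v_le: "(norm (?v n))\<^sup>2 \<le> C * abs_inner f (?v n) + abs_inner u (?v n)" for n
  proof -
    have "(norm (?v n))\<^sup>2 = Re (fock_inner (X (r n)) (?v n)) - Re (fock_inner u (?v n))"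
      by (simp add: power2_norm_eq_inner inner_fock_def fock_inner_diff)
    also have "\<dots> \<le> cmod (fock_inner (X (r n)) (?v n)) + cmod (fock_inner u (?v n))"
      using complex_Re_le_cmod[of "fock_inner (X (r n)) (?v n)"] abs_Re_le_cmod[of "fock_inner u (?v n)"] by linarith
    also have "cmod (fock_inner u (?v n)) \<le> abs_inner u (?v n)"
      unfolding fock_inner_integral
      using integral_norm_bound[of gauss "\<lambda>z. fock_fun u z * cnj (fock_fun (?v n) z)"] by (simp only: norm_mult complex_mod_cnj)
    finally show ?thesis using X[of "r n" "?v n"] by linarith
  qed
  have "(\<lambda>n. C * abs_inner f (?v n) + abs_inner u (?v n)) \<longlonglongrightarrow> C * 0 + 0"
    by (intro tendsto_intros fock_weak_null[OF v_B v_lim])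
  then have "(\<lambda>n. C * abs_inner f (?v n) + abs_inner u (?v n)) \<longlonglongrightarrow> 0"
    by (simp only: mult_zero_right add_0_right)
  then have "(\<lambda>n. (norm (?v n))\<^sup>2) \<longlonglongrightarrow> 0"
    by (rule Lim_null_comparison[rotated]) (intro always_eventually allI, simp only: real_norm_def abs_power2 v_le)
  then have "(\<lambda>n. sqrt ((norm (?v n))\<^sup>2)) \<longlonglongrightarrow> sqrt 0"
    by (rule tendsto_real_sqrt)
  then have conv: "(\<lambda>n. X (r n)) \<longlonglongrightarrow> u"
    by (simp add: LIM_zero_iff tendsto_norm_zero_iff)
  have "u \<in> ?S"
  proof (intro CollectI allI)
    fix g
    have "(\<lambda>n. fock_inner (X (r n)) g) \<longlonglongrightarrow> fock_inner u g"
    proof (rule Lim_null_comparison[THEN Lim_null[THEN iffD2]])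
      show "\<forall>\<^sub>F n in sequentially. norm (fock_inner (X (r n)) g - fock_inner u g) \<le> norm (X (r n) - u) * norm g"
        using fock_inner_bound by (auto simp flip: fock_inner_diff)
      have "(\<lambda>n. norm (X (r n) - u) * norm g) \<longlonglongrightarrow> 0 * norm g"
        using conv by (intro tendsto_intros) (simp add: LIM_zero tendsto_norm_zero)
      then show "(\<lambda>n. norm (X (r n) - u) * norm g) \<longlonglongrightarrow> 0" by simp
    qed
    then have "(\<lambda>n. cmod (fock_inner (X (r n)) g)) \<longlonglongrightarrow> cmod (fock_inner u g)"
      by (rule tendsto_norm)
    then show "cmod (fock_inner u g) \<le> C * abs_inner f g"
      by (rule LIMSEQ_le_const2) (use X in blast)
  qed
  then show "\<exists>l\<in>?S. \<exists>r. strict_mono r \<and> (X \<circ> r) \<longlonglongrightarrow> l"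
    using r(1) conv by (auto simp: o_def)
qed

lemma weyl_isometry_inner: "fock_inner (weyl w f) (weyl w g) = fock_inner f g"
proof -
  have re: "inner (weyl w f) (weyl w g) = inner f g" for f g
    unfolding dot_norm by (simp flip: weyl_add)
  show ?thesis
    by (rule complex_eqI) (simp_all add: Re_fock_inner Im_fock_inner re flip: weyl_scaleC)
qed

lemma weyl_inner: "fock_inner (weyl (- w) f) g = fock_inner f (weyl w g)"
  by (metis weyl_isometry_inner weyl_inverse(2))

lemma weyl_integral:
  "abs_inner (weyl w f) (weyl w g)
    = abs_inner f g"
proof -
  have "ennreal (abs_inner (weyl w f) (weyl w g))
    = ennreal (abs_inner f g)"
    using weyl_nn_integral[of "\<lambda>_. 1" w f g]
    by (simp add: nn_integral_eq_integral[OF integrable_norm_fock_mult])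
  then show ?thesis
    by (subst (asm) ennreal_inj) auto
qed

text \<open>Moving the outer Weyl operator to the other side and using the translation invariance of
  \<open>abs_inner\<close> puts the whole orbit into one compact dominated set.\<close>

lemma precompact_weyl_orbits_toeplitz:
  assumes "F \<in> L_infinity"
  shows "precompact_weyl_orbits (toeplitz F)"
  unfolding precompact_weyl_orbits_def
proof (intro allI impI, goal_cases)
  case e: (1 f e)
  obtain C where C: "C \<ge> 0" "AE z in gauss. cmod (F z) \<le> C" and F: "F \<in> borel_measurable borel"
    using L_infinityE[OF assms] .
  let ?S = "{u. \<forall>g. cmod (fock_inner u g) \<le> C * abs_inner f g}"
  obtain T where T: "finite T" "?S \<subseteq> (\<Union>t\<in>T. ball t e)"
    using seq_compact_imp_totally_bounded[OF seq_compact_dominated[OF C(1), of f]] e by meson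
  have "weyl_conj (toeplitz F) z f \<in> ?S" for z
    using toeplitz_inner_le[OF F C, of "weyl z f" "weyl z g" for g]
    by (simp add: weyl_inner weyl_integral)
  then have "\<forall>z. \<exists>t\<in>T. norm (weyl_conj (toeplitz F) z f - t) < e"
    using T(2) by (fastforce simp: dist_norm norm_minus_commute)
  then show ?case
    using T(1) by blast
qed

lemma precompact_weyl_orbitsD:
  assumes "precompact_weyl_orbits A" "e > 0"
  obtains T where "finite T" "\<And>z. \<exists>t\<in>T. norm (weyl_conj A z f - t) < e"
  using assms unfolding precompact_weyl_orbits_def by meson

lemma weyl_zero [simp]: "weyl w 0 = 0"
  by (rule fock_eqI) (simp add: fock_fun_weyl)

lemma precompact_weyl_orbits_zero: "precompact_weyl_orbits 0"
  unfolding precompact_weyl_orbits_def by (auto intro!: exI[of _ "{0}"])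

lemma precompact_weyl_orbits_add:
  assumes A: "precompact_weyl_orbits A" and B: "precompact_weyl_orbits B"
  shows "precompact_weyl_orbits (A + B)"
  unfolding precompact_weyl_orbits_def
proof (intro allI impI, goal_cases)
  case e: (1 f e)
  then have e2: "e / 2 > 0" by simp
  obtain S where S: "finite S" "\<And>z. \<exists>t\<in>S. norm (weyl_conj A z f - t) < e / 2"
    using precompact_weyl_orbitsD[OF A e2] by metis
  obtain T where T: "finite T" "\<And>z. \<exists>t\<in>T. norm (weyl_conj B z f - t) < e / 2"
    using precompact_weyl_orbitsD[OF B e2] by metis
  have net: "\<exists>t\<in>(\<lambda>(s, t). s + t) ` (S \<times> T). norm (weyl_conj (A + B) z f - t) < e" for z
  proof -
    obtain s t where st: "s \<in> S" "norm (weyl_conj A z f - s) < e / 2"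
      "t \<in> T" "norm (weyl_conj B z f - t) < e / 2"
      using S(2) T(2) by meson
    have "norm (weyl_conj (A + B) z f - (s + t)) < e"
      using norm_diff_triangle_ineq[of "weyl_conj A z f" "weyl_conj B z f" s t] st
      by (simp add: blinfun.add_left weyl_add)
    then show ?thesis using st by force
  qed
  then show ?case
    by (intro exI[of _ "(\<lambda>(s, t). s + t) ` (S \<times> T)"] conjI finite_imageI finite_cartesian_product allI S(1) T(1) net)
qed

lemma norm_weyl_conj_le: "norm (weyl_conj A z f) \<le> norm A * norm f"
  using norm_blinfun[of A "weyl z f"] by simp

text \<open>Conjugation is multiplicative and does not increase the operator norm. A net for the
  orbit of B, followed by a net for the orbit of A at each of its finitely many points, is a net for
  the product.\<close>

lemma precompact_weyl_orbits_comp: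
  assumes A: "precompact_weyl_orbits A" and B: "precompact_weyl_orbits B"
  shows "precompact_weyl_orbits (A o\<^sub>L B)"
  unfolding precompact_weyl_orbits_def
proof (intro allI impI, goal_cases)
  case e: (1 f e)
  \<comment> \<open>The coarseness that A may magnify to at most e/2; the summand 1 covers norm A =
    0.\<close>
  define d where "d = e / (2 * (norm A + 1))"
    have half: "x * (e / (2 * x)) = e / 2" if "x > 0" for x
      using that by simp
  have A1: "norm A + 1 > 0" by (simp add: add_nonneg_pos)
  have d: "d > 0" using e A1 by (simp add: d_def)
  have Ad: "norm A * d \<le> e / 2"
  proof -
    have "norm A * d \<le> (norm A + 1) * d" using d by (intro mult_right_mono) auto
    also have "\<dots> = e / 2" unfolding d_def by (rule half[OF A1])
    finally show ?thesis .
  qed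
  have e2: "e / 2 > 0" using e by simp
  obtain S where S: "finite S" "\<And>z. \<exists>t\<in>S. norm (weyl_conj B z f - t) < d"
    using precompact_weyl_orbitsD[OF B d] by metis
  have "\<exists>T. finite T \<and> (\<forall>z. \<exists>t\<in>T. norm (weyl_conj A z s - t) < e / 2)" for s
    using precompact_weyl_orbitsD[OF A e2] by metis
  then obtain T where T: "\<And>s. finite (T s)" "\<And>s z. \<exists>t\<in>T s. norm (weyl_conj A z s - t) < e / 2"
    by metis
  have "\<exists>t\<in>(\<Union>s\<in>S. T s). norm (weyl_conj (A o\<^sub>L B) z f - t) < e" for z
  proof -
    define u where "u = weyl_conj B z f"
    obtain s where s: "s \<in> S" "norm (u - s) < d" using S(2) u_def by blast
    obtain t where t: "t \<in> T s" "norm (weyl_conj A z s - t) < e / 2" using T(2) by blast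
    have "weyl_conj (A o\<^sub>L B) z f - t
      = weyl_conj A z (u - s) + (weyl_conj A z s - t)"
      by (simp add: u_def weyl_inverse weyl_diff blinfun.diff_right)
    also have "norm \<dots> \<le> norm (weyl_conj A z (u - s)) + norm (weyl_conj A z s - t)"
      by (rule norm_triangle_ineq)
    also have "norm (weyl_conj A z (u - s)) \<le> norm A * d"
      using norm_weyl_conj_le[of z A "u - s"] s(2) mult_left_mono[of "norm (u - s)" d "norm A"] by simp
    finally have "norm (weyl_conj (A o\<^sub>L B) z f - t) < e"
      using t(2) Ad by linarith
    then show ?thesis using s t by blast
  qed
  then show ?case
    using S(1) T(1) by (intro exI[of _ "\<Union>s\<in>S. T s"]) auto
qed

lemma precompact_weyl_orbits_scaleC:
  assumes A: "precompact_weyl_orbits A"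
  shows "precompact_weyl_orbits (op_scaleC c A)"
  unfolding precompact_weyl_orbits_def
proof (intro allI impI, goal_cases)
  case e: (1 f e)
  define d where "d = e / (cmod c + 1)"
  have c1: "cmod c + 1 > 0" by (simp add: add_nonneg_pos)
  have d: "d > 0" using e c1 by (simp add: d_def)
  have cd: "(cmod c + 1) * d = e" using c1 by (simp add: d_def)
  obtain S where S: "finite S" "\<And>z. \<exists>t\<in>S. norm (weyl_conj A z f - t) < d"
    using precompact_weyl_orbitsD[OF A d] by metis
  have "\<exists>t\<in>scaleC c ` S. norm (weyl_conj (op_scaleC c A) z f - t) < e" for z
  proof -
    obtain s where s: "s \<in> S" "norm (weyl_conj A z f - s) < d"
      using S(2) by blast
    have "norm (weyl_conj (op_scaleC c A) z f - c *\<^sub>C s) = cmod c * norm (weyl_conj A z f - s)"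
      by (simp add: op_scaleC_apply weyl_scaleC norm_scaleC flip: fock.scale_right_diff_distrib)
    also have "\<dots> \<le> cmod c * d"
      using s by (intro mult_left_mono) auto
    also have "\<dots> < e"
      using cd d by (simp add: distrib_right)
    finally show ?thesis using s by blast
  qed
  then show ?case
    using S(1) by blast
qed

text \<open>The conjugates of X n and A differ by at most norm (X n - A), uniformly in z, so a net
  for an approximant serves for the limit.\<close>

lemma closed_precompact_weyl_orbits: "closed {A. precompact_weyl_orbits A}"
  unfolding closed_sequential_limits
proof (intro allI impI, elim conjE)
  fix X A assume X: "\<forall>n. X n \<in> {A. precompact_weyl_orbits A}" and lim: "X \<longlonglongrightarrow> A"
  have "precompact_weyl_orbits A"
    unfolding precompact_weyl_orbits_def
  proof (intro allI impI, goal_cases)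
    case e: (1 f e)
    define d where "d = e / (2 * (norm f + 1))"
    have half: "x * (e / (2 * x)) = e / 2" if "x > 0" for x
      using that by simp
    have f1: "norm f + 1 > 0" by (simp add: add_nonneg_pos)
    have d: "d > 0" using e f1 by (simp add: d_def)
    have fd: "d * norm f \<le> e / 2"
    proof -
      have "d * norm f \<le> d * (norm f + 1)" using d by (intro mult_left_mono) auto
      also have "\<dots> = e / 2" unfolding d_def using half[OF f1] by (simp only: mult.commute)
      finally show ?thesis .
    qed
    obtain n where n: "norm (X n - A) < d"
      using LIMSEQ_D[OF lim d] by blast
    have e2: "e / 2 > 0" using e by simp
    have Xn: "precompact_weyl_orbits (X n)" using X by blast
    obtain S where S: "finite S" "\<And>z. \<exists>t\<in>S. norm (weyl_conj (X n) z f - t) < e / 2"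
      using precompact_weyl_orbitsD[OF Xn e2] by metis
    have "\<exists>t\<in>S. norm (weyl_conj A z f - t) < e" for z
    proof -
      obtain s where s: "s \<in> S" "norm (weyl_conj (X n) z f - s) < e / 2"
        using S(2) by blast
      have "weyl_conj A z f - s
        = (weyl_conj (X n) z f - s) - weyl_conj (X n - A) z f"
        by (simp add: blinfun.diff_left weyl_diff)
      also have "norm \<dots> \<le> norm (weyl_conj (X n) z f - s) + norm (weyl_conj (X n - A) z f)"
        by (rule norm_triangle_ineq4)
      also have "norm (weyl_conj (X n - A) z f) \<le> d * norm f"
        using norm_weyl_conj_le[of z "X n - A" f] n mult_right_mono[of "norm (X n - A)" d "norm f"] by simp
      finally have "norm (weyl_conj A z f - s) < e"
        using s(2) fd by linarith
      then show ?thesis using s by blast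
    qed
    then show ?case
      using S(1) by blast
  qed
  then show "A \<in> {A. precompact_weyl_orbits A}" by simp
qed

theorem toeplitz_algebra_precompact_weyl_orbits:
  assumes "A \<in> toeplitz_algebra"
  shows "precompact_weyl_orbits A" "A \<in> fock_operators"
proof -
  \<comment> \<open>Precompactness of orbits is a condition in the strong topology and says nothing
    directly about adjoints, so A and its adjoint are required to have it together. Toeplitz
    operators qualify because the adjoint has the conjugate symbol.\<close>
  define S where "S = {A \<in> fock_operators. precompact_weyl_orbits A \<and> precompact_weyl_orbits (op_adjoint A)}"
  have "closed S"
    unfolding closed_sequential_limits
  proof (intro allI impI, elim conjE)
    fix X A assume X: "\<forall>n. X n \<in> S" and lim: "X \<longlonglongrightarrow> A"
    have XO: "X n \<in> fock_operators" for n using X by (auto simp: S_def)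
    have A: "A \<in> fock_operators"
      by (rule closed_sequentially[OF closed_fock_operators XO lim])
    have "(\<lambda>n. op_adjoint (X n)) \<longlonglongrightarrow> op_adjoint A"
    proof (rule Lim_null_comparison[THEN Lim_null[THEN iffD2]])
      show "\<forall>\<^sub>F n in sequentially. norm (op_adjoint (X n) - op_adjoint A) \<le> norm (X n - A)"
        using norm_op_adjoint_le[OF fock_operators_diff[OF XO A]] by (simp add: op_adjoint_diff XO A)
      show "(\<lambda>n. norm (X n - A)) \<longlonglongrightarrow> 0"
        using lim by (simp add: LIM_zero tendsto_norm_zero)
    qed
    moreover have "op_adjoint (X n) \<in> {A. precompact_weyl_orbits A}" "X n \<in> {A. precompact_weyl_orbits A}" for n
      using X by (auto simp: S_def)
    ultimately have "A \<in> {A. precompact_weyl_orbits A}" "op_adjoint A \<in> {A. precompact_weyl_orbits A}"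
      using closed_sequentially[OF closed_precompact_weyl_orbits] lim by metis+
    then show "A \<in> S" using A by (simp add: S_def)
  qed
  then have "cstar_subalgebra S"
    by (auto simp: cstar_subalgebra_def S_def op_adjoint_zero op_adjoint_add op_adjoint_comp op_adjoint_scaleC
        op_adjoint_op_adjoint op_adjoint_mem fock_operators_zero fock_operators_add fock_operators_comp fock_operators_scaleC
        precompact_weyl_orbits_zero precompact_weyl_orbits_add precompact_weyl_orbits_comp precompact_weyl_orbits_scaleC)
  moreover have "toeplitz ` L_infinity \<subseteq> S"
  proof
    fix B assume "B \<in> toeplitz ` L_infinity"
    then obtain F where F: "F \<in> L_infinity" "B = toeplitz F" by blast
    obtain C where "C \<ge> 0" "AE z in gauss. cmod (F z) \<le> C" "F \<in> borel_measurable borel"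
      using L_infinityE[OF F(1)] .
    then have "B \<in> fock_operators"
      using toeplitz_mem F(2) by blast
    then show "B \<in> S"
      using F op_adjoint_toeplitz[OF F(1)] by (auto simp: S_def precompact_weyl_orbits_toeplitz)
  qed
  ultimately have "toeplitz_algebra \<subseteq> S"
    unfolding toeplitz_algebra_def by (intro hull_minimal)
  then show "precompact_weyl_orbits A" "A \<in> fock_operators"
    using assms by (auto simp: S_def)
qed

text \<open>The orbit of the constant 1 stays near finitely many vectors, each decaying relative to
  exp(|z|^2/2), so one radius serves for all w. Translating back by w turns decay at infinity into
  decay away from w.\<close>

lemma precompact_weyl_orbits_decay:
  assumes V: "precompact_weyl_orbits V" and e: "e > 0"
  obtains R where "R > 0" "\<And>w z. R \<le> cmod (z - w) \<Longrightarrow>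
    cmod (fock_fun (blinfun_apply V (weyl w fock_one)) z) \<le> e * exp ((cmod z)\<^sup>2 / 2)"
proof -
  have e2: "e / 2 > 0" using e by simp
  obtain T where T: "finite T" "\<And>z. \<exists>t\<in>T. norm (weyl_conj V z fock_one - t) < e / 2"
    using precompact_weyl_orbitsD[OF V e2] by metis
  have "\<exists>R>0. \<forall>w. R \<le> cmod w \<longrightarrow> cmod (fock_fun t w) \<le> e / 2 * exp ((cmod w)\<^sup>2 / 2)" for t
    using fock_decay[OF e2, of t] by metis
  then obtain R where R: "\<And>t. R t > 0" "\<And>t w. R t \<le> cmod w \<Longrightarrow> cmod (fock_fun t w) \<le> e / 2 * exp ((cmod w)\<^sup>2 / 2)"
    by metis
  define R' where "R' = 1 + (\<Sum>t\<in>T. R t)"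
  have R': "R t \<le> R'" if "t \<in> T" for t
    using member_le_sum[of t T R] that T(1) R(1) by (simp add: R'_def less_imp_le add_increasing)
  have "cmod (fock_fun (blinfun_apply V (weyl w fock_one)) z) \<le> e * exp ((cmod z)\<^sup>2 / 2)" if zw: "R' \<le> cmod (z - w)" for w z
  proof -
    define G where "G = weyl_conj V w fock_one"
    obtain t where t: "t \<in> T" "norm (G - t) < e / 2" using T(2) G_def by blast
    have "cmod (fock_fun G (z - w)) \<le> cmod (fock_fun (G - t) (z - w)) + cmod (fock_fun t (z - w))"
      using norm_triangle_ineq[of "fock_fun (G - t) (z - w)" "fock_fun t (z - w)"] by simp
    also have "\<dots> \<le> e / 2 * exp ((cmod (z - w))\<^sup>2 / 2) + e / 2 * exp ((cmod (z - w))\<^sup>2 / 2)"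
    proof (rule add_mono)
      show "cmod (fock_fun (G - t) (z - w)) \<le> e / 2 * exp ((cmod (z - w))\<^sup>2 / 2)"
        by (rule order_trans[OF norm_fock_fun_le mult_right_mono[OF less_imp_le[OF t(2)]]]) simp
      show "cmod (fock_fun t (z - w)) \<le> e / 2 * exp ((cmod (z - w))\<^sup>2 / 2)"
        using R(2)[of t "z - w"] R'[OF t(1)] zw by simp
    qed
    finally have G_le: "cmod (fock_fun G (z - w)) \<le> e * exp ((cmod (z - w))\<^sup>2 / 2)" by simp
    have "blinfun_apply V (weyl w fock_one) = weyl w G"
      by (simp add: G_def weyl_inverse)
    then have "cmod (fock_fun (blinfun_apply V (weyl w fock_one)) z) = exp (Re (cnj w * z) - (cmod w)\<^sup>2 / 2) * cmod (fock_fun G (z - w))"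
      by (simp add: cmod_fock_fun_weyl)
    also have "\<dots> \<le> exp (Re (cnj w * z) - (cmod w)\<^sup>2 / 2) * (e * exp ((cmod (z - w))\<^sup>2 / 2))"
      by (intro mult_left_mono G_le) auto
    also have "\<dots> = e * exp (Re (cnj w * z) - (cmod w)\<^sup>2 / 2 + (cmod (z - w))\<^sup>2 / 2)"
      by (simp add: exp_add)
    also have "Re (cnj w * z) - (cmod w)\<^sup>2 / 2 + (cmod (z - w))\<^sup>2 / 2 = (cmod z)\<^sup>2 / 2"
      by (simp add: cmod_power2 power2_diff field_simps)
    finally show ?thesis .
  qed
  moreover have "R' > 0"
    unfolding R'_def by (intro add_pos_nonneg sum_nonneg) (auto intro: less_imp_le R(1))
  ultimately show ?thesis using that by blast
qed

subsection \<open>Littlewood-Paley estimates\<close>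

lemma entire_shift:
  assumes f: "f holomorphic_on UNIV"
  obtains q where "q holomorphic_on UNIV" "\<And>z. f z = f a + (z - a) * q z"
proof -
  define q where "q z = (if z = a then deriv f a else (f z - f a) / (z - a))" for z
  have "q holomorphic_on UNIV"
    unfolding q_def by (rule pole_lemma[OF f]) simp
  moreover have "f z = f a + (z - a) * q z" for z
    by (simp add: q_def)
  ultimately show ?thesis using that by blast
qed

lemma taylor_coeff_shift:
  assumes q: "q holomorphic_on UNIV" and f: "\<And>z. f z = c + z * q z"
  shows "taylor_coeff f (Suc n) = taylor_coeff q n"
proof -
  have "q has_fps_expansion fps_expansion q 0"
    using q by (intro analytic_at_imp_has_fps_expansion_0) (auto simp: analytic_at)
  then have "(\<lambda>z. c + z * q z) has_fps_expansion fps_const c + fps_X * fps_expansion q 0"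
    by (intro fps_expansion_intros)
  then have "f has_fps_expansion fps_const c + fps_X * fps_expansion q 0"
    by (simp flip: f)
  then have "fps_nth (fps_expansion f 0) (Suc n) = fps_nth (fps_expansion q 0) n"
    by (simp add: fps_expansion_eqI)
  then show ?thesis
    by (simp only: fps_expansion_def fps_nth_Abs_fps taylor_coeff_def)
qed

text \<open>Splits off the terms below the degree of interest: below a hypothetical coefficient of
  \<phi> of degree at least 2, and below the order of vanishing of g' at 0.\<close>

lemma entire_split:
  assumes f: "f holomorphic_on UNIV"
  obtains q where "q holomorphic_on UNIV" "\<And>z. f z = (\<Sum>i<n. taylor_coeff f i * z ^ i) + z ^ n * q z"
    "\<And>m. taylor_coeff q m = taylor_coeff f (n + m)"
proof (induction n arbitrary: thesis)
  case 0
  show ?case by (rule 0[of f]) (auto simp: f)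
next
  case (Suc n)
  obtain q where q: "q holomorphic_on UNIV" "\<And>z. f z = (\<Sum>i<n. taylor_coeff f i * z ^ i) + z ^ n * q z"
    "\<And>m. taylor_coeff q m = taylor_coeff f (n + m)"
    using Suc.IH by blast
  obtain p where p: "p holomorphic_on UNIV" "\<And>z. q z = q 0 + (z - 0) * p z"
    using entire_shift[OF q(1)] by blast
  have q0: "q 0 = taylor_coeff f n"
    using q(3)[of 0] by (simp add: taylor_coeff_def)
  show ?case
  proof (rule Suc.prems[OF p(1)])
    show "f z = (\<Sum>i<Suc n. taylor_coeff f i * z ^ i) + z ^ Suc n * p z" for z
    proof -
      have "f z = (\<Sum>i<n. taylor_coeff f i * z ^ i) + z ^ n * q z" by (rule q(2))
      also have "q z = taylor_coeff f n + z * p z" using p(2)[of z] by (simp only: q0 diff_0_right)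
      finally show ?thesis by (simp add: algebra_simps)
    qed
    show "taylor_coeff p m = taylor_coeff f (Suc n + m)" for m
    proof -
      have "q z = q 0 + z * p z" for z
        using p(2)[of z] by (simp only: diff_0_right)
      then have "taylor_coeff q (Suc m) = taylor_coeff p m"
        by (rule taylor_coeff_shift[OF p(1)])
      then show ?thesis
        using q(3)[of "Suc m"] by (simp only: add_Suc_shift)
    qed
  qed
qed

lemma taylor_coeff_deriv: "taylor_coeff (deriv f) n = of_nat (Suc n) * taylor_coeff f (Suc n)"
proof -
  have "(deriv ^^ n) (deriv f) = (deriv ^^ Suc n) f"
    by (simp only: funpow_Suc_right o_apply)
  then have "taylor_coeff (deriv f) n = (deriv ^^ Suc n) f 0 / fact n"
    by (simp only: taylor_coeff_def)
  also have "\<dots> = of_nat (Suc n) * ((deriv ^^ Suc n) f 0 / (of_nat (Suc n) * fact n))"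
  proof -
    have "x / y = of_nat (Suc n) * (x / (of_nat (Suc n) * y))" for x y :: complex
      by (simp del: of_nat_Suc)
    then show ?thesis .
  qed
  finally show ?thesis
    by (simp only: taylor_coeff_def fact_Suc)
qed

text \<open>With r = 1/(1 + |z|), a point w at distance r satisfies |w|^2 <= |z|^2 + 2 |z| r + r^2
  <= |z|^2 + 3. Cauchy's estimate thus costs exp(3/2) from the weight and 1 + |z| from division by
  r.\<close>

lemma deriv_gauss_bound:
  assumes F: "F holomorphic_on UNIV" and e: "0 \<le> e"
    and le: "\<And>w. cmod (w - z) \<le> 1 / (1 + cmod z) \<Longrightarrow> cmod (F w) \<le> e * exp ((cmod w)\<^sup>2 / 2)"
  shows "cmod (deriv F z) \<le> e * exp (3 / 2) * (1 + cmod z) * exp ((cmod z)\<^sup>2 / 2)"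
proof -
  define r where "r = 1 / (1 + cmod z)"
  have z1: "1 + cmod z > 0" by (simp add: add_pos_nonneg)
  have r: "r > 0" "r \<le> 1" "cmod z * r \<le> 1"
    using z1 by (auto simp: r_def)
  define B where "B = e * (exp (3 / 2) * exp ((cmod z)\<^sup>2 / 2))"
  have "cmod ((deriv ^^ 1) F z) \<le> fact 1 * B / r ^ 1"
  proof (rule Cauchy_inequality)
    show "F holomorphic_on ball z r" using F holomorphic_on_subset by blast
    show "continuous_on (cball z r) F"
      using F holomorphic_on_imp_continuous_on continuous_on_subset by blast
    fix w assume w: "cmod (z - w) = r"
    have "cmod w \<le> cmod z + r"
      using norm_triangle_ineq4[of z "z - w"] w by simp
    then have "(cmod w)\<^sup>2 \<le> (cmod z + r)\<^sup>2" by (intro power_mono) auto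
    also have "\<dots> = (cmod z)\<^sup>2 + 2 * (cmod z * r) + r * r" by (simp add: power2_eq_square algebra_simps)
    also have "\<dots> \<le> (cmod z)\<^sup>2 + 2 + 1" using r mult_mono[of r 1 r 1] by simp
    finally have "exp ((cmod w)\<^sup>2 / 2) \<le> exp (3 / 2 + (cmod z)\<^sup>2 / 2)" by simp
    then have "e * exp ((cmod w)\<^sup>2 / 2) \<le> B"
      unfolding B_def exp_add by (rule mult_left_mono[OF _ e])
    moreover have "cmod (F w) \<le> e * exp ((cmod w)\<^sup>2 / 2)"
      using w by (intro le) (simp add: r_def norm_minus_commute)
    ultimately show "cmod (F w) \<le> B" by simp
  qed (rule r)
  then show ?thesis
    by (simp add: B_def r_def mult_ac)
qed

lemma ennreal_suminf_shift_le: "(\<Sum>n. g (n + k)) \<le> (\<Sum>n. (g n :: ennreal))"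
proof (rule suminf_le_const[OF summableI])
  fix N
  have "(\<Sum>n<N. g (n + k)) = sum g ((\<lambda>n. n + k) ` {..<N})"
    by (simp add: sum.reindex)
  also have "\<dots> \<le> (\<Sum>n. g n)"
    by (intro sum_le_suminf) auto
  finally show "(\<Sum>n<N. g (n + k)) \<le> (\<Sum>n. g n)" .
qed

lemma ennreal_suminf_drop_zero:
  assumes "(g 0 :: ennreal) = 0"
  shows "(\<Sum>n. g n) \<le> (\<Sum>n. g (Suc n))"
proof (rule suminf_le_const[OF summableI])
  fix N
  show "(\<Sum>n<N. g n) \<le> (\<Sum>n. g (Suc n))"
  proof (cases N)
    case (Suc M)
    have "(\<Sum>n<N. g n) = (\<Sum>n<M. g (Suc n))"
      using assms by (simp only: Suc sum.lessThan_Suc_shift) simp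
    also have "\<dots> \<le> (\<Sum>n. g (Suc n))"
      by (intro sum_le_suminf) auto
    finally show ?thesis .
  qed simp
qed

text \<open>The n-th coefficient of q is n + 2 times that of F at n + 2, and (n + 2)^2 n! <= 2 (n +
  2)!. Division by z therefore compensates for differentiation; this controls the preimages in the
  description of the range.\<close>

lemma fock_deriv_quotient:
  assumes q: "q holomorphic_on UNIV" and eq: "\<And>z. deriv (fock_fun F) z = c + z * q z"
  shows "(\<integral>\<^sup>+z. ennreal ((cmod (q z))\<^sup>2) \<partial>gauss) < \<infinity>"
proof -
  let ?g = "\<lambda>n. ennreal ((cmod (taylor_coeff (fock_fun F) n))\<^sup>2) * ennreal (fact n)"
  have tq: "taylor_coeff q n = of_nat (n + 2) * taylor_coeff (fock_fun F) (n + 2)" for n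
    using taylor_coeff_shift[OF q eq, of n] taylor_coeff_deriv[of "fock_fun F" "Suc n"] by simp
  have "(\<integral>\<^sup>+z. ennreal ((cmod (q z))\<^sup>2) \<partial>gauss) = (\<Sum>n. ennreal ((cmod (taylor_coeff q n))\<^sup>2) * ennreal (fact n))"
    by (rule parseval_gauss[OF q])
  also have "\<dots> \<le> (\<Sum>n. 2 * ?g (n + 2))"
  proof (intro suminf_le summableI)
    fix n
    let ?a = "(cmod (taylor_coeff (fock_fun F) (n + 2)))\<^sup>2"
    have "real (n + 2) * (real (n + 2) * fact n) \<le> real (n + 2) * (2 * (real (n + 1) * fact n))"
      by (intro mult_left_mono) (auto simp: algebra_simps)
    then have "(real (n + 2))\<^sup>2 * fact n \<le> 2 * fact (n + 2)"
      by (simp add: power2_eq_square algebra_simps)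
    then have "?a * ((real (n + 2))\<^sup>2 * fact n) \<le> ?a * (2 * fact (n + 2))"
      by (intro mult_left_mono) auto
    then have "(cmod (taylor_coeff q n))\<^sup>2 * fact n \<le> 2 * (?a * fact (n + 2))"
      unfolding tq norm_mult norm_of_nat power_mult_distrib by (simp only: mult_ac)
    then have "ennreal ((cmod (taylor_coeff q n))\<^sup>2 * fact n) \<le> ennreal (2 * (?a * fact (n + 2)))"
      by (rule ennreal_leI)
    then show "ennreal ((cmod (taylor_coeff q n))\<^sup>2) * ennreal (fact n) \<le> 2 * ?g (n + 2)"
      by (simp only: ennreal_mult zero_le_power2 fact_ge_zero mult_nonneg_nonneg ennreal_numeral zero_le_numeral)
  qed
  also have "\<dots> = 2 * (\<Sum>n. ?g (n + 2))"
    by (rule ennreal_suminf_cmult)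
  also have "\<dots> \<le> 2 * (\<Sum>n. ?g n)"
    by (intro mult_left_mono ennreal_suminf_shift_le) auto
  also have "(\<Sum>n. ?g n) = ennreal ((norm F)\<^sup>2)"
    by (simp add: ennreal_norm_fock_square parseval_gauss[OF holomorphic_fock_fun])
  also have "2 * ennreal ((norm F)\<^sup>2) < \<infinity>"
    by (simp add: ennreal_mult_less_top)
  finally show ?thesis .
qed

text \<open>Jensen's inequality for 1/y with y = 1 + |z|^2: under |z|^(2n) dmu, normalized by n!,
  the mean of y is n + 2. The tangent to 1/y at that mean is integrated.\<close>

lemma gauss_weighted_moment:
  "ennreal (fact n / real (n + 2)) \<le> (\<integral>\<^sup>+z. ennreal (1 / (1 + (cmod z)\<^sup>2)) * ennreal ((cmod z) ^ (2 * n)) \<partial>gauss)"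
  (is "_ \<le> ?D")
proof -
  define s where "s = real (n + 2)"
  have s: "s > 0" by (simp add: s_def)
  let ?x = "\<lambda>z::complex. (cmod z)\<^sup>2"
  have mom: "(\<integral>\<^sup>+z. ennreal (c * ?x z ^ k) \<partial>gauss) = ennreal (c * fact k)" if "c \<ge> 0" for c k
    using that gauss_moment[of k] by (simp add: ennreal_mult nn_integral_cmult flip: power_mult)
  \<comment> \<open>Written as two equal summands so that one can be cancelled at the end instead of
    subtracting in \<open>ennreal\<close>.\<close>
  have "ennreal (fact n / s) + ennreal (fact n / s) = (\<integral>\<^sup>+z. ennreal (2 / s * ?x z ^ n) \<partial>gauss)"
    using s by (subst mom) (auto simp flip: ennreal_plus)
  also have "\<dots> \<le> (\<integral>\<^sup>+z. ennreal (1 / (1 + ?x z)) * ennreal ((cmod z) ^ (2 * n))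
      + (ennreal (1 / s\<^sup>2 * ?x z ^ n) + ennreal (1 / s\<^sup>2 * ?x z ^ Suc n)) \<partial>gauss)"
  proof (rule nn_integral_mono)
    fix z :: complex
    define y where "y = 1 + ?x z"
    have y: "y > 0" by (simp add: y_def add_pos_nonneg)
    have "0 \<le> (1 / y) * (1 - y / s)\<^sup>2" using y by simp
    also have "\<dots> = 1 / y - 2 / s + y / s\<^sup>2"
      using y s by (simp add: power2_diff power2_eq_square field_simps)
    finally have "2 / s \<le> 1 / y + 1 / s\<^sup>2 * y" by simp
    then have "2 / s * ?x z ^ n \<le> (1 / y + 1 / s\<^sup>2 * y) * ?x z ^ n"
      by (rule mult_right_mono) simp
    also have "\<dots> = 1 / y * ?x z ^ n + (1 / s\<^sup>2 * ?x z ^ n + 1 / s\<^sup>2 * ?x z ^ Suc n)"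
      by (simp add: y_def algebra_simps)
    finally have "ennreal (2 / s * ?x z ^ n) \<le> ennreal (1 / y * ?x z ^ n + (1 / s\<^sup>2 * ?x z ^ n + 1 / s\<^sup>2 * ?x z ^ Suc n))"
      by (rule ennreal_leI)
    also have "\<dots> = ennreal (1 / y) * ennreal ((cmod z) ^ (2 * n)) + (ennreal (1 / s\<^sup>2 * ?x z ^ n) + ennreal (1 / s\<^sup>2 * ?x z ^ Suc n))"
    proof -
      have "0 \<le> 1 / y * ?x z ^ n" "0 \<le> 1 / s\<^sup>2 * ?x z ^ n" "0 \<le> 1 / s\<^sup>2 * ?x z ^ Suc n" "0 \<le> 1 / y" "0 \<le> ?x z ^ n"
        using y by auto
      then show ?thesis
        by (simp only: ennreal_plus ennreal_mult add_nonneg_nonneg power_mult)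
    qed
    finally show "ennreal (2 / s * ?x z ^ n) \<le> ennreal (1 / (1 + ?x z)) * ennreal ((cmod z) ^ (2 * n))
      + (ennreal (1 / s\<^sup>2 * ?x z ^ n) + ennreal (1 / s\<^sup>2 * ?x z ^ Suc n))"
      by (simp only: y_def)
  qed
  also have "\<dots> = ?D + (ennreal (1 / s\<^sup>2 * fact n) + ennreal (1 / s\<^sup>2 * fact (Suc n)))"
    by (subst nn_integral_add, measurable, subst nn_integral_add, measurable)
       (simp only: mom zero_le_divide_1_iff zero_le_power2)
  also have "ennreal (1 / s\<^sup>2 * fact n) + ennreal (1 / s\<^sup>2 * fact (Suc n)) = ennreal (fact n / s)"
  proof -
    have "1 / s\<^sup>2 * fact n + 1 / s\<^sup>2 * fact (Suc n) = fact n * s / s\<^sup>2"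
      by (simp add: s_def field_simps)
    also have "\<dots> = fact n / s"
      using s by (simp add: power2_eq_square)
    finally show ?thesis
      by (subst ennreal_plus[symmetric]) auto
  qed
  finally have "ennreal (fact n / s) + ennreal (fact n / s) \<le> ennreal (fact n / s) + ?D"
    by (simp only: add.commute)
  then show ?thesis
    unfolding s_def[symmetric] by (subst (asm) ennreal_add_left_cancel_le) auto
qed

text \<open>Coefficientwise, F' has coefficient (n + 1) a(n + 1) and weighted moment at least n!/(n
  + 2); so the comparison is (n + 1)! <= 2 (n + 1)^2 n!/(n + 2), that is n + 2 <= 2 (n + 1). The
  vanishing of F at 0 removes the term that the derivative does not see.\<close>

lemma littlewood_paley:
  assumes F: "F holomorphic_on UNIV" and F0: "F 0 = 0"
  shows "(\<integral>\<^sup>+z. ennreal ((cmod (F z))\<^sup>2) \<partial>gauss)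
    \<le> 2 * (\<integral>\<^sup>+z. ennreal (1 / (1 + (cmod z)\<^sup>2)) * ennreal ((cmod (deriv F z))\<^sup>2) \<partial>gauss)"
proof -
  let ?a = "taylor_coeff F"
  let ?D = "\<lambda>n. \<integral>\<^sup>+z. ennreal (1 / (1 + (cmod z)\<^sup>2)) * ennreal ((cmod z) ^ (2 * n)) \<partial>gauss"
  have "(\<integral>\<^sup>+z. ennreal ((cmod (F z))\<^sup>2) \<partial>gauss) = (\<Sum>n. ennreal ((cmod (?a n))\<^sup>2) * ennreal (fact n))"
    by (rule parseval_gauss[OF F])
  also have "\<dots> \<le> (\<Sum>n. ennreal ((cmod (?a (Suc n)))\<^sup>2) * ennreal (fact (Suc n)))"
    by (rule ennreal_suminf_drop_zero) (simp add: taylor_coeff_def F0)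
  also have "\<dots> \<le> (\<Sum>n. 2 * (ennreal ((cmod (taylor_coeff (deriv F) n))\<^sup>2) * ?D n))"
  proof (intro suminf_le summableI)
    fix n
    let ?b = "(cmod (?a (Suc n)))\<^sup>2"
    have "fact (Suc n) \<le> 2 * ((real (Suc n))\<^sup>2 * (fact n / real (n + 2)))"
    proof -
      have "real (Suc n) * fact n * real (n + 2) \<le> real (Suc n) * fact n * (2 * real (Suc n))"
        by (intro mult_left_mono) auto
      then have "real (Suc n) * fact n \<le> real (Suc n) * fact n * (2 * real (Suc n)) / real (n + 2)"
        by (subst pos_le_divide_eq) auto
      moreover have "real (Suc n) * fact n * (2 * real (Suc n)) / real (n + 2) = 2 * ((real (Suc n))\<^sup>2 * (fact n / real (n + 2)))"
        by (simp only: power2_eq_square times_divide_eq_right mult_ac)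
      ultimately show ?thesis by (simp only: fact_Suc of_nat_mult of_nat_fact)
    qed
    then have "?b * fact (Suc n) \<le> ?b * (2 * ((real (Suc n))\<^sup>2 * (fact n / real (n + 2))))"
      by (rule mult_left_mono) simp
    then have "?b * fact (Suc n) \<le> 2 * ((cmod (taylor_coeff (deriv F) n))\<^sup>2 * (fact n / real (n + 2)))"
      unfolding taylor_coeff_deriv norm_mult norm_of_nat power_mult_distrib by (simp only: mult_ac)
    then have "ennreal (?b * fact (Suc n)) \<le> ennreal (2 * ((cmod (taylor_coeff (deriv F) n))\<^sup>2 * (fact n / real (n + 2))))"
      by (rule ennreal_leI)
    then have "ennreal ?b * ennreal (fact (Suc n))
        \<le> 2 * (ennreal ((cmod (taylor_coeff (deriv F) n))\<^sup>2) * ennreal (fact n / real (n + 2)))"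
      by (simp only: ennreal_mult zero_le_power2 fact_ge_zero mult_nonneg_nonneg ennreal_numeral zero_le_numeral
          divide_nonneg_nonneg of_nat_0_le_iff)
    also have "\<dots> \<le> 2 * (ennreal ((cmod (taylor_coeff (deriv F) n))\<^sup>2) * ?D n)"
      by (intro mult_left_mono gauss_weighted_moment) auto
    finally show "ennreal ?b * ennreal (fact (Suc n)) \<le> 2 * (ennreal ((cmod (taylor_coeff (deriv F) n))\<^sup>2) * ?D n)" .
  qed
  also have "\<dots> = 2 * (\<Sum>n. ennreal ((cmod (taylor_coeff (deriv F) n))\<^sup>2) * ?D n)"
    by (rule ennreal_suminf_cmult)
  also have "(\<Sum>n. ennreal ((cmod (taylor_coeff (deriv F) n))\<^sup>2) * ?D n)
      = (\<integral>\<^sup>+z. ennreal (1 / (1 + (cmod z)\<^sup>2)) * ennreal ((cmod (deriv F z))\<^sup>2) \<partial>gauss)"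
  proof (rule parseval_gauss_density[symmetric])
    show "deriv F holomorphic_on UNIV"
      by (rule holomorphic_deriv[OF F]) simp
    show "ennreal (1 / (1 + (cmod z)\<^sup>2)) \<le> 1" for z :: complex
      by (subst ennreal_1[symmetric], rule ennreal_leI) (simp add: add_pos_nonneg)
  qed (auto simp: norm_mult)
  finally show ?thesis .
qed

subsection \<open>Volterra-type operators\<close>

lemma
  assumes h: "(\<lambda>w. f (\<phi> w) * deriv g w) holomorphic_on UNIV"
  shows volterra_has_field_derivative: "(volterra g \<phi> f has_field_derivative f (\<phi> z) * deriv g z) (at z)"
    and volterra_at_0: "volterra g \<phi> f 0 = 0"
proof -
  obtain G where G: "\<And>x. (G has_field_derivative f (\<phi> x) * deriv g x) (at x)"
    using holomorphic_convex_primitive'[OF convex_UNIV open_UNIV h] by auto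
  have eq: "volterra g \<phi> f = (\<lambda>z. G z - G 0)"
  proof
    fix z
    have "((\<lambda>w. f (\<phi> w) * deriv g w) has_contour_integral (G (pathfinish (linepath 0 z)) - G (pathstart (linepath 0 z)))) (linepath 0 z)"
      by (rule contour_integral_primitive[of UNIV, OF _ valid_path_linepath]) (auto simp: G)
    then show "volterra g \<phi> f z = G z - G 0"
      unfolding volterra_def by (simp add: contour_integral_unique)
  qed
  show "(volterra g \<phi> f has_field_derivative f (\<phi> z) * deriv g z) (at z)"
    unfolding eq by (rule derivative_eq_intros G refl | simp)+
  show "volterra g \<phi> f 0 = 0"
    by (simp add: eq)
qed

lemma fock_eqI_deriv:
  assumes F: "\<And>z. (fock_fun F has_field_derivative d z) (at z)" and G: "\<And>z. (fock_fun G has_field_derivative d z) (at z)"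
    and "fock_fun F 0 = fock_fun G 0"
  shows "F = G"
proof (rule fock_eqI)
  fix z
  have "((\<lambda>z. fock_fun F z - fock_fun G z) has_field_derivative 0) (at x within UNIV)" for x
    using DERIV_diff[OF F G, of x] by simp
  then obtain c where "\<And>x. fock_fun F x - fock_fun G x = c"
    using has_field_derivative_zero_constant[OF convex_UNIV, of "\<lambda>z. fock_fun F z - fock_fun G z"] by blast
  then have "fock_fun F z - fock_fun G z = fock_fun F 0 - fock_fun G 0"
    by simp
  then show "fock_fun F z = fock_fun G z"
    using assms(3) by simp
qed

locale volterra_operator =
  fixes g \<phi> :: "complex \<Rightarrow> complex" and V :: "fock \<Rightarrow>\<^sub>L fock"
  assumes g: "g holomorphic_on UNIV" and \<phi>: "\<phi> holomorphic_on UNIV"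
    and rep: "\<And>f. fock_fun (blinfun_apply V f) = volterra g \<phi> (fock_fun f)"
begin

lemma deriv_g_holomorphic: "deriv g holomorphic_on UNIV"
  by (rule holomorphic_deriv[OF g]) simp

lemma integrand_holomorphic: "(\<lambda>w. fock_fun f (\<phi> w) * deriv g w) holomorphic_on UNIV"
proof -
  have "fock_fun f \<circ> \<phi> holomorphic_on UNIV"
    by (rule holomorphic_on_compose_gen[OF \<phi> holomorphic_fock_fun]) simp
  then show ?thesis
    by (intro holomorphic_intros deriv_g_holomorphic) (simp add: o_def)
qed

lemma V_deriv: "(fock_fun (V f) has_field_derivative fock_fun f (\<phi> z) * deriv g z) (at z)"
  unfolding rep by (rule volterra_has_field_derivative[where f = "fock_fun f" and \<phi> = \<phi> and g = g, OF integrand_holomorphic])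

lemma V_0: "fock_fun (V f) 0 = 0"
  unfolding rep by (rule volterra_at_0[where f = "fock_fun f" and \<phi> = \<phi> and g = g, OF integrand_holomorphic])

text \<open>The function m of the overview. The denominator absorbs the growth that differentiation
  causes in the Fock space.\<close>

definition weight :: "complex \<Rightarrow> real" where
  "weight z = cmod (deriv g z) * exp (((cmod (\<phi> z))\<^sup>2 - (cmod z)\<^sup>2) / 2) / (1 + cmod z)"

lemma weight_nonneg: "0 \<le> weight z"
  by (simp add: weight_def)

lemma weight_eq: "cmod (deriv g z) * exp ((cmod (\<phi> z))\<^sup>2 / 2) = weight z * (1 + cmod z) * exp ((cmod z)\<^sup>2 / 2)"
proof -
  have "1 + cmod z \<noteq> 0"
    using norm_ge_zero[of z] by linarith
  then have "weight z * (1 + cmod z) = cmod (deriv g z) * exp (((cmod (\<phi> z))\<^sup>2 - (cmod z)\<^sup>2) / 2)"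
    by (simp add: weight_def)
  then show ?thesis
    by (simp add: diff_divide_distrib exp_diff)
qed

text \<open>At z the derivative of V applied to the normalized kernel at \<phi>(z) has modulus
  |g'(z)| exp(|\<phi>(z)|^2/2). Only values within 1/(1 + |z|) of z enter, so the same argument
  serves the global bound by norm V and the decay far from \<phi>(z).\<close>

lemma weight_le_local:
  assumes e: "0 \<le> e" and le: "\<And>w. cmod (w - z) \<le> 1 / (1 + cmod z) \<Longrightarrow>
    cmod (fock_fun (V (weyl (\<phi> z) fock_one)) w) \<le> e * exp ((cmod w)\<^sup>2 / 2)"
  shows "weight z \<le> e * exp (3 / 2)"
proof -
  let ?F = "fock_fun (V (weyl (\<phi> z) fock_one))"
  have "cmod (deriv ?F z) = cmod (fock_fun (weyl (\<phi> z) fock_one) (\<phi> z)) * cmod (deriv g z)"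
    unfolding DERIV_imp_deriv[OF V_deriv] by (rule norm_mult)
  also have "cmod (fock_fun (weyl (\<phi> z) fock_one) (\<phi> z)) = exp ((cmod (\<phi> z))\<^sup>2 / 2)"
  proof -
    have "Re (cnj (\<phi> z) * \<phi> z) = (cmod (\<phi> z))\<^sup>2"
      unfolding cmod_power2 by (simp add: power2_eq_square)
    then show ?thesis by (simp add: cmod_fock_fun_weyl)
  qed
  finally have "weight z * (1 + cmod z) * exp ((cmod z)\<^sup>2 / 2) = cmod (deriv ?F z)"
    by (simp only: weight_eq[symmetric]) (simp only: mult.commute)
  also have "\<dots> \<le> e * exp (3 / 2) * (1 + cmod z) * exp ((cmod z)\<^sup>2 / 2)"
    by (rule deriv_gauss_bound[OF holomorphic_fock_fun e le])
  finally have "weight z * (1 + cmod z) \<le> e * exp (3 / 2) * (1 + cmod z)"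
    by (subst (asm) mult_le_cancel_right_pos) auto
  then show ?thesis
    by (subst (asm) mult_le_cancel_right_pos) (auto simp: add_pos_nonneg)
qed

lemma weight_bounded: "weight z \<le> norm V * exp (3 / 2)"
proof (rule weight_le_local)
  fix w
  have "cmod (fock_fun (V (weyl (\<phi> z) fock_one)) w) \<le> norm (V (weyl (\<phi> z) fock_one)) * exp ((cmod w)\<^sup>2 / 2)"
    by (rule norm_fock_fun_le)
  also have "\<dots> \<le> norm V * exp ((cmod w)\<^sup>2 / 2)"
    using norm_blinfun[of V "weyl (\<phi> z) fock_one"] by (intro mult_right_mono) auto
  finally show "cmod (fock_fun (V (weyl (\<phi> z) fock_one)) w) \<le> norm V * exp ((cmod w)\<^sup>2 / 2)" .
qed simp

lemma weight_small:
  assumes V: "precompact_weyl_orbits V" and e: "e > 0"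
  obtains R where "\<And>z. R \<le> cmod (\<phi> z - z) \<Longrightarrow> weight z \<le> e"
proof -
  define d where "d = e / exp (3 / 2)"
  have d: "d > 0" "d * exp (3 / 2) = e" using e by (simp_all add: d_def)
  obtain R where R: "R > 0" "\<And>w z. R \<le> cmod (z - w) \<Longrightarrow>
    cmod (fock_fun (V (weyl w fock_one)) z) \<le> d * exp ((cmod z)\<^sup>2 / 2)"
    using precompact_weyl_orbits_decay[OF V d(1)] by metis
  \<comment> \<open>The extra 1 pays for moving from z to a point w of the disc used in Cauchy's
    estimate, whose radius is at most 1.\<close>
  have "weight z \<le> e" if z: "R + 1 \<le> cmod (\<phi> z - z)" for z
  proof -
    have "weight z \<le> d * exp (3 / 2)"
    proof (rule weight_le_local)
      fix w assume "cmod (w - z) \<le> 1 / (1 + cmod z)"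
      also have "\<dots> \<le> 1" by (simp add: add_pos_nonneg)
      finally have "R \<le> cmod (w - \<phi> z)"
        using z norm_triangle_ineq[of "\<phi> z - w" "w - z"] by (simp add: norm_minus_commute)
      then show "cmod (fock_fun (V (weyl (\<phi> z) fock_one)) w) \<le> d * exp ((cmod w)\<^sup>2 / 2)"
        by (rule R(2))
    qed (use d in simp)
    then show ?thesis using d by simp
  qed
  then show ?thesis using that by blast
qed

text \<open>
  On the circle of radius \<open>r\<close>, \<open>\<bar>\<phi> z\<bar>\<^sup>2\<close> dominates \<open>2 Re (cnj (c z\<^sup>n) \<phi> z) - \<bar>c z\<^sup>n\<bar>\<^sup>2\<close>, and up to lower order
  terms \<open>cnj (z\<^sup>n) \<phi> z\<close> is \<open>r\<^sup>2\<^sup>n \<psi> z\<close> with \<open>\<psi>\<close> entire. So the bound on the weight passes to an entire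
  function, and the maximum principle bounds \<open>exp (\<bar>c\<bar>\<^sup>2 r\<^sup>2\<^sup>n / 2)\<close> by \<open>exp (r\<^sup>2 / 2)\<close> and lower order factors.
\<close>

lemma taylor_coeff_\<phi>_eq_0:
  assumes nz: "deriv g z0 \<noteq> 0" and n: "n \<ge> 2"
  shows "taylor_coeff \<phi> n = 0"
proof (rule ccontr)
  define c where "c = taylor_coeff \<phi> n"
  assume "taylor_coeff \<phi> n \<noteq> 0"
  then have c: "c \<noteq> 0" by (simp add: c_def)
  define h where "h = deriv g"
  have h: "h holomorphic_on UNIV" unfolding h_def by (rule deriv_g_holomorphic)
  have "\<exists>k. taylor_coeff h k \<noteq> 0"
  proof (rule ccontr)
    assume "\<not> (\<exists>k. taylor_coeff h k \<noteq> 0)"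
    then have "(\<lambda>n. 0) sums h z0"
      using entire_sums[OF h, of z0] by simp
    then have "h z0 = 0"
      using sums_unique2[OF sums_zero] by metis
    then show False using nz by (simp add: h_def)
  qed
  \<comment> \<open>The maximum principle is evaluated at the centre 0, where g' may vanish;
    dividing out its order of vanishing leaves H with H 0 nonzero.\<close>
  define k where "k = (LEAST k. taylor_coeff h k \<noteq> 0)"
  have k: "taylor_coeff h k \<noteq> 0" "\<And>i. i < k \<Longrightarrow> taylor_coeff h i = 0"
    using LeastI_ex[OF \<open>\<exists>k. taylor_coeff h k \<noteq> 0\<close>] not_less_Least by (auto simp: k_def)
  obtain H where H: "H holomorphic_on UNIV" "\<And>z. h z = (\<Sum>i<k. taylor_coeff h i * z ^ i) + z ^ k * H z"
    "\<And>m. taylor_coeff H m = taylor_coeff h (k + m)"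
    by (rule entire_split[OF h, where n = k]) (rule that)
  have hH: "h z = z ^ k * H z" for z
    using H(2)[of z] k(2) by simp
  have H0: "H 0 \<noteq> 0"
    using H(3)[of 0] k(1) by (simp add: taylor_coeff_def)
  obtain \<psi> where \<psi>: "\<psi> holomorphic_on UNIV" "\<And>z. \<phi> z = (\<Sum>i<n. taylor_coeff \<phi> i * z ^ i) + z ^ n * \<psi> z"
    "\<And>m. taylor_coeff \<psi> m = taylor_coeff \<phi> (n + m)"
    by (rule entire_split[OF \<phi>, where n = n]) (rule that)
  have \<psi>0: "\<psi> 0 = c"
    using \<psi>(3)[of 0] by (simp add: taylor_coeff_def c_def)
  define p where "p z = (\<Sum>i<n. taylor_coeff \<phi> i * z ^ i)" for z
  define P where "P = (\<Sum>i<n. cmod (taylor_coeff \<phi> i))"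
  have P: "P \<ge> 0" by (auto simp: P_def intro: sum_nonneg)
  have p_le: "cmod (p z) \<le> P * r ^ (n - 1)" if "cmod z = r" "r \<ge> 1" for z r
  proof -
    have "cmod (p z) \<le> (\<Sum>i<n. cmod (taylor_coeff \<phi> i) * r ^ (n - 1))"
      unfolding p_def using that
      by (intro sum_norm_le) (auto simp: norm_mult norm_power intro!: mult_left_mono power_increasing)
    then show ?thesis by (simp add: P_def sum_distrib_right)
  qed
  define K where "K = norm V * exp (3 / 2)"
  have K: "K \<ge> 0" by (simp add: K_def)
  \<comment> \<open>Collects all lower order exponents: 3/2 covers r + r^2/2, where r comes from 1 +
    r <= 2 exp r, and |c| P comes from the Taylor polynomial p. Bounding r^2 by r^(2n - 1) is where
    n >= 2 enters.\<close>
  define D where "D = 3 / 2 + cmod c * P"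
  have D: "D \<ge> 0" using P by (simp add: D_def)
  let ?M = "\<lambda>r. (cmod c)\<^sup>2 * r ^ (2 * n) / 2" and ?L = "\<lambda>r. cmod c * P * r ^ (2 * n - 1)"
  have bound: "cmod (H 0) * exp (?M r) \<le> 2 * K * exp (D * r ^ (2 * n - 1))" if r: "r \<ge> 1" for r :: real
  proof -
    \<comment> \<open>At the centre the exponent is |c|^2 r^(2n), twice the leading exponent
      \<open>?M r\<close> available on the circle; the surplus \<open>?M r\<close> is what lower
      order terms cannot absorb.\<close>
    define G where "G z = H z * exp (of_real (r ^ (2 * n)) * (cnj c * \<psi> z))" for z
    have G: "G holomorphic_on UNIV"
      unfolding G_def by (intro holomorphic_intros H(1) \<psi>(1))
    define T where "T = r\<^sup>2 / 2 + ?M r + ?L r"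
    have "cmod (G 0) \<le> K * (1 + r) * exp T"
    proof (rule maximum_modulus_frontier[of G "cball 0 r"])
      show "G holomorphic_on interior (cball 0 r)" using G holomorphic_on_subset by blast
      show "continuous_on (closure (cball 0 r)) G"
        using G holomorphic_on_imp_continuous_on continuous_on_subset by blast
      fix z :: complex assume "z \<in> frontier (cball 0 r)"
      then have z: "cmod z = r" using r by simp
      have zz: "cnj z ^ n * z ^ n = of_real (r ^ (2 * n))"
      proof -
        have "cnj z ^ n * z ^ n = (z * cnj z) ^ n" by (simp add: power_mult_distrib mult.commute)
        also have "z * cnj z = of_real (r\<^sup>2)" by (simp add: complex_norm_square[symmetric] z)
        finally show ?thesis by (simp add: power_mult)
      qed
      have e1: "of_real (r ^ (2 * n)) * (cnj c * \<psi> z) = cnj (c * z ^ n) * \<phi> z - cnj (c * z ^ n) * p z"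
      proof -
        have "cnj (c * z ^ n) * \<phi> z = cnj c * (cnj z ^ n * (p z + z ^ n * \<psi> z))"
          using \<psi>(2)[of z] by (simp add: p_def)
        also have "\<dots> = cnj c * (cnj z ^ n * p z) + (cnj z ^ n * z ^ n) * (cnj c * \<psi> z)"
          by (simp add: algebra_simps)
        finally show ?thesis by (simp add: zz)
      qed
      have "2 * Re (cnj (c * z ^ n) * \<phi> z) \<le> (cmod (\<phi> z))\<^sup>2 + (cmod (c * z ^ n))\<^sup>2"
      proof -
        have "Re (cnj (c * z ^ n) * \<phi> z) \<le> cmod (c * z ^ n) * cmod (\<phi> z)"
          using complex_Re_le_cmod[of "cnj (c * z ^ n) * \<phi> z"] by (simp only: norm_mult complex_mod_cnj)
        moreover have "2 * cmod (c * z ^ n) * cmod (\<phi> z) \<le> (cmod (c * z ^ n))\<^sup>2 + (cmod (\<phi> z))\<^sup>2"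
          by (rule sum_squares_bound)
        ultimately show ?thesis by linarith
      qed
      moreover have "(cmod (c * z ^ n))\<^sup>2 = (cmod c)\<^sup>2 * r ^ (2 * n)"
        by (simp add: norm_mult norm_power z power_mult_distrib power_even_eq)
      moreover have "\<bar>Re (cnj (c * z ^ n) * p z)\<bar> \<le> ?L r"
      proof -
        have "\<bar>Re (cnj (c * z ^ n) * p z)\<bar> \<le> cmod c * r ^ n * cmod (p z)"
          using abs_Re_le_cmod[of "cnj (c * z ^ n) * p z"] by (simp add: norm_mult norm_power z)
        also have "\<dots> \<le> cmod c * r ^ n * (P * r ^ (n - 1))"
          using r by (intro mult_left_mono p_le z) auto
        also have "\<dots> = cmod c * P * (r ^ n * r ^ (n - 1))" by (simp only: mult_ac)
        also have "r ^ n * r ^ (n - 1) = r ^ (2 * n - 1)"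
          using n by (simp add: mult_2 flip: power_add)
        finally show ?thesis .
      qed
      ultimately have Re_le: "Re (of_real (r ^ (2 * n)) * (cnj c * \<psi> z))
          \<le> (cmod (\<phi> z))\<^sup>2 / 2 + (?M r + ?L r)"
        unfolding e1 minus_complex.simps by (simp only: abs_le_iff) linarith
      have "cmod (H z) \<le> cmod (h z)"
      proof -
        have "1 \<le> r ^ k" using r by simp
        then show ?thesis
          using mult_right_mono[of 1 "r ^ k" "cmod (H z)"] by (simp add: hH norm_mult norm_power z)
      qed
      then have "cmod (G z) \<le> cmod (h z) * exp ((cmod (\<phi> z))\<^sup>2 / 2 + (?M r + ?L r))"
        unfolding G_def norm_mult norm_exp_eq_Re using Re_le by (intro mult_mono) auto
      also have "\<dots> = (cmod (deriv g z) * exp ((cmod (\<phi> z))\<^sup>2 / 2)) * exp (?M r + ?L r)"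
        by (simp add: exp_add h_def)
      also have "\<dots> = weight z * (1 + r) * exp (r\<^sup>2 / 2) * exp (?M r + ?L r)"
        unfolding weight_eq z ..
      also have "\<dots> = weight z * ((1 + r) * exp T)"
        by (simp add: T_def exp_add)
      also have "\<dots> \<le> K * ((1 + r) * exp T)"
        using r weight_bounded[of z] by (intro mult_right_mono) (auto simp: K_def)
      finally show "cmod (G z) \<le> K * (1 + r) * exp T" by (simp add: mult.assoc)
    qed (use r in auto)
    moreover have "cmod (G 0) = cmod (H 0) * exp ((cmod c)\<^sup>2 * r ^ (2 * n))"
    proof -
      have "of_real (r ^ (2 * n)) * (cnj c * \<psi> 0) = complex_of_real ((cmod c)\<^sup>2 * r ^ (2 * n))"
        using complex_norm_square[of c] by (simp add: \<psi>0 mult.commute)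
      then show ?thesis by (simp only: G_def norm_mult norm_exp_eq_Re Re_complex_of_real)
    qed
    moreover have "K * (1 + r) * exp T \<le> 2 * K * exp (D * r ^ (2 * n - 1)) * exp (?M r)"
    proof -
      have "r \<le> r ^ (2 * n - 1)"
        using power_increasing[of 1 "2 * n - 1" r] r n by simp
      moreover have "r\<^sup>2 \<le> r ^ (2 * n - 1)"
        using power_increasing[of 2 "2 * n - 1" r] r n by simp
      ultimately have "r + r\<^sup>2 / 2 + ?L r \<le> D * r ^ (2 * n - 1)"
        by (simp add: D_def distrib_right)
      then have "r + T \<le> D * r ^ (2 * n - 1) + ?M r"
        by (simp add: T_def)
      then have "exp (r + T) \<le> exp (D * r ^ (2 * n - 1) + ?M r)" by simp
      moreover have "1 + r \<le> 2 * exp r"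
        using exp_ge_add_one_self[of r] r by linarith
      then have "(1 + r) * exp T \<le> 2 * exp (r + T)"
        using mult_right_mono[of "1 + r" "2 * exp r" "exp T"] by (simp add: exp_add)
      ultimately have "(1 + r) * exp T \<le> 2 * exp (D * r ^ (2 * n - 1) + ?M r)"
        by linarith
      then have "K * ((1 + r) * exp T) \<le> K * (2 * exp (D * r ^ (2 * n - 1) + ?M r))"
        using K by (rule mult_left_mono)
      then show ?thesis by (simp add: exp_add mult_ac)
    qed
    ultimately have "cmod (H 0) * exp ((cmod c)\<^sup>2 * r ^ (2 * n))
        \<le> 2 * K * exp (D * r ^ (2 * n - 1)) * exp (?M r)" by linarith
    moreover have "exp ((cmod c)\<^sup>2 * r ^ (2 * n)) = exp (?M r) * exp (?M r)"
      by (simp flip: exp_add)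
    ultimately have "(cmod (H 0) * exp (?M r)) * exp (?M r)
        \<le> (2 * K * exp (D * r ^ (2 * n - 1))) * exp (?M r)"
      by (simp add: mult.assoc)
    then show ?thesis
      by (subst (asm) mult_le_cancel_right_pos) auto
  qed
  \<comment> \<open>Chosen so that 2 K = |H 0| X, which is strictly below |H 0| exp X.\<close>
  define X where "X = 2 * K / cmod (H 0)"
  have X: "X \<ge> 0" using K by (simp add: X_def)
  have c2: "(cmod c)\<^sup>2 > 0" using c by simp
  \<comment> \<open>Large enough for the surplus |c|^2 r^(2n)/2 to exceed the lower order exponent D
    r^(2n - 1) by X.\<close>
  define r where "r = max 1 (2 * (D + X) / (cmod c)\<^sup>2)"
  have r: "r \<ge> 1" "D + X \<le> (cmod c)\<^sup>2 * r / 2"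
  proof -
    show "r \<ge> 1" by (simp add: r_def)
    have "2 * (D + X) / (cmod c)\<^sup>2 \<le> r" by (simp add: r_def)
    then show "D + X \<le> (cmod c)\<^sup>2 * r / 2"
      using c2 by (simp add: pos_divide_le_eq mult.commute)
  qed
  define S where "S = r ^ (2 * n - 1)"
  have S: "S \<ge> 1" using r by (simp add: S_def)
  have rS: "r ^ (2 * n) = r * S"
    using n by (simp add: S_def flip: power_Suc)
  have "D * S + X \<le> ?M r"
  proof -
    have "(D + X) * S \<le> (cmod c)\<^sup>2 * r / 2 * S"
      using r S by (intro mult_right_mono) auto
    moreover have "X \<le> X * S" using X S mult_left_mono[of 1 S X] by simp
    ultimately show ?thesis by (simp add: rS distrib_right)
  qed
  then have "exp (D * S) * exp X \<le> exp (?M r)"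
    by (simp flip: exp_add)
  then have "cmod (H 0) * (exp (D * S) * exp X) \<le> cmod (H 0) * exp (?M r)"
    by (rule mult_left_mono) simp
  also have "\<dots> \<le> 2 * K * exp (D * S)"
    unfolding S_def by (rule bound[OF r(1)])
  finally have "(cmod (H 0) * exp X) * exp (D * S) \<le> (2 * K) * exp (D * S)"
    by (simp add: mult_ac)
  then have "cmod (H 0) * exp X \<le> 2 * K"
    by (subst (asm) mult_le_cancel_right_pos) auto
  moreover have "2 * K = cmod (H 0) * X"
    using H0 by (simp add: X_def)
  moreover have "cmod (H 0) * X < cmod (H 0) * exp X"
  proof (rule mult_strict_left_mono)
    show "X < exp X" using exp_ge_add_one_self[of X] by linarith
  qed (use H0 in simp)
  ultimately show False by linarith
qed

lemma \<phi>_affine: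
  assumes nz: "deriv g z0 \<noteq> 0"
  obtains a b where "\<And>z. \<phi> z = a * z + b"
proof -
  have "\<phi> z = taylor_coeff \<phi> 1 * z + taylor_coeff \<phi> 0" for z
  proof -
    have "(\<lambda>n. taylor_coeff \<phi> n * z ^ n) sums (\<Sum>n\<in>{0, 1}. taylor_coeff \<phi> n * z ^ n)"
    proof (rule sums_finite)
      fix n :: nat assume "n \<notin> {0, 1}"
      then have "n \<ge> 2" by auto
      then show "taylor_coeff \<phi> n * z ^ n = 0"
        using taylor_coeff_\<phi>_eq_0[OF nz] by simp
    qed simp
    then have "\<phi> z = (\<Sum>n\<in>{0, 1}. taylor_coeff \<phi> n * z ^ n)"
      using sums_unique2[OF entire_sums[OF \<phi>, of z]] by blast
    then show ?thesis by simp
  qed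
  then show ?thesis using that by blast
qed

text \<open>In this form the Gaussian density is taken at \<phi>(z), so the substitution u =
  \<phi>(z) becomes available. The factor 4 is 2 from Littlewood-Paley times 2 from (1 + |z|)^2 <= 2
  (1 + |z|^2).\<close>

lemma norm_V_square_le:
  "ennreal ((norm (V f))\<^sup>2)
    \<le> (\<integral>\<^sup>+z. ennreal (4 * (weight z)\<^sup>2 * ((cmod (fock_fun f (\<phi> z)))\<^sup>2 * exp (- (cmod (\<phi> z))\<^sup>2) / pi)) \<partial>lborel)"
proof -
  let ?d = "\<lambda>z. fock_fun f (\<phi> z) * deriv g z"
  have [measurable]: "?d \<in> borel_measurable borel"
    using integrand_holomorphic by (intro borel_measurable_continuous_onI holomorphic_on_imp_continuous_on)
  have d: "deriv (fock_fun (V f)) = ?d"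
    using DERIV_imp_deriv[OF V_deriv] by blast
  have "ennreal ((norm (V f))\<^sup>2)
      \<le> 2 * (\<integral>\<^sup>+z. ennreal (1 / (1 + (cmod z)\<^sup>2)) * ennreal ((cmod (?d z))\<^sup>2) \<partial>gauss)"
    using littlewood_paley[OF holomorphic_fock_fun V_0, of f] by (simp add: ennreal_norm_fock_square d)
  also have "\<dots> = (\<integral>\<^sup>+z. ennreal (exp (- (cmod z)\<^sup>2) / pi) * (2 * (ennreal (1 / (1 + (cmod z)\<^sup>2)) * ennreal ((cmod (?d z))\<^sup>2))) \<partial>lborel)"
    by (subst nn_integral_cmult[symmetric], measurable) (rule nn_integral_gauss, measurable)
  also have "\<dots> \<le> (\<integral>\<^sup>+z. ennreal (4 * (weight z)\<^sup>2 * ((cmod (fock_fun f (\<phi> z)))\<^sup>2 * exp (- (cmod (\<phi> z))\<^sup>2) / pi)) \<partial>lborel)"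
  proof (rule nn_integral_mono)
    fix z
    let ?p = "(cmod (fock_fun f (\<phi> z)))\<^sup>2 * exp (- (cmod (\<phi> z))\<^sup>2) / pi"
    define y where "y = 1 + (cmod z)\<^sup>2"
    have y: "y > 0" by (simp add: y_def add_pos_nonneg)
    have "(1 + cmod z)\<^sup>2 \<le> 2 * y"
      using sum_squares_bound[of 1 "cmod z"] by (simp add: y_def power2_sum)
    then have y2: "(1 + cmod z)\<^sup>2 / y \<le> 2"
      using y by (simp add: pos_divide_le_eq)
    have ex2: "(exp (x / 2))\<^sup>2 = exp x" for x :: real
      by (simp flip: exp_double)
    have "(cmod (deriv g z) * exp ((cmod (\<phi> z))\<^sup>2 / 2))\<^sup>2 = (weight z * (1 + cmod z) * exp ((cmod z)\<^sup>2 / 2))\<^sup>2"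
      by (simp only: weight_eq)
    then have "(cmod (deriv g z))\<^sup>2 * exp ((cmod (\<phi> z))\<^sup>2) = (weight z)\<^sup>2 * (1 + cmod z)\<^sup>2 * exp ((cmod z)\<^sup>2)"
      by (simp only: power_mult_distrib ex2)
    then have g2: "(cmod (deriv g z))\<^sup>2 = (weight z)\<^sup>2 * (1 + cmod z)\<^sup>2 * exp ((cmod z)\<^sup>2) * exp (- (cmod (\<phi> z))\<^sup>2)"
      by (simp add: exp_minus field_simps)
    have "exp (- (cmod z)\<^sup>2) / pi * (2 * (1 / y * (cmod (?d z))\<^sup>2))
      = 2 * ((1 + cmod z)\<^sup>2 / y) * ((weight z)\<^sup>2 * ?p)"
      proof -
      have "A / pi * (2 * (1 / y * (F * (W * Y * E * P)))) = 2 * (Y / y) * (W * (F * P / pi)) * (A * E)"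
        for A F W Y E P :: real
        by (simp only: times_divide_eq_left times_divide_eq_right mult_1_left mult_1_right divide_divide_eq_left mult_ac)
      moreover have "exp (- (cmod z)\<^sup>2) * exp ((cmod z)\<^sup>2) = 1"
        by (simp flip: exp_add)
      ultimately show ?thesis
        unfolding norm_mult power_mult_distrib g2 by (simp only: mult_1_right)
    qed
    also have "\<dots> \<le> (2 * 2) * ((weight z)\<^sup>2 * ?p)"
      using y2 by (intro mult_right_mono mult_left_mono) auto
    finally have "exp (- (cmod z)\<^sup>2) / pi * (2 * (1 / y * (cmod (?d z))\<^sup>2))
      \<le> 4 * (weight z)\<^sup>2 * ?p" by simp
    then have "ennreal (exp (- (cmod z)\<^sup>2) / pi * (2 * (1 / y * (cmod (?d z))\<^sup>2)))
      \<le> ennreal (4 * (weight z)\<^sup>2 * ?p)"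
      by (rule ennreal_leI)
    moreover have "0 \<le> exp (- (cmod z)\<^sup>2) / pi" "0 \<le> 1 / y" using y by auto
    ultimately show "ennreal (exp (- (cmod z)\<^sup>2) / pi) * (2 * (ennreal (1 / (1 + (cmod z)\<^sup>2)) * ennreal ((cmod (?d z))\<^sup>2)))
      \<le> ennreal (4 * (weight z)\<^sup>2 * ?p)"
      by (simp only: ennreal_mult zero_le_power2 mult_nonneg_nonneg ennreal_numeral zero_le_numeral y_def)
  qed
  finally show ?thesis .
qed

text \<open>On a large disc the values of v n at \<phi>(z) are uniformly small and the weight is
  bounded; outside it the weight is small and the affine substitution recovers the bounded norm of v
  n.\<close>

lemma V_tendsto_zero:
  assumes \<phi>ab: "\<And>z. \<phi> z = a * z + b"
    and wt: "\<And>e. e > 0 \<Longrightarrow> \<exists>R. \<forall>z. R \<le> cmod z \<longrightarrow> weight z \<le> e"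
    and B: "\<And>n. norm (v n) \<le> B"
    and lim: "\<And>K. compact K \<Longrightarrow> uniform_limit K (\<lambda>n. fock_fun (v n)) (\<lambda>_. 0) sequentially"
  shows "(\<lambda>n. V (v n)) \<longlonglongrightarrow> 0"
proof (cases "a = 0")
  case True
  \<comment> \<open>For constant \<phi> the substitution degenerates, but V only sees the value of
    its argument at b.\<close>
  have "V (v n) = fock_fun (v n) b *\<^sub>C V fock_one" for n
  proof (rule fock_eqI_deriv[where d = "\<lambda>z. fock_fun (v n) b * deriv g z"])
    fix z
    show "(fock_fun (V (v n)) has_field_derivative fock_fun (v n) b * deriv g z) (at z)"
      using V_deriv[of "v n" z] by (simp add: \<phi>ab True)
    have "fock_fun (fock_fun (v n) b *\<^sub>C V fock_one) = (\<lambda>z. fock_fun (v n) b * fock_fun (V fock_one) z)"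
      by auto
    then show "(fock_fun (fock_fun (v n) b *\<^sub>C V fock_one) has_field_derivative fock_fun (v n) b * deriv g z) (at z)"
      using DERIV_cmult[OF V_deriv[of fock_one z], of "fock_fun (v n) b"] by simp
  qed (simp add: V_0)
  then have "norm (V (v n)) = cmod (fock_fun (v n) b) * norm (V fock_one)" for n
    by (simp add: norm_scaleC)
  moreover have "(\<lambda>n. cmod (fock_fun (v n) b) * norm (V fock_one)) \<longlonglongrightarrow> 0 * norm (V fock_one)"
    by (intro tendsto_intros tendsto_norm_zero fock_uniform_imp_pointwise lim)
  ultimately show ?thesis
    by (simp only: mult_zero_left tendsto_norm_zero_cancel)
next
  case a: False
  define K where "K = norm V * exp (3 / 2)"
  have K: "K \<ge> 0" "\<And>z. weight z \<le> K" using weight_bounded by (auto simp: K_def)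
  have ev: "\<forall>\<^sub>F n in sequentially. (norm (V (v n)))\<^sup>2 \<le> e" if e: "e > 0" for e
  proof -
    \<comment> \<open>Gives 4 d^2 B^2 / |a|^2 <= e/2, where 1 / |a|^2 is the Jacobian of the
      substitution.\<close>
    define d where "d = sqrt (e * (cmod a)\<^sup>2 / (8 * (B\<^sup>2 + 1)))"
    have B1: "B\<^sup>2 + 1 > 0" by (simp add: add_nonneg_pos)
    have d: "d > 0" "d\<^sup>2 = e * (cmod a)\<^sup>2 / (8 * (B\<^sup>2 + 1))"
      using e a B1 by (simp_all add: d_def)
    obtain R0 where R0: "\<And>z. R0 \<le> cmod z \<Longrightarrow> weight z \<le> d" using wt[OF d(1)] by blast
    define R where "R = max R0 1"
    have R: "R > 0" "\<And>z. R \<le> cmod z \<Longrightarrow> weight z \<le> d" using R0 by (auto simp: R_def)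
    \<comment> \<open>Gives 4 K^2 s^2 R^2 <= e/2, where R^2 is left of the area of the disc after
      cancelling pi.\<close>
    define s where "s = sqrt (e / (8 * (K\<^sup>2 * R\<^sup>2 + 1)))"
    have K1: "K\<^sup>2 * R\<^sup>2 + 1 > 0" by (simp add: add_nonneg_pos)
    have s: "s > 0" "s\<^sup>2 = e / (8 * (K\<^sup>2 * R\<^sup>2 + 1))"
      using e K1 by (simp_all add: s_def)
    have "compact (\<phi> ` cball 0 R)"
      by (intro compact_continuous_image holomorphic_on_imp_continuous_on holomorphic_on_subset[OF \<phi>]) auto
    then have "\<forall>\<^sub>F n in sequentially. \<forall>u\<in>\<phi> ` cball 0 R. cmod (fock_fun (v n) u) < s"
      using uniform_limitD[OF lim s(1), of "\<phi> ` cball 0 R"] by (simp only: dist_norm diff_0_right)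
    then show ?thesis
    proof eventually_elim
      let ?k = "ennreal (4 * K\<^sup>2 * s\<^sup>2 / pi)"
      fix n assume n: "\<forall>u\<in>\<phi> ` cball 0 R. cmod (fock_fun (v n) u) < s"
      \<comment> \<open>The Gaussian-weighted square of v n as a function on the plane with Lebesgue
        measure, ready for the substitution u = \<phi>(z).\<close>
      define \<Psi> where "\<Psi> u = ennreal ((cmod (fock_fun (v n) u))\<^sup>2 * exp (- (cmod u)\<^sup>2) / pi)" for u
      have [measurable]: "\<Psi> \<in> borel_measurable borel" unfolding \<Psi>_def by measurable
      have I\<Psi>: "(\<integral>\<^sup>+u. \<Psi> u \<partial>lborel) = ennreal ((norm (v n))\<^sup>2)"
        unfolding ennreal_norm_fock_square \<Psi>_def
        by (subst nn_integral_gauss, measurable) (auto intro!: nn_integral_cong simp: mult.commute simp flip: ennreal_mult)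
      have I\<Psi>\<phi>: "(\<integral>\<^sup>+z. \<Psi> (\<phi> z) \<partial>lborel) = ennreal (1 / (cmod a)\<^sup>2) * ennreal ((norm (v n))\<^sup>2)"
      proof -
        have "(\<integral>\<^sup>+z. \<Psi> (\<phi> z) \<partial>lborel) = (\<integral>\<^sup>+z. \<Psi> (a * z + b) \<partial>lborel)" by (simp add: \<phi>ab)
        also have "\<dots> = ennreal (1 / (cmod a)\<^sup>2) * (\<integral>\<^sup>+u. \<Psi> (u + b) \<partial>lborel)"
          by (rule nn_integral_lborel_cmult[where f = "\<lambda>u. \<Psi> (u + b)", OF _ a]) measurable
        also have "(\<integral>\<^sup>+u. \<Psi> (u + b) \<partial>lborel) = (\<integral>\<^sup>+u. \<Psi> u \<partial>lborel)"
          by (rule nn_integral_lborel_translate) measurable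
        finally show ?thesis by (simp add: I\<Psi>)
      qed
      have ind: "(indicator (cball 0 R) :: complex \<Rightarrow> ennreal) \<in> borel_measurable (borel :: complex measure)"
        by (rule borel_measurable_indicator) simp
      have [measurable]: "\<phi> \<in> borel_measurable borel"
        using \<phi> by (intro borel_measurable_continuous_onI holomorphic_on_imp_continuous_on)
      have "ennreal ((norm (V (v n)))\<^sup>2)
        \<le> (\<integral>\<^sup>+z. ?k * indicator (cball 0 R) z + ennreal (4 * d\<^sup>2) * \<Psi> (\<phi> z) \<partial>lborel)"
      proof (rule order_trans[OF norm_V_square_le], rule nn_integral_mono)
        fix z
        let ?p = "(cmod (fock_fun (v n) (\<phi> z)))\<^sup>2 * exp (- (cmod (\<phi> z))\<^sup>2) / pi"
        show "ennreal (4 * (weight z)\<^sup>2 * ?p) \<le> ?k * indicator (cball 0 R) z + ennreal (4 * d\<^sup>2) * \<Psi> (\<phi> z)"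
        proof (cases "z \<in> cball 0 R")
          case True
          have "(cmod (fock_fun (v n) (\<phi> z)))\<^sup>2 * exp (- (cmod (\<phi> z))\<^sup>2) \<le> s\<^sup>2 * 1"
            using n True by (intro mult_mono power_mono) (auto intro: less_imp_le)
          then have "?p \<le> s\<^sup>2 / pi" by (simp add: divide_right_mono)
          moreover have "4 * (weight z)\<^sup>2 \<le> 4 * K\<^sup>2"
            using K(2)[of z] weight_nonneg[of z] by (simp add: power_mono)
          ultimately have "4 * (weight z)\<^sup>2 * ?p \<le> 4 * K\<^sup>2 * (s\<^sup>2 / pi)"
            by (intro mult_mono) auto
          then have "ennreal (4 * (weight z)\<^sup>2 * ?p) \<le> ennreal (4 * K\<^sup>2 * s\<^sup>2 / pi)"
            by (intro ennreal_leI) simp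
          then show ?thesis using True by (simp add: add_increasing2)
        next
          case False
          then have "weight z \<le> d" by (intro R(2)) simp
          then have "4 * (weight z)\<^sup>2 \<le> 4 * d\<^sup>2"
            using weight_nonneg[of z] by (simp add: power_mono)
          then have "4 * (weight z)\<^sup>2 * ?p \<le> 4 * d\<^sup>2 * ?p"
            by (rule mult_right_mono) simp
          then have "ennreal (4 * (weight z)\<^sup>2 * ?p) \<le> ennreal (4 * d\<^sup>2 * ?p)"
            by (rule ennreal_leI)
          also have "\<dots> = ennreal (4 * d\<^sup>2) * \<Psi> (\<phi> z)"
            unfolding \<Psi>_def by (rule ennreal_mult) auto
          finally show ?thesis using False by simp
        qed
      qed
      also have "\<dots> = ?k * emeasure lborel (cball (0::complex) R) + ennreal (4 * d\<^sup>2) * (\<integral>\<^sup>+z. \<Psi> (\<phi> z) \<partial>lborel)"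
      proof (subst nn_integral_add)
        show "(\<lambda>z::complex. ?k * indicator (cball 0 R) z) \<in> borel_measurable lborel"
          using ind by (intro borel_measurable_times_ennreal borel_measurable_const) simp
        show "(\<lambda>z. ennreal (4 * d\<^sup>2) * \<Psi> (\<phi> z)) \<in> borel_measurable lborel" by measurable
        have "(\<integral>\<^sup>+z. ?k * indicator (cball (0::complex) R) z \<partial>lborel) = ?k * emeasure lborel (cball (0::complex) R)"
          by (rule nn_integral_cmult_indicator) simp
        moreover have "(\<integral>\<^sup>+z. ennreal (4 * d\<^sup>2) * \<Psi> (\<phi> z) \<partial>lborel) = ennreal (4 * d\<^sup>2) * (\<integral>\<^sup>+z. \<Psi> (\<phi> z) \<partial>lborel)"
          by (rule nn_integral_cmult) measurable
        ultimately show "(\<integral>\<^sup>+z. ?k * indicator (cball (0::complex) R) z \<partial>lborel) + (\<integral>\<^sup>+z. ennreal (4 * d\<^sup>2) * \<Psi> (\<phi> z) \<partial>lborel)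
          = ?k * emeasure lborel (cball (0::complex) R) + ennreal (4 * d\<^sup>2) * (\<integral>\<^sup>+z. \<Psi> (\<phi> z) \<partial>lborel)"
          by simp
      qed
      also have "\<dots> = ennreal (4 * K\<^sup>2 * s\<^sup>2 / pi * (pi * R\<^sup>2) + 4 * d\<^sup>2 * (1 / (cmod a)\<^sup>2 * (norm (v n))\<^sup>2))"
      proof -
        have "emeasure lborel (cball (0::complex) R) = ennreal (pi * R\<^sup>2)"
          using R(1) by (simp add: emeasure_cball unit_ball_vol_2)
        moreover have "0 \<le> 4 * K\<^sup>2 * s\<^sup>2 / pi" "0 \<le> pi * R\<^sup>2" "0 \<le> 4 * d\<^sup>2" "0 \<le> 1 / (cmod a)\<^sup>2" by auto
        ultimately show ?thesis
          unfolding I\<Psi>\<phi> by (simp only: ennreal_plus ennreal_mult mult_nonneg_nonneg zero_le_power2)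
      qed
      finally have "(norm (V (v n)))\<^sup>2 \<le> 4 * K\<^sup>2 * s\<^sup>2 / pi * (pi * R\<^sup>2) + 4 * d\<^sup>2 * (1 / (cmod a)\<^sup>2 * (norm (v n))\<^sup>2)"
        by (subst (asm) ennreal_le_iff) auto
      also have "4 * K\<^sup>2 * s\<^sup>2 / pi * (pi * R\<^sup>2) \<le> e / 2"
      proof -
        have "4 * K\<^sup>2 * s\<^sup>2 / pi * (pi * R\<^sup>2) = e / 2 * (K\<^sup>2 * R\<^sup>2 / (K\<^sup>2 * R\<^sup>2 + 1))"
        proof -
          have "4 * A * (e / (8 * x)) / pi * (pi * B) = e / 2 * (A * B / x)" for A B x :: real
            by simp
          then show ?thesis unfolding s(2) .
        qed
        also have "\<dots> \<le> e / 2 * 1"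
          using e K1 by (intro mult_left_mono) auto
        finally show ?thesis by simp
      qed
      also have "4 * d\<^sup>2 * (1 / (cmod a)\<^sup>2 * (norm (v n))\<^sup>2) \<le> e / 2"
      proof -
        have "4 * d\<^sup>2 * (1 / (cmod a)\<^sup>2 * (norm (v n))\<^sup>2) \<le> 4 * d\<^sup>2 * (1 / (cmod a)\<^sup>2 * B\<^sup>2)"
          using B[of n] by (intro mult_left_mono power_mono) auto
        also have "\<dots> = e / 2 * (B\<^sup>2 / (B\<^sup>2 + 1))"
        proof -
          have "4 * (e * A / (8 * x)) * (1 / A * B) = e / 2 * (B / x)" if "A \<noteq> 0" for A B x :: real
            using that by simp
          moreover have "(cmod a)\<^sup>2 \<noteq> 0" using a by simp
          ultimately show ?thesis unfolding d(2) by blast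
        qed
        also have "\<dots> \<le> e / 2 * 1"
          using e B1 by (intro mult_left_mono) auto
        finally show ?thesis by simp
      qed
      finally show "(norm (V (v n)))\<^sup>2 \<le> e" by simp
    qed
  qed
  show ?thesis
  proof (rule LIMSEQ_I)
    fix e :: real assume e: "e > 0"
    have "(e / 2)\<^sup>2 > 0" using e by simp
    from ev[OF this] obtain N where N: "\<And>n. n \<ge> N \<Longrightarrow> (norm (V (v n)))\<^sup>2 \<le> (e / 2)\<^sup>2"
      unfolding eventually_sequentially by blast
    have "norm (V (v n) - 0) < e" if "n \<ge> N" for n
    proof -
      have "norm (V (v n)) \<le> e / 2"
        by (rule power2_le_imp_le[OF N[OF that]]) (use e in simp)
      then show ?thesis using e by simp
    qed
    then show "\<exists>no. \<forall>n\<ge>no. norm (V (v n) - 0) < e" by blast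
  qed
qed

text \<open>The Montel limit u of a subsequence stays in the unit ball and
  \<open>V_tendsto_zero\<close> applies to the differences from u, so the image of the ball is
  itself compact.\<close>

lemma compact_V:
  assumes \<phi>ab: "\<And>z. \<phi> z = a * z + b"
    and wt: "\<And>e. e > 0 \<Longrightarrow> \<exists>R. \<forall>z. R \<le> cmod z \<longrightarrow> weight z \<le> e"
  shows "compact_operator V"
proof -
  have "seq_compact (blinfun_apply V ` cball 0 1)"
  proof (rule seq_compactI)
    fix Y assume "\<forall>n::nat. Y n \<in> blinfun_apply V ` cball 0 1"
    then have "Y n \<in> blinfun_apply V ` cball 0 1" for n
      by blast
    then have "\<exists>x. Y n = V x \<and> norm x \<le> 1" for n
      by (metis imageE mem_cball_0)
    then obtain X where X: "\<And>n. Y n = V (X n)" "\<And>n. norm (X n) \<le> 1" by metis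
    obtain u r where r: "strict_mono (r :: nat \<Rightarrow> nat)" "norm u \<le> 1" and
      lim: "\<And>K. compact K \<Longrightarrow> uniform_limit K (\<lambda>n. fock_fun (X (r n))) (fock_fun u) sequentially"
      using fock_montel[of X 1] X(2) by metis
    have "(\<lambda>n. V (X (r n) - u)) \<longlonglongrightarrow> 0"
    proof (rule V_tendsto_zero[OF \<phi>ab wt])
      show "norm (X (r n) - u) \<le> 1 + 1" for n
        using norm_triangle_ineq4[of "X (r n)" u] X(2)[of "r n"] r(2) by linarith
    qed (assumption, rule uniform_limit_fock_diff, rule lim)
    then have "(\<lambda>n. Y (r n)) \<longlonglongrightarrow> V u"
      by (simp add: X(1) blinfun.diff_right LIM_zero_iff)
    then show "\<exists>l\<in>blinfun_apply V ` cball 0 1. \<exists>r. strict_mono r \<and> (Y \<circ> r) \<longlonglongrightarrow> l"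
      using r by (intro bexI[of _ "V u"] exI[of _ r]) (auto simp: o_def)
  qed
  then have "compact (blinfun_apply V ` cball 0 1)"
    by (simp add: compact_eq_seq_compact_metric)
  then show ?thesis
    by (simp add: compact_operator_def compact_imp_closed)
qed

lemma noncompact_imp_form:
  assumes V: "precompact_weyl_orbits V" and nc: "\<not> compact_operator V"
  obtains \<alpha> \<beta> b where "\<alpha> \<noteq> 0" "\<And>z. \<phi> z = z + b" "\<And>z. deriv g z = exp (- cnj b * z) * (\<alpha> * z + \<beta>)"
proof -
  \<comment> \<open>A nonzero value of g' is the hypothesis of \<open>\<phi>_affine\<close>; if g'
    vanished identically, V would be the compact operator 0.\<close>
  have "\<exists>z. deriv g z \<noteq> 0"
  proof (rule ccontr)
    assume "\<not> (\<exists>z. deriv g z \<noteq> 0)"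
    then have "V f = 0" for f
      using V_deriv[of f] by (intro fock_eqI_deriv[where d = "\<lambda>_. 0"]) (auto simp: V_0 zero_fock.rep_eq)
    then have "blinfun_apply V ` cball 0 1 \<subseteq> {0}" by auto
    then have "finite (blinfun_apply V ` cball 0 1)" by (rule finite_subset) simp
    then have "compact_operator V"
      by (simp add: compact_operator_def finite_imp_compact finite_imp_closed)
    then show False using nc by simp
  qed
  then obtain z0 a b where \<phi>ab: "\<And>z. \<phi> z = a * z + b"
    using \<phi>_affine by metis
  have a: "a = 1"
  proof (rule ccontr)
    assume "a \<noteq> 1"
    \<comment> \<open>For a different from 1 the distance from \<phi>(z) to z tends to infinity with
      z, so smallness far from the diagonal becomes smallness at infinity.\<close>
    have "\<exists>R. \<forall>z. R \<le> cmod z \<longrightarrow> weight z \<le> e" if e: "e > 0" for e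
    proof -
      obtain R where R: "\<And>z. R \<le> cmod (\<phi> z - z) \<Longrightarrow> weight z \<le> e"
        using weight_small[OF V e] by metis
      have "weight z \<le> e" if z: "(\<bar>R\<bar> + cmod b) / cmod (a - 1) \<le> cmod z" for z
      proof (rule R)
        have "\<bar>R\<bar> + cmod b \<le> cmod z * cmod (a - 1)"
          using z \<open>a \<noteq> 1\<close> by (simp add: pos_divide_le_eq)
        also have "\<dots> = cmod ((\<phi> z - z) - b)"
        proof -
          have "z * (a - 1) = (\<phi> z - z) - b" by (simp add: \<phi>ab algebra_simps)
          then show ?thesis by (metis norm_mult)
        qed
        also have "\<dots> \<le> cmod (\<phi> z - z) + cmod b"
          by (rule norm_triangle_ineq4)
        finally show "R \<le> cmod (\<phi> z - z)" by simp
      qed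
      then show ?thesis by blast
    qed
    then show False using compact_V[OF \<phi>ab] nc by blast
  qed
  \<comment> \<open>With \<phi>(z) = z + b, |\<phi>(z)|^2 - |z|^2 = 2 Re(cnj b z) + |b|^2. The
    exponential in h matches the one in the weight, so |h| is a constant times weight (1 + |z|) and
    grows at most linearly.\<close>
  define h where "h z = deriv g z * exp (cnj b * z)" for z
  have h: "h holomorphic_on UNIV"
    unfolding h_def by (intro holomorphic_intros deriv_g_holomorphic)
  have h_weight: "cmod (h z) * exp ((cmod b)\<^sup>2 / 2) = weight z * (1 + cmod z)" for z
  proof -
    have "((cmod (\<phi> z))\<^sup>2 - (cmod z)\<^sup>2) / 2 = Re (cnj b * z) + (cmod b)\<^sup>2 / 2"
      by (simp add: \<phi>ab a cmod_power2 power2_sum field_simps)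
    then have "weight z = cmod (deriv g z) * (exp (Re (cnj b * z)) * exp ((cmod b)\<^sup>2 / 2)) / (1 + cmod z)"
      by (simp only: weight_def exp_add)
    moreover have "1 + cmod z \<noteq> 0" using norm_ge_zero[of z] by linarith
    ultimately show ?thesis
      by (simp add: h_def norm_mult norm_exp_eq_Re)
  qed
  define K where "K = norm V * exp (3 / 2)"
  have K: "K \<ge> 0" "\<And>z. weight z \<le> K" using weight_bounded by (auto simp: K_def)
  have h_le: "cmod (h z) \<le> 2 * K * cmod z ^ 1" if "1 \<le> cmod z" for z
  proof -
    have "cmod (h z) * 1 \<le> cmod (h z) * exp ((cmod b)\<^sup>2 / 2)"
      by (intro mult_left_mono) auto
    also have "\<dots> \<le> K * (2 * cmod z)"
      unfolding h_weight using that K by (intro mult_mono) auto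
    finally show ?thesis by simp
  qed
  define \<alpha> where "\<alpha> = deriv h 0"
  define \<beta> where "\<beta> = h 0"
  have hz: "h z = \<alpha> * z + \<beta>" for z
    using Liouville_polynomial[OF h h_le, of 1 z] by (simp add: \<alpha>_def \<beta>_def)
  have "\<alpha> \<noteq> 0"
  proof
    assume "\<alpha> = 0"
    \<comment> \<open>If h is constant, the weight is a constant divided by 1 + |z|.\<close>
    have "\<exists>R. \<forall>z. R \<le> cmod z \<longrightarrow> weight z \<le> e" if e: "e > 0" for e
    proof -
      have "weight z \<le> e" if z: "cmod \<beta> * exp ((cmod b)\<^sup>2 / 2) / e \<le> cmod z" for z
      proof -
        have "weight z * (1 + cmod z) = cmod \<beta> * exp ((cmod b)\<^sup>2 / 2)"
          using h_weight[of z] by (simp add: hz \<open>\<alpha> = 0\<close>)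
        also have "\<dots> \<le> e * cmod z"
          using z e by (simp add: pos_divide_le_eq mult.commute)
        also have "\<dots> \<le> e * (1 + cmod z)"
          using e by simp
        finally show ?thesis
          by (subst (asm) mult_le_cancel_right_pos) (auto simp: add_pos_nonneg)
      qed
      then show ?thesis by blast
    qed
    then show False using compact_V[OF \<phi>ab] nc by blast
  qed
  moreover have "\<phi> z = z + b" for z by (simp add: \<phi>ab a)
  moreover have "deriv g z = exp (- cnj b * z) * (\<alpha> * z + \<beta>)" for z
  proof -
    have "exp (- cnj b * z) * h z = deriv g z * (exp (- cnj b * z) * exp (cnj b * z))"
      by (simp add: h_def)
    also have "exp (- cnj b * z) * exp (cnj b * z) = 1"
      by (simp flip: exp_add)
    finally show ?thesis by (simp add: hz)
  qed
  ultimately show ?thesis using that by blast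
qed

end

subsection \<open>The Fredholm index\<close>

lemma fock_inner_zero_right [simp]: "fock_inner f 0 = 0"
  using fock_inner_scaleC_right[of f 0 0] by simp

lemma fock_eval_riesz:
  obtains p where "\<And>f. fock_fun f z = fock_inner f p"
proof -
  obtain p where "\<And>f. fock_fun f z = fock_inner f p"
  proof (rule fock_riesz[of "\<lambda>f. fock_fun f z" "exp ((cmod z)\<^sup>2 / 2)"])
    show "cmod (fock_fun f z) \<le> exp ((cmod z)\<^sup>2 / 2) * norm f" for f
      using norm_fock_fun_le[of f z] by (simp add: mult.commute)
  qed auto
  then show ?thesis using that by blast
qed

lemma fock_fun_field_derivative: "(fock_fun f has_field_derivative deriv (fock_fun f) z) (at z)"
  using holomorphic_derivI[OF holomorphic_fock_fun open_UNIV] by simp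

text \<open>The bound comes from \<open>deriv_gauss_bound\<close> with the constant norm f. The
  vectors representing evaluation at 0 and the derivative at the zero of g' will span the kernel of
  the adjoint.\<close>

lemma fock_deriv_riesz:
  obtains p where "\<And>f. deriv (fock_fun f) z = fock_inner f p"
proof -
  obtain p where "\<And>f. deriv (fock_fun f) z = fock_inner f p"
  proof (rule fock_riesz[of "\<lambda>f. deriv (fock_fun f) z" "exp (3 / 2) * (1 + cmod z) * exp ((cmod z)\<^sup>2 / 2)"])
    show "deriv (fock_fun (f + g)) z = deriv (fock_fun f) z + deriv (fock_fun g) z" for f g
    proof (rule DERIV_imp_deriv)
      have "fock_fun (f + g) = (\<lambda>z. fock_fun f z + fock_fun g z)" by auto
      then show "(fock_fun (f + g) has_field_derivative deriv (fock_fun f) z + deriv (fock_fun g) z) (at z)"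
        using DERIV_add[OF fock_fun_field_derivative fock_fun_field_derivative] by simp
    qed
    show "deriv (fock_fun (c *\<^sub>C f)) z = c * deriv (fock_fun f) z" for c f
    proof (rule DERIV_imp_deriv)
      have "fock_fun (c *\<^sub>C f) = (\<lambda>z. c * fock_fun f z)" by auto
      then show "(fock_fun (c *\<^sub>C f) has_field_derivative c * deriv (fock_fun f) z) (at z)"
        using DERIV_cmult[OF fock_fun_field_derivative] by simp
    qed
    show "cmod (deriv (fock_fun f) z) \<le> exp (3 / 2) * (1 + cmod z) * exp ((cmod z)\<^sup>2 / 2) * norm f" for f
      using deriv_gauss_bound[OF holomorphic_fock_fun norm_ge_zero norm_fock_fun_le, of f z]
      by (simp add: mult_ac)
  qed auto
  then show ?thesis using that by blast
qed

text \<open>Together with \<open>fock_one\<close> this is a dual basis for the functionals F(0) and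
  F'(z0): their values are (1, 0) and (0, 1).\<close>

lift_definition fock_id :: fock is "\<lambda>z. z"
proof (rule fock_spaceI)
  show "(\<integral>\<^sup>+z. ennreal ((cmod z)\<^sup>2) \<partial>gauss) < \<infinity>"
    using gauss_moment[of 1] by simp
qed (rule holomorphic_on_ident)

lemma fock_fun_id: "fock_fun fock_id = (\<lambda>z. z)"
  by (rule fock_id.rep_eq)

lemma deriv_fock_id: "deriv (fock_fun fock_id) z = 1"
  by (simp add: fock_fun_id)

lemma deriv_fock_one: "deriv (fock_fun fock_one) z = 0"
  by (simp add: fock_one.rep_eq)

text \<open>The zero of F' cancels the linear factor, so the quotient is entire. Near infinity it is
  bounded by a constant times |F'(0)| + |q| with q = (F' - F'(0)) / z, and q is square integrable by
  \<open>fock_deriv_quotient\<close>.\<close>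

lemma fock_deriv_divide:
  assumes a: "\<alpha> \<noteq> 0" and z0: "\<alpha> * z0 + \<beta> = 0" and F: "deriv (fock_fun F) z0 = 0"
  obtains G where "\<And>z. fock_fun G z * (\<alpha> * z + \<beta>) = deriv (fock_fun F) z"
proof -
  let ?d = "deriv (fock_fun F)"
  have d: "?d holomorphic_on UNIV"
    by (rule holomorphic_deriv[OF holomorphic_fock_fun]) simp
  obtain H where H: "H holomorphic_on UNIV" "\<And>z. ?d z = ?d z0 + (z - z0) * H z"
    using entire_shift[OF d] by metis
  obtain q where q: "q holomorphic_on UNIV" "\<And>z. ?d z = ?d 0 + (z - 0) * q z"
    using entire_shift[OF d] by metis
  have q': "?d z = ?d 0 + z * q z" for z using q(2)[of z] by simp
  define h where "h z = H z / \<alpha>" for z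
  have h: "h holomorphic_on UNIV" unfolding h_def using a by (intro holomorphic_intros H(1)) auto
  have eq: "h z * (\<alpha> * z + \<beta>) = ?d z" for z
  proof -
    have "\<alpha> * z + \<beta> = \<alpha> * (z - z0)"
    proof -
      have "\<beta> = - (\<alpha> * z0)"
        using z0 by (simp only: eq_neg_iff_add_eq_0 add.commute)
      then show ?thesis by (simp add: right_diff_distrib)
    qed
    then show ?thesis using H(2)[of z] F a by (simp add: h_def)
  qed
  \<comment> \<open>Outside this disc |\<alpha> z + \<beta>| >= |\<alpha>| |z| / 2 and |z| > 1;
    inside it continuity bounds the quotient.\<close>
  define R where "R = max 1 (2 * cmod \<beta> / cmod \<alpha>)"
  have "compact (h ` cball 0 R)"
    by (intro compact_continuous_image holomorphic_on_imp_continuous_on holomorphic_on_subset[OF h]) auto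
  then have "bounded (h ` cball 0 R)"
    by (rule compact_imp_bounded)
  then obtain B where B: "\<And>z. z \<in> cball 0 R \<Longrightarrow> cmod (h z) \<le> B"
    unfolding bounded_iff by blast
  define C where "C = 2 / cmod \<alpha>"
  have C: "C > 0" using a by (simp add: C_def)
  have h_le: "(cmod (h z))\<^sup>2 \<le> (B\<^sup>2 + 2 * C\<^sup>2 * (cmod (?d 0))\<^sup>2) + 2 * C\<^sup>2 * (cmod (q z))\<^sup>2" for z
  proof (cases "z \<in> cball 0 R")
    case True
    then have "(cmod (h z))\<^sup>2 \<le> B\<^sup>2" using B by (intro power_mono) auto
    then show ?thesis by (simp add: add_increasing2)
  next
    case False
    then have z: "cmod z > 1" "cmod z > 2 * cmod \<beta> / cmod \<alpha>" by (auto simp: R_def)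
    have "2 * cmod \<beta> < cmod z * cmod \<alpha>" using z(2) a by (simp add: pos_divide_less_eq)
    then have "cmod \<alpha> * cmod z / 2 \<le> cmod \<alpha> * cmod z - cmod \<beta>"
      by (simp add: mult.commute)
    also have "\<dots> \<le> cmod (\<alpha> * z + \<beta>)"
      using norm_diff_ineq[of "\<alpha> * z" \<beta>] by (simp add: norm_mult)
    finally have low: "cmod \<alpha> * cmod z / 2 \<le> cmod (\<alpha> * z + \<beta>)" .
    have "cmod (h z) * (cmod \<alpha> * cmod z / 2) \<le> cmod (h z) * cmod (\<alpha> * z + \<beta>)"
      by (rule mult_left_mono[OF low]) simp
    also have "\<dots> = cmod (?d z)" by (simp flip: norm_mult add: eq)
    also have "\<dots> \<le> cmod (?d 0) + cmod z * cmod (q z)"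
      unfolding q'[of z] using norm_triangle_ineq[of "?d 0" "z * q z"] by (simp add: norm_mult)
    also have "\<dots> \<le> cmod z * (cmod (?d 0) + cmod (q z))"
      using z(1) mult_right_mono[of 1 "cmod z" "cmod (?d 0)"] by (simp add: distrib_left)
    finally have "cmod z * (cmod (h z) * cmod \<alpha> / 2) \<le> cmod z * (cmod (?d 0) + cmod (q z))"
      by (simp add: mult_ac)
    then have "cmod (h z) * cmod \<alpha> / 2 \<le> cmod (?d 0) + cmod (q z)"
      using z(1) by (subst (asm) mult_le_cancel_left_pos) auto
    then have "cmod (h z) \<le> C * (cmod (?d 0) + cmod (q z))"
      using a by (simp add: C_def field_simps)
    then have "(cmod (h z))\<^sup>2 \<le> (C * (cmod (?d 0) + cmod (q z)))\<^sup>2"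
      by (intro power_mono) auto
    also have "\<dots> = C\<^sup>2 * (cmod (?d 0) + cmod (q z))\<^sup>2" by (rule power_mult_distrib)
    also have "\<dots> \<le> C\<^sup>2 * (2 * (cmod (?d 0))\<^sup>2 + 2 * (cmod (q z))\<^sup>2)"
      using sum_squares_bound[of "cmod (?d 0)" "cmod (q z)"]
      by (intro mult_left_mono) (auto simp: power2_sum)
    finally have "(cmod (h z))\<^sup>2 \<le> C\<^sup>2 * (2 * (cmod (?d 0))\<^sup>2 + 2 * (cmod (q z))\<^sup>2)" .
    then show ?thesis by (simp add: algebra_simps add_increasing)
  qed
  have [measurable]: "q \<in> borel_measurable borel"
    using holomorphic_imp_borel[OF q(1)] by simp
  define c where "c = B\<^sup>2 + 2 * C\<^sup>2 * (cmod (?d 0))\<^sup>2"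
  have "h \<in> fock_space"
  proof (rule fock_spaceI[OF h])
    have "(\<integral>\<^sup>+z. ennreal ((cmod (h z))\<^sup>2) \<partial>gauss) \<le> (\<integral>\<^sup>+z. ennreal c + ennreal (2 * C\<^sup>2) * ennreal ((cmod (q z))\<^sup>2) \<partial>gauss)"
    proof (rule nn_integral_mono)
      fix z
      have "ennreal ((cmod (h z))\<^sup>2) \<le> ennreal (c + 2 * C\<^sup>2 * (cmod (q z))\<^sup>2)"
        unfolding c_def by (rule ennreal_leI[OF h_le])
      also have "\<dots> = ennreal c + ennreal (2 * C\<^sup>2) * ennreal ((cmod (q z))\<^sup>2)"
      proof -
        have "0 \<le> c" "0 \<le> 2 * C\<^sup>2" by (auto simp: c_def)
        then show ?thesis by (simp only: ennreal_plus ennreal_mult mult_nonneg_nonneg zero_le_power2)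
      qed
      finally show "ennreal ((cmod (h z))\<^sup>2) \<le> ennreal c + ennreal (2 * C\<^sup>2) * ennreal ((cmod (q z))\<^sup>2)" .
    qed
    also have "\<dots> = ennreal c + ennreal (2 * C\<^sup>2) * (\<integral>\<^sup>+z. ennreal ((cmod (q z))\<^sup>2) \<partial>gauss)"
      by (subst nn_integral_add) (auto simp: nn_integral_cmult emeasure_gauss_UNIV)
    also have "\<dots> < \<infinity>"
      using fock_deriv_quotient[OF q(1) q'] by (simp add: ennreal_mult_less_top)
    finally show "(\<integral>\<^sup>+z. ennreal ((cmod (h z))\<^sup>2) \<partial>gauss) < \<infinity>" .
  qed
  then have "fock_fun (Fock h) = h" by (rule Fock_inverse)
  then show ?thesis using that[of "Fock h"] eq by simp
qed

section \<open>Range, kernel and cokernel in the non-compact case\<close>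

context volterra_operator
begin

context
  fixes \<alpha> \<beta> b :: complex
  assumes \<alpha>: "\<alpha> \<noteq> 0" and \<phi>b: "\<And>z. \<phi> z = z + b"
    and deriv_g: "\<And>z. deriv g z = exp (- cnj b * z) * (\<alpha> * z + \<beta>)"
begin

lemma deriv_g_eq_0_iff: "deriv g z = 0 \<longleftrightarrow> z = - \<beta> / \<alpha>"
proof -
  have "deriv g z = 0 \<longleftrightarrow> \<alpha> * z + \<beta> = 0"
    by (simp add: deriv_g)
  also have "\<dots> \<longleftrightarrow> z = - \<beta> / \<alpha>"
    using \<alpha> by (auto simp: field_simps add_eq_0_iff)
  finally show ?thesis .
qed

lemma range_V: "range (blinfun_apply V) = {F. fock_fun F 0 = 0 \<and> deriv (fock_fun F) (- \<beta> / \<alpha>) = 0}"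
proof (intro set_eqI iffI)
  fix F assume "F \<in> range (blinfun_apply V)"
  then obtain f where F: "F = V f" by blast
  have "deriv (fock_fun F) (- \<beta> / \<alpha>) = fock_fun f (\<phi> (- \<beta> / \<alpha>)) * deriv g (- \<beta> / \<alpha>)"
    unfolding F by (rule DERIV_imp_deriv[OF V_deriv])
  then show "F \<in> {F. fock_fun F 0 = 0 \<and> deriv (fock_fun F) (- \<beta> / \<alpha>) = 0}"
    using deriv_g_eq_0_iff[of "- \<beta> / \<alpha>"] by (simp add: F V_0)
next
  fix F assume "F \<in> {F. fock_fun F 0 = 0 \<and> deriv (fock_fun F) (- \<beta> / \<alpha>) = 0}"
  then have F: "fock_fun F 0 = 0" "deriv (fock_fun F) (- \<beta> / \<alpha>) = 0" by auto
  have "\<alpha> * (- \<beta> / \<alpha>) + \<beta> = 0" using \<alpha> by simp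
  then obtain G where G: "\<And>z. fock_fun G z * (\<alpha> * z + \<beta>) = deriv (fock_fun F) z"
    using fock_deriv_divide[OF \<alpha> _ F(2)] by metis
  \<comment> \<open>The Weyl operator undoes the shift by b, and its exponential cancels the one in
    g'; the scalar normalizes so that f(z + b) = exp(cnj b z) G(z).\<close>
  define f where "f = exp (- ((complex_of_real (cmod b))\<^sup>2 / 2)) *\<^sub>C weyl b G"
  have f: "fock_fun f (\<phi> z) = exp (cnj b * z) * fock_fun G z" for z
  proof -
    have "- ((complex_of_real (cmod b))\<^sup>2 / 2) + (cnj b * (z + b) - (complex_of_real (cmod b))\<^sup>2 / 2)
        = cnj b * z + (cnj b * b - (complex_of_real (cmod b))\<^sup>2)"
      by (simp add: distrib_left)
    also have "cnj b * b = (complex_of_real (cmod b))\<^sup>2"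
      using complex_norm_square[of b] by (simp add: mult.commute)
    finally have "exp (- ((complex_of_real (cmod b))\<^sup>2 / 2)) * exp (cnj b * (z + b) - (complex_of_real (cmod b))\<^sup>2 / 2) = exp (cnj b * z)"
      by (simp flip: exp_add)
    then show ?thesis
      by (simp add: f_def \<phi>b fock_fun_weyl flip: mult.assoc)
  qed
  have "F = V f"
  proof (rule fock_eqI_deriv[where d = "deriv (fock_fun F)"])
    fix z
    show "(fock_fun F has_field_derivative deriv (fock_fun F) z) (at z)"
      by (rule fock_fun_field_derivative)
    have "exp (cnj b * z) * exp (- cnj b * z) = 1" by (simp flip: exp_add)
    moreover have "fock_fun f (\<phi> z) * deriv g z = (exp (cnj b * z) * exp (- cnj b * z)) * (fock_fun G z * (\<alpha> * z + \<beta>))"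
      by (simp add: f deriv_g mult_ac)
    ultimately have "fock_fun f (\<phi> z) * deriv g z = deriv (fock_fun F) z"
      by (simp only: G mult_1_left)
    then show "(fock_fun (V f) has_field_derivative deriv (fock_fun F) z) (at z)"
      using V_deriv[of f z] by simp
  qed (simp add: F V_0)
  then show "F \<in> range (blinfun_apply V)" by blast
qed

text \<open>Dividing the derivative of V f by g' shows that f vanishes except possibly at the image
  of the single zero of g', and continuity covers that point.\<close>

lemma kernel_V: "op_kernel V = {0}"
proof -
  have "f = 0" if "V f = 0" for f
  proof -
    define w where "w = \<phi> (- \<beta> / \<alpha>)"
    have zero: "fock_fun f u = 0" if "u \<noteq> w" for u
    proof -
      have "fock_fun f (\<phi> (u - b)) * deriv g (u - b) = deriv (fock_fun (V f)) (u - b)"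
        by (rule DERIV_imp_deriv[OF V_deriv, symmetric])
      also have "\<dots> = 0"
        using \<open>V f = 0\<close> by (simp add: zero_fock.rep_eq)
      finally have "fock_fun f u * deriv g (u - b) = 0"
        by (simp add: \<phi>b)
      moreover have "u - b \<noteq> - \<beta> / \<alpha>"
      proof
        assume "u - b = - \<beta> / \<alpha>"
        then have "u = - \<beta> / \<alpha> + b" by (simp only: diff_eq_eq)
        then show False using that by (simp add: w_def \<phi>b)
      qed
      ultimately show ?thesis
        using deriv_g_eq_0_iff[of "u - b"] by (simp only: mult_eq_0_iff) blast
    qed
    have "(fock_fun f \<longlongrightarrow> fock_fun f w) (at w)"
      using continuous_fock_fun[of UNIV f] by (auto simp: continuous_on_def)
    moreover have "(fock_fun f \<longlongrightarrow> 0) (at w)"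
      by (rule tendsto_eventually) (auto simp: eventually_at zero intro!: exI[of _ 1])
    ultimately have "fock_fun f w = 0"
      using tendsto_unique[OF trivial_limit_at] by blast
    then show ?thesis
      using zero by (intro fock_eqI) (metis fock_fun_0)
  qed
  then show ?thesis by (auto simp: op_kernel_def)
qed

text \<open>The range is the common null space of two continuous functionals, hence closed. The
  kernel of the adjoint is its orthogonal complement, spanned by the two representing vectors, so
  the index is 0 - 2.\<close>

lemma fredholm_V:
  assumes V: "V \<in> fock_operators"
  shows "fredholm V \<and> fredholm_index V = - 2"
proof -
  obtain K where K: "\<And>f. fock_fun f 0 = fock_inner f K"
    using fock_eval_riesz by metis
  obtain L where L: "\<And>f. deriv (fock_fun f) (- \<beta> / \<alpha>) = fock_inner f L"
    using fock_deriv_riesz by metis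
  have range: "range (blinfun_apply V) = {F. fock_inner F K = 0 \<and> fock_inner F L = 0}"
    by (simp only: range_V K L)
  have ip: "fock_inner fock_one K = 1" "fock_inner fock_one L = 0" "fock_inner fock_id K = 0" "fock_inner fock_id L = 1"
    by (simp_all flip: K L add: deriv_fock_one deriv_fock_id fock_fun_id)
  have "closed {F. fock_inner F p = 0}" for p
  proof -
    have "{F. fock_inner F p = 0} = {F. inner F p = 0} \<inter> {F. inner F (\<i> *\<^sub>C p) = 0}"
      by (auto simp: complex_eq_iff Re_fock_inner Im_fock_inner)
    also have "closed \<dots>"
      by (intro closed_Int closed_Collect_eq continuous_intros)
    finally show ?thesis .
  qed
  then have closed: "closed (range (blinfun_apply V))"
    unfolding range Collect_conj_eq by (intro closed_Int)
  have adj: "op_kernel (op_adjoint V) = {u. \<forall>f. fock_inner (V f) u = 0}"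
  proof (intro set_eqI iffI)
    fix u assume "u \<in> op_kernel (op_adjoint V)"
    then have "blinfun_apply (op_adjoint V) u = 0" by (simp add: op_kernel_def)
    then show "u \<in> {u. \<forall>f. fock_inner (V f) u = 0}"
      by (simp add: op_adjoint[OF V])
  next
    fix u assume "u \<in> {u. \<forall>f. fock_inner (V f) u = 0}"
    then have "fock_inner f (blinfun_apply (op_adjoint V) u) = fock_inner f 0" for f
      by (simp flip: op_adjoint[OF V])
    then have "blinfun_apply (op_adjoint V) u = 0" by (rule fock_inner_eqI)
    then show "u \<in> op_kernel (op_adjoint V)" by (simp add: op_kernel_def)
  qed
  have span: "op_kernel (op_adjoint V) = fock.span {K, L}"
  proof
    show "op_kernel (op_adjoint V) \<subseteq> fock.span {K, L}"
    proof
      fix u assume "u \<in> op_kernel (op_adjoint V)"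
      then have u: "fock_inner F u = 0" if "fock_inner F K = 0" "fock_inner F L = 0" for F
      proof -
        have "F \<in> range (blinfun_apply V)"
          unfolding range using that by simp
        then obtain f where "F = V f" by blast
        then show ?thesis
          using \<open>u \<in> op_kernel (op_adjoint V)\<close> by (simp add: adj)
      qed
      define v where "v = cnj (fock_inner fock_one u) *\<^sub>C K + cnj (fock_inner fock_id u) *\<^sub>C L"
      have "u = v"
      proof (rule fock_inner_eqI)
        fix f
        \<comment> \<open>Subtracting the combination of 1 and z with the same two functional values
          puts the remainder in the range of V, on which u vanishes.\<close>
        let ?F = "f - (fock_inner f K *\<^sub>C fock_one + fock_inner f L *\<^sub>C fock_id)"
        have "fock_inner ?F u = 0"
          by (rule u) (simp_all add: fock_inner_diff fock_inner_add fock_inner_scaleC ip)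
        then have "fock_inner f u = fock_inner f K * fock_inner fock_one u + fock_inner f L * fock_inner fock_id u"
          by (simp add: fock_inner_diff fock_inner_add fock_inner_scaleC)
        then show "fock_inner f u = fock_inner f v"
          by (simp add: v_def fock_inner_add_right fock_inner_scaleC_right mult.commute)
      qed
      moreover have "v \<in> fock.span {K, L}"
        unfolding v_def by (intro fock.span_add fock.span_scale fock.span_base) auto
      ultimately show "u \<in> fock.span {K, L}" by simp
    qed
    have "fock.subspace (op_kernel (op_adjoint V))"
      unfolding adj by (auto simp: fock.subspace_def fock_inner_add_right fock_inner_scaleC_right)
    moreover have "{K, L} \<subseteq> op_kernel (op_adjoint V)"
      using range by (auto simp: adj)
    ultimately show "fock.span {K, L} \<subseteq> op_kernel (op_adjoint V)"
      by (intro fock.span_minimal)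
  qed
  have "L \<notin> fock.span {K}"
  proof
    assume "L \<in> fock.span {K}"
    then obtain c where "L = c *\<^sub>C K"
      by (auto simp: fock.span_singleton)
    then show False using ip by (simp add: fock_inner_scaleC_right)
  qed
  moreover have "K \<noteq> 0"
    using ip(1) by auto
  moreover have "K \<noteq> L" using ip by auto
  ultimately have "fock.independent {K, L}" "card {K, L} = 2"
    by (auto simp: fock.independent_insert insert_commute[of K L])
  then have dim: "fock.dim (op_kernel (op_adjoint V)) = 2"
    unfolding span by (metis fock.dim_span_eq_card_independent)
  have "fin_dim (op_kernel (op_adjoint V))"
    unfolding fin_dim_def span by (intro exI[of _ "{K, L}"]) auto
  moreover have "fin_dim (op_kernel V)"
    unfolding fin_dim_def kernel_V by (intro exI[of _ "{}"]) auto
  moreover have "fock.dim (op_kernel V) = 0"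
    unfolding kernel_V using fock.dim_span_eq_card_independent[OF fock.independent_empty] by simp
  ultimately show ?thesis
    using V closed dim by (simp add: fredholm_def fredholm_index_def)
qed

end

end

theorem corollary3p26:
  fixes g \<phi> :: "complex \<Rightarrow> complex" and V :: "fock \<Rightarrow>\<^sub>L fock"
  assumes "g holomorphic_on UNIV" and "\<phi> holomorphic_on UNIV"
    and "\<And>f. fock_fun (blinfun_apply V f) = volterra g \<phi> (fock_fun f)"
    and "V \<in> toeplitz_algebra"
    and "\<not> compact_operator V"
  shows "fredholm V \<and> fredholm_index V = -2"
proof -
  interpret volterra_operator g \<phi> V
    by standard fact+
  show ?thesis
    using noncompact_imp_form[OF toeplitz_algebra_precompact_weyl_orbits(1)[OF assms(4)] assms(5)]
      fredholm_V[OF _ _ _ toeplitz_algebra_precompact_weyl_orbits(2)[OF assms(4)]]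
    by metis
qed

end
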